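(* Let $R$ be a ring in which $2$ is a primoid non-zerodivisor, and let $A$ be an $R$-algebra equipped with an $R$-module basis (with $n$ elements). Then $\mathrm{A}_n$-closure data for $A$ over $R$ correspond to square roots in $R$ of the discriminant of $A$ with respect to that basis.
   Context: All rings and algebras are commutative with 1. An element $p\in R$ is primoid if whenever $p^2$ divides a product $ab$ ($a,b\in R$), then $p$ divides $a$ or $b$. The discriminant of $A$ with respect to a basis $(\theta_1,\dots,\theta_n)$ is $\det(\mathrm{Tr}_{A/R}(\theta_i\theta_j))_{i,j}\in R$; a square root of $d\in R$ is an $r\in R$ with $r^2=d$. $A^{\otimes n}$ is the $n$-fold tensor power over $R$; for $a\in A$, $a^{(i)}\in A^{\otimes n}$ is the pure tensor with $a$ in position $i$ and $1$ elsewhere. $\mathrm{S}_n$ acts on $A^{\otimes n}$ by the $R$-algebra automorphisms with $\sigma\cdot a^{(i)}=a^{(\sigma(i))}$; $(A^{\otimes n})^{\mathrm{A}_n}$ is the subalgebra of invariants of the alternating group $\mathrm{A}_n$. $e_k(a)\in(A^{\otimes n})^{\mathrm{S}_n}$ is the $k$-th elementary symmetric polynomial in $a^{(1)},\dots,a^{(n)}$, and $s_k(a)\in R$ is defined by the characteristic polynomial of multiplication by $a$ on $A$: $\lambda^n-s_1(a)\lambda^{n-1}+\dots+(-1)^ns_n(a)$. An $\mathrm{A}_n$-closure datum for $A$ over $R$ is an $R$-algebra homomorphism $\varphi:(A^{\otimes n})^{\mathrm{A}_n}\to R$ with $\varphi(e_k(a))=s_k(a)$ for all $a\in A$, $1\le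 k\le n$.
   Formalization: The basis is assumed to have n ≥ 2 elements; for n = 0 or 1 and nonzero R the claim fails, since there is exactly one closure datum while the discriminant (1, or the square of a unit u) has at least two square roots. *)

theory Defs
  imports
    "HOL-Algebra.Divisibility"
    "HOL-Algebra.Module"
    "HOL-Algebra.QuotRing"
    "HOL-Algebra.UnivPoly"
    "HOL-Algebra.Sym_Groups"
begin

section \<open>Elements of the base ring\<close>

definition primoid :: "('a, 'm) ring_scheme \<Rightarrow> 'a \<Rightarrow> bool"
  where "primoid R p \<longleftrightarrow> p \<in> carrier R \<and>
    (\<forall>a\<in>carrier R. \<forall>b\<in>carrier R.
      (p [^]\<^bsub>R\<^esub> (2::nat)) divides\<^bsub>R\<^esub> (a \<otimes>\<^bsub>R\<^esub> b) \<longrightarrow> p divides\<^bsub>R\<^esub> a \<or> p divides\<^bsub>R\<^esub> b)"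

definition non_zero_divisor :: "('a, 'm) ring_scheme \<Rightarrow> 'a \<Rightarrow> bool"
  where "non_zero_divisor R p \<longleftrightarrow> p \<in> carrier R \<and>
    (\<forall>a\<in>carrier R. p \<otimes>\<^bsub>R\<^esub> a = \<zero>\<^bsub>R\<^esub> \<longrightarrow> a = \<zero>\<^bsub>R\<^esub>)"

definition two :: "('a, 'm) ring_scheme \<Rightarrow> 'a"
  where "two R = \<one>\<^bsub>R\<^esub> \<oplus>\<^bsub>R\<^esub> \<one>\<^bsub>R\<^esub>"

definition square_roots :: "('a, 'm) ring_scheme \<Rightarrow> 'a \<Rightarrow> 'a set"
  where "square_roots R d = {r \<in> carrier R. r [^]\<^bsub>R\<^esub> (2::nat) = d}"


section \<open>Bases, characteristic polynomials and discriminants\<close>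

text \<open>Matrices are functions of two indices, both running over \<open>{1..n}\<close>.\<close>

definition rdet :: "('a, 'm) ring_scheme \<Rightarrow> nat \<Rightarrow> (nat \<Rightarrow> nat \<Rightarrow> 'a) \<Rightarrow> 'a"
  where "rdet R n M =
    (\<Oplus>\<^bsub>R\<^esub>p\<in>{p. p permutes {1..n}}. [(sign p :: int)] \<cdot>\<^bsub>R\<^esub> (\<Otimes>\<^bsub>R\<^esub>i\<in>{1..n}. M i (p i)))"

definition module_basis ::
    "('a, 'm) ring_scheme \<Rightarrow> ('a, 'b, 'k) module_scheme \<Rightarrow> nat \<Rightarrow> (nat \<Rightarrow> 'b) \<Rightarrow> bool"
  where "module_basis R A n \<theta> \<longleftrightarrow>
    \<theta> \<in> {1..n} \<rightarrow> carrier A \<and>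
    (\<forall>a\<in>carrier A. \<exists>c\<in>{1..n} \<rightarrow> carrier R. a = (\<Oplus>\<^bsub>A\<^esub>i\<in>{1..n}. c i \<odot>\<^bsub>A\<^esub> \<theta> i)) \<and>
    (\<forall>c\<in>{1..n} \<rightarrow> carrier R.
      (\<Oplus>\<^bsub>A\<^esub>i\<in>{1..n}. c i \<odot>\<^bsub>A\<^esub> \<theta> i) = \<zero>\<^bsub>A\<^esub> \<longrightarrow> (\<forall>i\<in>{1..n}. c i = \<zero>\<^bsub>R\<^esub>))"

definition coords ::
    "('a, 'm) ring_scheme \<Rightarrow> ('a, 'b, 'k) module_scheme \<Rightarrow> nat \<Rightarrow> (nat \<Rightarrow> 'b) \<Rightarrow> 'b \<Rightarrow> nat \<Rightarrow> 'a"
  where "coords R A n \<theta> a =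
    (THE c. c \<in> {1..n} \<rightarrow>\<^sub>E carrier R \<and> a = (\<Oplus>\<^bsub>A\<^esub>i\<in>{1..n}. c i \<odot>\<^bsub>A\<^esub> \<theta> i))"

text \<open>The matrix of multiplication by \<open>a\<close>: column \<open>j\<close> holds the coordinates of \<open>a \<theta>\<^sub>j\<close>.
  Trace and characteristic polynomial computed from it do not depend on the basis.\<close>

definition mult_matrix ::
    "('a, 'm) ring_scheme \<Rightarrow> ('a, 'b, 'k) module_scheme \<Rightarrow> nat \<Rightarrow> (nat \<Rightarrow> 'b) \<Rightarrow> 'b \<Rightarrow>
      nat \<Rightarrow> nat \<Rightarrow> 'a"
  where "mult_matrix R A n \<theta> a i j = coords R A n \<theta> (a \<otimes>\<^bsub>A\<^esub> \<theta> j) i"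

definition algebra_trace ::
    "('a, 'm) ring_scheme \<Rightarrow> ('a, 'b, 'k) module_scheme \<Rightarrow> nat \<Rightarrow> (nat \<Rightarrow> 'b) \<Rightarrow> 'b \<Rightarrow> 'a"
  where "algebra_trace R A n \<theta> a = (\<Oplus>\<^bsub>R\<^esub>i\<in>{1..n}. mult_matrix R A n \<theta> a i i)"

definition discriminant ::
    "('a, 'm) ring_scheme \<Rightarrow> ('a, 'b, 'k) module_scheme \<Rightarrow> nat \<Rightarrow> (nat \<Rightarrow> 'b) \<Rightarrow> 'a"
  where "discriminant R A n \<theta> =
    rdet R n (\<lambda>i j. algebra_trace R A n \<theta> (\<theta> i \<otimes>\<^bsub>A\<^esub> \<theta> j))"

definition algebra_char_poly ::
    "('a, 'm) ring_scheme \<Rightarrow> ('a, 'b, 'k) module_scheme \<Rightarrow> nat \<Rightarrow> (nat \<Rightarrow> 'b) \<Rightarrow> 'b \<Rightarrow> nat \<Rightarrow> 'a"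
  where "algebra_char_poly R A n \<theta> a =
    rdet (UP R) n (\<lambda>i j. (if i = j then monom (UP R) \<one>\<^bsub>R\<^esub> 1 else \<zero>\<^bsub>UP R\<^esub>)
      \<ominus>\<^bsub>UP R\<^esub> monom (UP R) (mult_matrix R A n \<theta> a i j) 0)"

text \<open>\<open>s\<^sub>k(a)\<close>, the characteristic polynomial being
  \<open>\<lambda>\<^sup>n - s\<^sub>1(a) \<lambda>\<^sup>n\<^sup>-\<^sup>1 + \<dots> + (-1)\<^sup>n s\<^sub>n(a)\<close>; only meaningful for \<open>k \<le> n\<close>.\<close>

definition char_coeff ::
    "('a, 'm) ring_scheme \<Rightarrow> ('a, 'b, 'k) module_scheme \<Rightarrow> nat \<Rightarrow> (nat \<Rightarrow> 'b) \<Rightarrow> nat \<Rightarrow> 'b \<Rightarrow> 'a"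
  where "char_coeff R A n \<theta> k a =
    [((- 1) ^ k :: int)] \<cdot>\<^bsub>R\<^esub> coeff (UP R) (algebra_char_poly R A n \<theta> a) (n - k)"


section \<open>Tensor powers\<close>

text \<open>The tensor power is the free \<open>R\<close>-module on the set of \<open>n\<close>-tuples of elements of \<open>A\<close>,
  modulo multilinearity. The free module carries the product extending the componentwise product
  of tuples. A tuple times a multilinearity relation is again such a relation, so the submodule
  spanned by the relations is the ideal they generate, and the quotient ring below has the usual
  tensor product as its underlying module.\<close>

definition tuples :: "('a, 'b, 'k) module_scheme \<Rightarrow> nat \<Rightarrow> (nat \<Rightarrow> 'b) set"
  where "tuples A n = {1..n} \<rightarrow>\<^sub>E carrier A"

definition tuple_mult ::
    "('a, 'b, 'k) module_scheme \<Rightarrow> nat \<Rightarrow> (nat \<Rightarrow> 'b) \<Rightarrow> (nat \<Rightarrow> 'b) \<Rightarrow> nat \<Rightarrow> 'b"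
  where "tuple_mult A n u v = (\<lambda>i\<in>{1..n}. u i \<otimes>\<^bsub>A\<^esub> v i)"

definition free_gen :: "('a, 'm) ring_scheme \<Rightarrow> (nat \<Rightarrow> 'b) \<Rightarrow> (nat \<Rightarrow> 'b) \<Rightarrow> 'a"
  where "free_gen R t = (\<lambda>u. if u = t then \<one>\<^bsub>R\<^esub> else \<zero>\<^bsub>R\<^esub>)"

definition free_algebra ::
    "('a, 'm) ring_scheme \<Rightarrow> ('a, 'b, 'k) module_scheme \<Rightarrow> nat \<Rightarrow> ('a, (nat \<Rightarrow> 'b) \<Rightarrow> 'a) module"
  where "free_algebra R A n = \<lparr>
    carrier = {f. (\<forall>t. f t \<in> carrier R) \<and> (\<forall>t. t \<notin> tuples A n \<longrightarrow> f t = \<zero>\<^bsub>R\<^esub>) \<and>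
      finite {t. f t \<noteq> \<zero>\<^bsub>R\<^esub>}},
    mult = (\<lambda>f g t. \<Oplus>\<^bsub>R\<^esub>p\<in>{(u, v). f u \<noteq> \<zero>\<^bsub>R\<^esub> \<and> g v \<noteq> \<zero>\<^bsub>R\<^esub> \<and> tuple_mult A n u v = t}.
      f (fst p) \<otimes>\<^bsub>R\<^esub> g (snd p)),
    one = free_gen R (\<lambda>i\<in>{1..n}. \<one>\<^bsub>A\<^esub>),
    zero = (\<lambda>t. \<zero>\<^bsub>R\<^esub>),
    add = (\<lambda>f g t. f t \<oplus>\<^bsub>R\<^esub> g t),
    smult = (\<lambda>r f t. r \<otimes>\<^bsub>R\<^esub> f t)\<rparr>"

definition tensor_relations ::
    "('a, 'm) ring_scheme \<Rightarrow> ('a, 'b, 'k) module_scheme \<Rightarrow> nat \<Rightarrow> ((nat \<Rightarrow> 'b) \<Rightarrow> 'a) set"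
  where "tensor_relations R A n =
    (let F = free_algebra R A n in
      {free_gen R (t(i := a \<oplus>\<^bsub>A\<^esub> b)) \<ominus>\<^bsub>F\<^esub> (free_gen R (t(i := a)) \<oplus>\<^bsub>F\<^esub> free_gen R (t(i := b)))
        | t i a b. t \<in> tuples A n \<and> i \<in> {1..n} \<and> a \<in> carrier A \<and> b \<in> carrier A} \<union>
      {free_gen R (t(i := r \<odot>\<^bsub>A\<^esub> a)) \<ominus>\<^bsub>F\<^esub> (r \<odot>\<^bsub>F\<^esub> free_gen R (t(i := a)))
        | t i r a. t \<in> tuples A n \<and> i \<in> {1..n} \<and> r \<in> carrier R \<and> a \<in> carrier A})"

definition tensor_ideal ::
    "('a, 'm) ring_scheme \<Rightarrow> ('a, 'b, 'k) module_scheme \<Rightarrow> nat \<Rightarrow> ((nat \<Rightarrow> 'b) \<Rightarrow> 'a) set"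
  where "tensor_ideal R A n = genideal (free_algebra R A n) (tensor_relations R A n)"

definition tensor_power ::
    "('a, 'm) ring_scheme \<Rightarrow> ('a, 'b, 'k) module_scheme \<Rightarrow> nat \<Rightarrow>
      ('a, ((nat \<Rightarrow> 'b) \<Rightarrow> 'a) set) module"
  where "tensor_power R A n =
    (let F = free_algebra R A n; I = tensor_ideal R A n; Q = F Quot I in
      \<lparr>carrier = carrier Q, mult = mult Q, one = one Q, zero = zero Q, add = add Q,
       smult = (\<lambda>r X. \<Union>f\<in>X. I +>\<^bsub>F\<^esub> (r \<odot>\<^bsub>F\<^esub> f))\<rparr>)"

definition pure_tensor ::
    "('a, 'm) ring_scheme \<Rightarrow> ('a, 'b, 'k) module_scheme \<Rightarrow> nat \<Rightarrow> (nat \<Rightarrow> 'b) \<Rightarrow>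
      ((nat \<Rightarrow> 'b) \<Rightarrow> 'a) set"
  where "pure_tensor R A n t = tensor_ideal R A n +>\<^bsub>free_algebra R A n\<^esub> free_gen R t"

text \<open>\<open>a\<^sup>(\<^sup>i\<^sup>)\<close>\<close>

definition tensor_at ::
    "('a, 'm) ring_scheme \<Rightarrow> ('a, 'b, 'k) module_scheme \<Rightarrow> nat \<Rightarrow> nat \<Rightarrow> 'b \<Rightarrow>
      ((nat \<Rightarrow> 'b) \<Rightarrow> 'a) set"
  where "tensor_at R A n i a = pure_tensor R A n (\<lambda>j\<in>{1..n}. if j = i then a else \<one>\<^bsub>A\<^esub>)"

text \<open>On the free module, \<open>f \<mapsto> (\<lambda>t. f (t \<circ> \<sigma>))\<close> sends the generator \<open>t\<close> to the generator
  \<open>t \<circ> inv \<sigma>\<close>, that is, it moves the entry in position \<open>i\<close> to position \<open>\<sigma> i\<close>; so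
  \<open>\<sigma> \<cdot> a\<^sup>(\<^sup>i\<^sup>) = a\<^sup>(\<^sup>\<sigma>\<^sup>i\<^sup>)\<close>. A class in the quotient is mapped elementwise.\<close>

definition perm_act ::
    "(nat \<Rightarrow> nat) \<Rightarrow> ((nat \<Rightarrow> 'b) \<Rightarrow> 'a) set \<Rightarrow> ((nat \<Rightarrow> 'b) \<Rightarrow> 'a) set"
  where "perm_act \<sigma> X = (\<lambda>f t. f (t \<circ> \<sigma>)) ` X"

definition alt_invariants ::
    "('a, 'm) ring_scheme \<Rightarrow> ('a, 'b, 'k) module_scheme \<Rightarrow> nat \<Rightarrow>
      ('a, ((nat \<Rightarrow> 'b) \<Rightarrow> 'a) set) module"
  where "alt_invariants R A n = (tensor_power R A n)
    \<lparr>carrier := {X \<in> carrier (tensor_power R A n). \<forall>\<sigma>\<in>carrier (alt_group n). perm_act \<sigma> X = X}\<rparr>"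

definition elem_sym ::
    "('a, 'm) ring_scheme \<Rightarrow> ('a, 'b, 'k) module_scheme \<Rightarrow> nat \<Rightarrow> nat \<Rightarrow> 'b \<Rightarrow>
      ((nat \<Rightarrow> 'b) \<Rightarrow> 'a) set"
  where "elem_sym R A n k a =
    (\<Oplus>\<^bsub>tensor_power R A n\<^esub>S\<in>{S. S \<subseteq> {1..n} \<and> card S = k}.
      \<Otimes>\<^bsub>tensor_power R A n\<^esub>i\<in>S. tensor_at R A n i a)"


section \<open>Closure data\<close>

text \<open>Homomorphisms of \<open>R\<close>-algebras to \<open>R\<close>. They are made \<open>undefined\<close> off the carrier, so that
  equality of such functions is equality of homomorphisms.\<close>

definition algebra_homs_to_base ::
    "('a, 'm) ring_scheme \<Rightarrow> ('a, 'b, 'k) module_scheme \<Rightarrow> ('b \<Rightarrow> 'a) set"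
  where "algebra_homs_to_base R B = {\<phi> \<in> extensional (carrier B). \<phi> \<in> ring_hom B R \<and>
    (\<forall>r\<in>carrier R. \<forall>x\<in>carrier B. \<phi> (r \<odot>\<^bsub>B\<^esub> x) = r \<otimes>\<^bsub>R\<^esub> \<phi> x)}"

text \<open>The parameter \<open>\<theta>\<close> only serves to compute characteristic polynomials.\<close>

definition alt_closure_data ::
    "('a, 'm) ring_scheme \<Rightarrow> ('a, 'b, 'k) module_scheme \<Rightarrow> nat \<Rightarrow> (nat \<Rightarrow> 'b) \<Rightarrow>
      (((nat \<Rightarrow> 'b) \<Rightarrow> 'a) set \<Rightarrow> 'a) set"
  where "alt_closure_data R A n \<theta> = {\<phi> \<in> algebra_homs_to_base R (alt_invariants R A n).
    \<forall>a\<in>carrier A. \<forall>k\<in>{1..n}. \<phi> (elem_sym R A n k a) = char_coeff R A n \<theta> k a}"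

text \<open>The alternating element \<open>det (\<theta>\<^sub>j\<^sup>(\<^sup>i\<^sup>))\<close>. It is invariant under even permutations, and its
  square is the determinant of the matrix with entries \<open>e\<^sub>1(\<theta>\<^sub>i \<theta>\<^sub>j)\<close>, so closure data send it to a
  square root of the discriminant.\<close>

definition alt_element ::
    "('a, 'm) ring_scheme \<Rightarrow> ('a, 'b, 'k) module_scheme \<Rightarrow> nat \<Rightarrow> (nat \<Rightarrow> 'b) \<Rightarrow>
      ((nat \<Rightarrow> 'b) \<Rightarrow> 'a) set"
  where "alt_element R A n \<theta> = rdet (tensor_power R A n) n (\<lambda>i j. tensor_at R A n i (\<theta> j))"

end

theory Submission
  imports Defs
begin

text \<open>
  Write \<open>B\<close> for the \<open>n\<close>-fold tensor power of \<open>A\<close>. It is free over \<open>R\<close> on the pure tensors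
  \<open>E f = \<theta> (f 1) \<otimes> \<dots> \<otimes> \<theta> (f n)\<close>, where \<open>f\<close> runs over all self-maps of \<open>{1..n}\<close>, and a permutation
  moves the coordinate at \<open>f \<circ> \<sigma>\<close> to the coordinate at \<open>f\<close>. Everything is read off from these
  coordinates.

  The key is that \<open>2\<close> is a non-zero-divisor. If \<open>X\<close> is antisymmetric, that is, \<open>\<sigma>\<close> acts on it by the
  sign, then its coordinate at a map taking the same value twice equals its own negative, hence
  vanishes; so \<open>X\<close> is a multiple of the alternating element \<open>\<delta>\<close> (\<open>antisymmetric_multiple_delta\<close>).
  A symmetric tensor \<open>z\<close> times \<open>\<delta>\<close> is antisymmetric, so \<open>z \<delta> = \<Phi> z \<delta>\<close> for a scalar \<open>\<Phi> z\<close>, and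
  \<open>\<Phi>\<close> is an algebra homomorphism from symmetric tensors to \<open>R\<close>. Reading off the coordinate of
  \<open>e\<^sub>k(a) \<delta>\<close> at the identity gives the sum of the principal \<open>k\<close>-minors of the matrix of
  multiplication by \<open>a\<close>, which is \<open>s\<^sub>k(a)\<close> (\<open>Phi_elem_sym\<close>). As \<open>\<delta>\<^sup>2\<close> is the determinant of the matrix
  of the \<open>e\<^sub>1(\<theta>\<^sub>i \<theta>\<^sub>j)\<close>, its image under \<open>\<Phi>\<close> is the discriminant (\<open>acts_delta_square\<close>).

  Symmetric tensors are generated as an algebra by the \<open>e\<^sub>k(a)\<close> (\<open>symmetric_generated\<close>): an orbit sum
  is \<open>e\<^sub>k\<close> of one of its entries times an orbit sum with fewer entries, up to terms in which
  factors overlap, and those involve fewer positions. Hence every closure datum \<open>\<phi>\<close> agrees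
  with \<open>\<Phi>\<close> on symmetric tensors.

  For a tensor \<open>X\<close> invariant under even permutations, let \<open>X'\<close> be its image under a transposition.
  Then \<open>X + X'\<close> is symmetric and \<open>X - X' = s \<delta>\<close> is antisymmetric, so that
  \<open>2 \<phi>(X) = \<Phi>(X + X') + s \<phi>(\<delta>)\<close>. This shows that \<open>\<phi>\<close> is determined by \<open>\<phi>(\<delta>)\<close>, which is a square root
  of the discriminant. Conversely let \<open>r\<close> be such a root. The element \<open>u + v\<close> with \<open>u = \<Phi>(X + X')\<close> and
  \<open>v = s r\<close> is divisible by \<open>2\<close>, because \<open>(u + v) (u - v) = \<Phi>((X + X')\<^sup>2 - (X - X')\<^sup>2) = 4 \<Phi>(X X')\<close>,
  \<open>2\<close> is primoid, and the two factors differ by a multiple of \<open>2\<close> (\<open>half_exists\<close>). Its half defines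
  a closure datum sending \<open>\<delta>\<close> to \<open>r\<close>; multiplicativity follows by expanding \<open>X \<plusminus> X'\<close> and \<open>Y \<plusminus> Y'\<close>.
\<close>

section \<open>Finite sums and products\<close>

text \<open>The lemmas on commutative monoids serve for sums as well, since a ring is a commutative monoid
  under addition.\<close>

lemma (in comm_monoid) finprod_fibre:
  assumes "finite X" "finite Y" "h ` X \<subseteq> Y" "g \<in> X \<rightarrow> carrier G"
  shows "(\<Otimes>x\<in>X. g x) = (\<Otimes>y\<in>Y. \<Otimes>x\<in>{x \<in> X. h x = y}. g x)"
proof -
  have "X = (\<Union>y\<in>Y. {x \<in> X. h x = y})"
    using assms(3) by auto
  moreover have "(\<Otimes>x\<in>(\<Union>y\<in>Y. {x \<in> X. h x = y}). g x) = (\<Otimes>y\<in>Y. \<Otimes>x\<in>{x \<in> X. h x = y}. g x)"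
    using assms by (intro finprod_UN_disjoint) (auto simp: disjnt_def pairwise_def)
  ultimately show ?thesis by simp
qed

lemma (in comm_monoid) finprod_Times:
  assumes "finite X" "finite Y" "\<And>x y. x \<in> X \<Longrightarrow> y \<in> Y \<Longrightarrow> g x y \<in> carrier G"
  shows "(\<Otimes>p\<in>X \<times> Y. g (fst p) (snd p)) = (\<Otimes>x\<in>X. \<Otimes>y\<in>Y. g x y)"
proof -
  have "(\<Otimes>p\<in>X \<times> Y. g (fst p) (snd p)) = (\<Otimes>x\<in>X. \<Otimes>p\<in>{p \<in> X \<times> Y. fst p = x}. g (fst p) (snd p))"
    using assms by (intro finprod_fibre) auto
  also have "\<dots> = (\<Otimes>x\<in>X. \<Otimes>y\<in>Y. g x y)"
  proof (rule finprod_cong')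
    fix x assume x: "x \<in> X"
    have eq: "{p \<in> X \<times> Y. fst p = x} = Pair x ` Y"
      using x by auto
    show "(\<Otimes>p\<in>{p \<in> X \<times> Y. fst p = x}. g (fst p) (snd p)) = (\<Otimes>y\<in>Y. g x y)"
      unfolding eq using assms(3) x by (subst finprod_reindex) (auto simp: inj_on_def)
  qed (use assms(3) in auto)
  finally show ?thesis .
qed

lemma (in comm_monoid) finprod_swap:
  assumes "finite X" "finite Y" "\<And>x y. x \<in> X \<Longrightarrow> y \<in> Y \<Longrightarrow> g x y \<in> carrier G"
  shows "(\<Otimes>x\<in>X. \<Otimes>y\<in>Y. g x y) = (\<Otimes>y\<in>Y. \<Otimes>x\<in>X. g x y)"
  using assms(1,3)
proof (induction X)
  case (insert a X)
  have 1: "(\<Otimes>x\<in>insert a X. \<Otimes>y\<in>Y. g x y) = (\<Otimes>y\<in>Y. g a y) \<otimes> (\<Otimes>x\<in>X. \<Otimes>y\<in>Y. g x y)"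
    using insert by (intro finprod_insert) auto
  have 2: "(\<Otimes>y\<in>Y. \<Otimes>x\<in>insert a X. g x y) = (\<Otimes>y\<in>Y. g a y \<otimes> (\<Otimes>x\<in>X. g x y))"
    using insert by (intro finprod_cong' refl finprod_insert) auto
  have 3: "\<dots> = (\<Otimes>y\<in>Y. g a y) \<otimes> (\<Otimes>y\<in>Y. \<Otimes>x\<in>X. g x y)"
    using insert by (intro finprod_multf) auto
  show ?case
    unfolding 1 2 3 using insert by simp
qed simp

lemma (in cring) finprod_finsum_distrib:
  assumes "finite I" "finite K" "\<And>i k. i \<in> I \<Longrightarrow> k \<in> K \<Longrightarrow> g i k \<in> carrier R"
  shows "(\<Otimes>i\<in>I. \<Oplus>k\<in>K. g i k) = (\<Oplus>f\<in>I \<rightarrow>\<^sub>E K. \<Otimes>i\<in>I. g i (f i))"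
  using assms(1,3)
proof (induction I)
  case empty
  show ?case by (simp add: finsum_insert finsum_empty)
next
  case (insert a I)
  \<comment> \<open>A choice on \<open>insert a I\<close> is a choice at \<open>a\<close> together with one on \<open>I\<close>.\<close>
  let ?h = "\<lambda>(y, f). f(a := y)"
  have fin: "finite (I \<rightarrow>\<^sub>E K)"
    using insert.hyps assms(2) by (intro finite_PiE) auto
  have inj: "inj_on ?h (K \<times> (I \<rightarrow>\<^sub>E K))"
    using insert.hyps(2) by (rule inj_combinator)
  have pc: "(\<Otimes>i\<in>I. g i (f i)) \<in> carrier R" if "f \<in> I \<rightarrow>\<^sub>E K" for f
    using insert.prems that by (intro finprod_closed) auto
  have "(\<Oplus>f\<in>insert a I \<rightarrow>\<^sub>E K. \<Otimes>i\<in>insert a I. g i (f i))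
      = (\<Oplus>p\<in>K \<times> (I \<rightarrow>\<^sub>E K). \<Otimes>i\<in>insert a I. g i (?h p i))"
    unfolding PiE_insert_eq using inj
    by (intro finsum_reindex) (auto simp: Pi_iff PiE_mem intro!: finprod_closed insert.prems)
  also have "\<dots> = (\<Oplus>p\<in>K \<times> (I \<rightarrow>\<^sub>E K). g a (fst p) \<otimes> (\<Otimes>i\<in>I. g i (snd p i)))"
  proof (rule finsum_cong')
    fix p assume p: "p \<in> K \<times> (I \<rightarrow>\<^sub>E K)"
    have "(\<Otimes>i\<in>insert a I. g i (?h p i)) = g a (?h p a) \<otimes> (\<Otimes>i\<in>I. g i (?h p i))"
      using insert.hyps p by (intro finprod_insert) (auto simp: Pi_iff PiE_mem intro!: insert.prems)
    also have "(\<Otimes>i\<in>I. g i (?h p i)) = (\<Otimes>i\<in>I. g i (snd p i))"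
      using insert.hyps p by (intro finprod_cong') (auto simp: Pi_iff PiE_mem intro!: insert.prems)
    finally show "(\<Otimes>i\<in>insert a I. g i (?h p i)) = g a (fst p) \<otimes> (\<Otimes>i\<in>I. g i (snd p i))"
      by (simp add: split_beta)
  qed (use insert.prems pc in auto)
  also have "\<dots> = (\<Oplus>k\<in>K. \<Oplus>f\<in>I \<rightarrow>\<^sub>E K. g a k \<otimes> (\<Otimes>i\<in>I. g i (f i)))"
    using insert.prems pc assms(2) fin by (intro add.finprod_Times[folded finsum_def]) auto
  also have "\<dots> = (\<Oplus>k\<in>K. g a k \<otimes> (\<Oplus>f\<in>I \<rightarrow>\<^sub>E K. \<Otimes>i\<in>I. g i (f i)))"
    using insert.prems pc fin by (intro finsum_cong' refl finsum_rdistr[symmetric]) auto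
  also have "\<dots> = (\<Oplus>k\<in>K. g a k) \<otimes> (\<Oplus>f\<in>I \<rightarrow>\<^sub>E K. \<Otimes>i\<in>I. g i (f i))"
    using insert.prems pc assms(2) by (intro finsum_ldistr[symmetric]) auto
  also have "\<dots> = (\<Otimes>i\<in>insert a I. \<Oplus>k\<in>K. g i k)"
    using insert by (subst finprod_insert) auto
  finally show ?case by simp
qed

lemma (in cring) finprod_add_distrib:
  assumes "finite I" "u \<in> I \<rightarrow> carrier R" "v \<in> I \<rightarrow> carrier R"
  shows "(\<Otimes>i\<in>I. u i \<oplus> v i) = (\<Oplus>S\<in>Pow I. (\<Otimes>i\<in>S. u i) \<otimes> (\<Otimes>i\<in>I - S. v i))"
  using assms
proof (induction I)
  case empty
  show ?case by (simp add: finsum_insert finsum_empty)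
next
  case (insert a I)
  let ?t = "\<lambda>I S. (\<Otimes>i\<in>S. u i) \<otimes> (\<Otimes>i\<in>I - S. v i)"
  have tc: "(\<Otimes>i\<in>S. u i) \<otimes> (\<Otimes>i\<in>J. v i) \<in> carrier R" if "S \<subseteq> insert a I" "J \<subseteq> insert a I" for S J
    using that insert.prems by (intro m_closed finprod_closed) auto
  have fin: "finite S" if "S \<in> Pow I" for S
    using that insert.hyps finite_subset by auto
  have split: "(\<Oplus>S\<in>Pow (insert a I). ?t (insert a I) S)
      = (\<Oplus>S\<in>Pow I. ?t (insert a I) S) \<oplus> (\<Oplus>S\<in>insert a ` Pow I. ?t (insert a I) S)"
    unfolding Pow_insert using insert.hyps by (intro finsum_Un_disjoint) (auto intro!: tc)
  have A: "(\<Oplus>S\<in>Pow I. ?t (insert a I) S) = (\<Oplus>S\<in>Pow I. v a \<otimes> ?t I S)"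
  proof (rule finsum_cong')
    fix S assume S: "S \<in> Pow I"
    have eq: "insert a I - S = insert a (I - S)"
      using S insert.hyps by auto
    have "(\<Otimes>i\<in>insert a I - S. v i) = v a \<otimes> (\<Otimes>i\<in>I - S. v i)"
      unfolding eq using insert by (intro finprod_insert) auto
    moreover have "(\<Otimes>i\<in>S. u i) \<in> carrier R" "(\<Otimes>i\<in>I - S. v i) \<in> carrier R" "v a \<in> carrier R"
      using S insert.prems by (auto intro!: finprod_closed)
    ultimately show "?t (insert a I) S = v a \<otimes> ?t I S"
      by (simp add: m_lcomm)
  qed (use insert.prems in \<open>auto intro!: m_closed[OF _ tc]\<close>)
  have "(\<Oplus>S\<in>insert a ` Pow I. ?t (insert a I) S) = (\<Oplus>S\<in>Pow I. ?t (insert a I) (insert a S))"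
    using insert.hyps
    by (intro finsum_reindex) (auto simp: inj_on_def intro!: tc dest: insert_ident[THEN iffD1, rotated 2])
  also have "\<dots> = (\<Oplus>S\<in>Pow I. u a \<otimes> ?t I S)"
  proof (rule finsum_cong')
    fix S assume S: "S \<in> Pow I"
    have eq: "insert a I - insert a S = I - S"
      using S insert.hyps by auto
    have "(\<Otimes>i\<in>insert a S. u i) = u a \<otimes> (\<Otimes>i\<in>S. u i)"
      using S fin[OF S] insert by (intro finprod_insert) auto
    moreover have "(\<Otimes>i\<in>S. u i) \<in> carrier R" "(\<Otimes>i\<in>I - S. v i) \<in> carrier R" "u a \<in> carrier R"
      using S insert.prems by (auto intro!: finprod_closed)
    ultimately show "?t (insert a I) (insert a S) = u a \<otimes> ?t I S"
      unfolding eq by (simp add: m_assoc)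
  qed (use insert.prems in \<open>auto intro!: m_closed[OF _ tc]\<close>)
  finally have B: "(\<Oplus>S\<in>insert a ` Pow I. ?t (insert a I) S) = (\<Oplus>S\<in>Pow I. u a \<otimes> ?t I S)" .
  have uv: "u a \<in> carrier R" "v a \<in> carrier R" and sc: "(\<Oplus>S\<in>Pow I. ?t I S) \<in> carrier R"
    using insert.prems tc by (auto intro!: finsum_closed tc)
  have C: "(\<Oplus>S\<in>Pow I. c \<otimes> ?t I S) = c \<otimes> (\<Oplus>S\<in>Pow I. ?t I S)" if "c \<in> carrier R" for c
    using that insert.hyps by (intro finsum_rdistr[symmetric]) (auto intro!: tc)
  have "(\<Otimes>i\<in>insert a I. u i \<oplus> v i) = (u a \<oplus> v a) \<otimes> (\<Otimes>i\<in>I. u i \<oplus> v i)"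
    using insert by (intro finprod_insert) auto
  also have "\<dots> = (u a \<oplus> v a) \<otimes> (\<Oplus>S\<in>Pow I. ?t I S)"
    using insert by simp
  also have "\<dots> = (\<Oplus>S\<in>Pow (insert a I). ?t (insert a I) S)"
    unfolding split A B C[OF uv(1)] C[OF uv(2)] using uv sc by (simp add: l_distr a_comm)
  finally show ?case .
qed

lemma (in abelian_group) sign_act:
  assumes "x \<in> carrier G"
  shows "[sign p] \<cdot> x = (if evenperm p then x else \<ominus> x)"
proof -
  have "[(1::int)] \<cdot> x = x" "[(- 1::int)] \<cdot> x = \<ominus> x"
    using assms by (simp_all add: add_pow_int_ge add_pow_int_lt add.nat_pow_eone)
  then show ?thesis
    by (simp add: sign_def)
qed

lemma (in abelian_group) sign_act_closed [simp]:
  "x \<in> carrier G \<Longrightarrow> [sign p] \<cdot> x \<in> carrier G"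
  by (simp add: sign_act)

lemma (in abelian_group) finsum_neg:
  assumes "x \<in> K \<rightarrow> carrier G" "finite K"
  shows "(\<Oplus>k\<in>K. \<ominus> x k) = \<ominus> (\<Oplus>k\<in>K. x k)"
  using assms(2,1)
proof (induction K)
  case empty
  have "\<zero> = \<ominus> \<zero>"
    by (rule minus_equality[symmetric]) simp_all
  then show ?case by (simp only: finsum_empty)
next
  case (insert k K)
  then show ?case
    by (subst (1 2) finsum_insert) (auto simp: minus_add Pi_iff finsum_closed)
qed

lemma (in abelian_group) sign_act_finsum:
  assumes "x \<in> K \<rightarrow> carrier G" "finite K"
  shows "[sign p] \<cdot> (\<Oplus>k\<in>K. x k) = (\<Oplus>k\<in>K. [sign p] \<cdot> x k)"
proof -
  have "(\<Oplus>k\<in>K. [sign p] \<cdot> x k) = (\<Oplus>k\<in>K. if evenperm p then x k else \<ominus> x k)"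
    using assms by (intro finsum_cong') (auto simp: sign_act Pi_iff)
  then show ?thesis
    using assms finsum_neg[OF assms] by (auto simp: sign_act finsum_closed)
qed

section \<open>Self-maps and permutations of a finite set\<close>

text \<open>Positions are the elements of \<open>{1..n}\<close>; rewriting \<open>1\<close> to \<open>Suc 0\<close> would hide this shape from
  the lemmas about them.\<close>

declare One_nat_def [simp del]

lemma PiE_comp_permutes:
  assumes "\<sigma> permutes S" "t \<in> S \<rightarrow>\<^sub>E U"
  shows "t \<circ> \<sigma> \<in> S \<rightarrow>\<^sub>E U"
proof (rule PiE_I)
  fix i assume "i \<in> S"
  then show "(t \<circ> \<sigma>) i \<in> U"
    using PiE_mem[OF assms(2)] permutes_in_image[OF assms(1), of i] by simp
next
  fix i assume "i \<notin> S"
  then show "(t \<circ> \<sigma>) i = undefined"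
    using assms(2) permutes_not_in[OF assms(1)] by (simp add: PiE_def extensional_def)
qed

lemma comp_inv_permutes:
  assumes "\<sigma> permutes S"
  shows "t \<circ> \<sigma> \<circ> inv' \<sigma> = t" "t \<circ> inv' \<sigma> \<circ> \<sigma> = t"
  using permutes_inv_o[OF assms] by (simp_all add: comp_assoc)

lemma restrict_permutes_PiE: "p permutes S \<Longrightarrow> restrict p S \<in> S \<rightarrow>\<^sub>E S"
  by (auto simp: permutes_in_image)

lemma restrict_permutes_inj: "inj_on (\<lambda>p. restrict p S) {p. p permutes S}"
proof (rule inj_onI, rule ext)
  fix p q x assume pq: "p \<in> {p. p permutes S}" "q \<in> {p. p permutes S}" "restrict p S = restrict q S"
  show "p x = q x"
    using fun_cong[OF pq(3), of x] pq(1,2) by (cases "x \<in> S") (auto simp: permutes_not_in)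
qed

lemma restrict_comp_permutes:
  "q permutes S \<Longrightarrow> restrict p S \<circ> q = restrict (p \<circ> q) S"
  by (auto simp: fun_eq_iff restrict_def permutes_in_image)

text \<open>A self-map of a finite set is a permutation or identifies two points. In the second case the
  transposition of these points fixes it; this is the form in which antisymmetry is
  exploited.\<close>

lemma self_map_cases:
  assumes "finite S" "f \<in> S \<rightarrow>\<^sub>E S"
  obtains (perm) p where "p permutes S" "f = restrict p S"
  | (collision) i k where "i \<in> S" "k \<in> S" "i \<noteq> k" "f \<circ> transpose i k = f"
proof (cases "inj_on f S")
  case True
  have im: "f ` S \<subseteq> S" using assms(2) by auto
  then have "f ` S = S"
    using assms(1) True by (simp add: endo_inj_surj)
  then have b: "bij_betw f S S"
    using True by (simp add: bij_betw_def)
  define p where "p = (\<lambda>x. if x \<in> S then f x else x)"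
  have "bij_betw p S S"
    using b by (subst bij_betw_cong[of _ _ f]) (auto simp: p_def)
  then have "p permutes S"
    by (intro bij_imp_permutes) (auto simp: p_def)
  moreover have "f = restrict p S"
    using assms(2) by (auto simp: p_def fun_eq_iff restrict_def PiE_def extensional_def)
  ultimately show ?thesis by (rule perm)
next
  case False
  then obtain i k where "i \<in> S" "k \<in> S" "i \<noteq> k" "f i = f k"
    by (auto simp: inj_on_def)
  moreover from this have "f \<circ> transpose i k = f"
    by (auto simp: fun_eq_iff transpose_def)
  ultimately show ?thesis using collision by blast
qed

lemma self_map_collision_not_perm:
  assumes "p permutes S" "i \<in> S" "k \<in> S" "i \<noteq> k"
  shows "restrict p S \<circ> transpose i k \<noteq> restrict p S"
proof
  assume "restrict p S \<circ> transpose i k = restrict p S"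
  then have "restrict p S (transpose i k i) = restrict p S i"
    by (metis comp_apply)
  then show False using assms permutes_inj[OF assms(1)] by (auto dest: injD)
qed

lemma sign_compose_permutes:
  "finite S \<Longrightarrow> p permutes S \<Longrightarrow> q permutes S \<Longrightarrow> evenperm (p \<circ> q) \<longleftrightarrow> (evenperm p \<longleftrightarrow> evenperm q)"
  by (intro evenperm_comp) (auto simp: permutation_permutes)

lemma (in abelian_group) sign_act_twice:
  assumes "x \<in> carrier G" "finite S" "p permutes S" "q permutes S"
  shows "[sign (p \<circ> q)] \<cdot> x = [sign q] \<cdot> ([sign p] \<cdot> x)"
  using assms sign_compose_permutes[OF assms(2-4)] by (auto simp: sign_act)

section \<open>Determinants\<close>

lemma (in cring) rdet_closed:
  assumes "\<And>i j. i \<in> {1..n} \<Longrightarrow> j \<in> {1..n} \<Longrightarrow> M i j \<in> carrier R"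
  shows "rdet R n M \<in> carrier R"
  unfolding rdet_def using assms
  by (auto intro!: finsum_closed sign_act_closed finprod_closed simp: permutes_in_image simp del: atLeastAtMost_iff)

text \<open>Permuting the rows of the matrix with rows \<open>M (f i)\<close> amounts to composing \<open>f\<close> with a permutation.
  Here \<open>f\<close> may be any self-map, so repeated rows are included.\<close>

lemma (in cring) row_map_det_comp:
  assumes M: "\<And>i j. i \<in> {1..n} \<Longrightarrow> j \<in> {1..n} \<Longrightarrow> M i j \<in> carrier R"
    and f: "f \<in> {1..n} \<rightarrow>\<^sub>E {1..n}" and q: "q permutes {1..n}"
  shows "rdet R n (\<lambda>i j. M ((f \<circ> q) i) j) = [sign q] \<cdot> rdet R n (\<lambda>i j. M (f i) j)"
proof -
  let ?P = "{p. p permutes {1..n}}"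
  have fin: "finite ?P" by (simp add: finite_permutations)
  have fi: "f i \<in> {1..n}" if "i \<in> {1..n}" for i
    using PiE_mem[OF f that] .
  have pin: "p i \<in> {1..n}" if "p permutes {1..n}" "i \<in> {1..n}" for p i
    using that by (simp only: permutes_in_image)
  have c: "(\<Otimes>i\<in>{1..n}. M (f i) (p i)) \<in> carrier R" if "p permutes {1..n}" for p
    using M fi pin[OF that] by (intro finprod_closed Pi_I) auto
  have qP: "bij_betw (\<lambda>p. p \<circ> q) ?P ?P"
    by (rule bij_betw_byWitness[of _ "\<lambda>p. p \<circ> inv' q"])
      (auto simp: comp_inv_permutes[OF q] permutes_compose q permutes_inv)
  have "rdet R n (\<lambda>i j. M ((f \<circ> q) i) j)
      = (\<Oplus>p\<in>(\<lambda>p. p \<circ> q) ` ?P. [sign p] \<cdot> (\<Otimes>i\<in>{1..n}. M ((f \<circ> q) i) (p i)))"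
    unfolding rdet_def bij_betw_imp_surj_on[OF qP] ..
  also have "\<dots> = (\<Oplus>p\<in>?P. [sign (p \<circ> q)] \<cdot> (\<Otimes>i\<in>{1..n}. M ((f \<circ> q) i) ((p \<circ> q) i)))"
  proof (rule finsum_reindex[OF _ bij_betw_imp_inj_on[OF qP]], unfold bij_betw_imp_surj_on[OF qP], rule Pi_I)
    fix p assume "p \<in> ?P"
    then show "[sign p] \<cdot> (\<Otimes>i\<in>{1..n}. M ((f \<circ> q) i) (p i)) \<in> carrier R"
      using M fi pin q by (intro sign_act_closed finprod_closed Pi_I) auto
  qed
  also have "\<dots> = (\<Oplus>p\<in>?P. [sign q] \<cdot> ([sign p] \<cdot> (\<Otimes>i\<in>{1..n}. M (f i) (p i))))"
  proof (rule finsum_cong')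
    fix p assume p: "p \<in> ?P"
    have im: "q ` {1..n} = {1..n}" by (rule permutes_image[OF q])
    have "(\<Otimes>i\<in>{1..n}. M (f i) (p i)) = (\<Otimes>i\<in>q ` {1..n}. M (f i) (p i))"
      unfolding im ..
    also have "\<dots> = (\<Otimes>i\<in>{1..n}. M (f (q i)) (p (q i)))"
      using M fi pin p permutes_inj_on[OF q] by (intro finprod_reindex) (auto simp: im)
    finally show "[sign (p \<circ> q)] \<cdot> (\<Otimes>i\<in>{1..n}. M ((f \<circ> q) i) ((p \<circ> q) i))
        = [sign q] \<cdot> ([sign p] \<cdot> (\<Otimes>i\<in>{1..n}. M (f i) (p i)))"
      using c[of p] p sign_compose_permutes[OF _ _ q, of p] by (simp add: sign_act)
  qed (use c in auto)
  also have "\<dots> = [sign q] \<cdot> rdet R n (\<lambda>i j. M (f i) j)"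
    unfolding rdet_def using c fin by (intro sign_act_finsum[symmetric]) auto
  finally show ?thesis .
qed

text \<open>The form in which a non-zero-divisor \<open>2\<close> kills antisymmetric quantities.\<close>

lemma (in cring) two_cancel:
  assumes "non_zero_divisor R (two R)" "x \<in> carrier R" "x = \<ominus> x"
  shows "x = \<zero>"
proof -
  have "two R \<otimes> x = x \<oplus> x"
    using assms(2) by (simp add: two_def l_distr)
  also have "\<dots> = \<zero>"
    using assms(2,3) by (metis r_neg)
  finally show ?thesis
    using assms(1,2) by (simp add: non_zero_divisor_def)
qed

text \<open>The identity \<open>det (M\<^sup>T M) = (det M)\<^sup>2\<close>. Expanding the products of sums gives a sum over all
  self-maps \<open>f\<close> of \<open>\<Prod>\<^sub>j M (f j) j\<close> times the determinant of the matrix with rows \<open>M (f j)\<close>. If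
  \<open>f\<close> takes a value twice, that determinant equals its own negative and therefore vanishes; if
  \<open>f\<close> is a permutation, it is \<open>det M\<close> up to the sign, and the remaining sum is again \<open>det M\<close>.\<close>

lemma (in cring) rdet_gram:
  assumes M: "\<And>i j. i \<in> {1..n} \<Longrightarrow> j \<in> {1..n} \<Longrightarrow> M i j \<in> carrier R"
    and two: "non_zero_divisor R (two R)"
  shows "rdet R n (\<lambda>j k. \<Oplus>i\<in>{1..n}. M i j \<otimes> M i k) = rdet R n M \<otimes> rdet R n M"
proof -
  let ?P = "{p. p permutes {1..n}}" and ?J = "{1..n} \<rightarrow>\<^sub>E {1..n}"
  have fin: "finite ?P" "finite ?J" by (simp_all add: finite_permutations finite_PiE)
  have fi: "f i \<in> {1..n}" if "f \<in> ?J" "i \<in> {1..n}" for f i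
    using PiE_mem[OF that] .
  have pin: "p i \<in> {1..n}" if "p permutes {1..n}" "i \<in> {1..n}" for p i
    using that by (simp only: permutes_in_image)
  have invin: "inv' p i \<in> {1..n}" if "p permutes {1..n}" "i \<in> {1..n}" for p i
    using pin[OF permutes_inv[OF that(1)] that(2)] .
  define D where "D f = rdet R n (\<lambda>i j. M (f i) j)" for f
  define d where "d f = (\<Otimes>j\<in>{1..n}. M (f j) j)" for f
  have Dc: "D f \<in> carrier R" and dc: "d f \<in> carrier R"
    and tc: "p permutes {1..n} \<Longrightarrow> (\<Otimes>j\<in>{1..n}. M (f j) (p j)) \<in> carrier R" if "f \<in> ?J" for f p
    unfolding D_def d_def using M fi[OF that] pin
    by (auto intro!: rdet_closed finprod_closed simp del: atLeastAtMost_iff)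
  have "rdet R n (\<lambda>j k. \<Oplus>i\<in>{1..n}. M i j \<otimes> M i k)
      = (\<Oplus>p\<in>?P. \<Oplus>f\<in>?J. d f \<otimes> ([sign p] \<cdot> (\<Otimes>j\<in>{1..n}. M (f j) (p j))))"
    unfolding rdet_def
  proof (rule finsum_cong')
    fix p assume p: "p \<in> ?P"
    have "(\<Otimes>j\<in>{1..n}. \<Oplus>i\<in>{1..n}. M i j \<otimes> M i (p j))
        = (\<Oplus>f\<in>?J. \<Otimes>j\<in>{1..n}. M (f j) j \<otimes> M (f j) (p j))"
      using M pin p by (intro finprod_finsum_distrib) auto
    also have "\<dots> = (\<Oplus>f\<in>?J. d f \<otimes> (\<Otimes>j\<in>{1..n}. M (f j) (p j)))"
      unfolding d_def using M pin p fi
      by (intro finsum_cong' refl finprod_multf Pi_I m_closed finprod_closed) (auto simp del: atLeastAtMost_iff)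
    finally have e: "(\<Otimes>j\<in>{1..n}. \<Oplus>i\<in>{1..n}. M i j \<otimes> M i (p j)) = \<dots>" .
    have "[sign p] \<cdot> (\<Otimes>j\<in>{1..n}. \<Oplus>i\<in>{1..n}. M i j \<otimes> M i (p j))
        = (\<Oplus>f\<in>?J. [sign p] \<cdot> (d f \<otimes> (\<Otimes>j\<in>{1..n}. M (f j) (p j))))"
      unfolding e using dc tc p fin by (intro sign_act_finsum) auto
    also have "\<dots> = (\<Oplus>f\<in>?J. d f \<otimes> ([sign p] \<cdot> (\<Otimes>j\<in>{1..n}. M (f j) (p j))))"
      using dc tc p by (intro finsum_cong') (auto simp: sign_act r_minus)
    finally show "[sign p] \<cdot> (\<Otimes>j\<in>{1..n}. \<Oplus>i\<in>{1..n}. M i j \<otimes> M i (p j))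
        = (\<Oplus>f\<in>?J. d f \<otimes> ([sign p] \<cdot> (\<Otimes>j\<in>{1..n}. M (f j) (p j))))" .
  qed (use dc tc in \<open>auto intro!: finsum_closed\<close>)
  also have "\<dots> = (\<Oplus>f\<in>?J. \<Oplus>p\<in>?P. d f \<otimes> ([sign p] \<cdot> (\<Otimes>j\<in>{1..n}. M (f j) (p j))))"
    using dc tc fin by (intro add.finprod_swap[folded finsum_def]) auto
  also have "\<dots> = (\<Oplus>f\<in>?J. d f \<otimes> D f)"
    unfolding D_def rdet_def using dc tc fin
    by (intro finsum_cong' refl finsum_rdistr[symmetric] Pi_I m_closed finsum_closed) auto
  also have "\<dots> = (\<Oplus>f\<in>(\<lambda>p. restrict p {1..n}) ` ?P. d f \<otimes> D f)"
  proof (rule add.finprod_mono_neutral_cong_right[folded finsum_def])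
    show "d f \<otimes> D f = \<zero>" if f: "f \<in> ?J - (\<lambda>p. restrict p {1..n}) ` ?P" for f
    proof -
      obtain i k where ik: "i \<in> {1..n}" "k \<in> {1..n}" "i \<noteq> k" "f \<circ> transpose i k = f"
        by (rule self_map_cases[of "{1..n}" f]) (use f in auto)
      have tr: "transpose i k permutes {1..n}" using ik by (intro permutes_swap_id)
      have "D f = [sign (transpose i k)] \<cdot> D f"
        using row_map_det_comp[where f = f, OF M _ tr] f ik(4) by (simp add: D_def)
      also have "\<dots> = \<ominus> D f"
        using ik(3) f Dc by (simp add: sign_act evenperm_swap)
      finally have "D f = \<zero>"
        using f Dc by (intro two_cancel two) auto
      then show ?thesis using f dc by simp
    qed
  qed (use fin dc Dc pin in \<open>auto simp del: atLeastAtMost_iff\<close>)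
  also have "\<dots> = (\<Oplus>p\<in>?P. d (restrict p {1..n}) \<otimes> D (restrict p {1..n}))"
    using dc Dc pin restrict_permutes_inj
    by (intro finsum_reindex) (auto simp del: atLeastAtMost_iff)
  also have "\<dots> = (\<Oplus>p\<in>?P. ([sign (inv' p)] \<cdot> (\<Otimes>i\<in>{1..n}. M i (inv' p i))) \<otimes> rdet R n M)"
  proof (rule finsum_cong')
    fix p assume "p \<in> ?P"
    then have p: "p permutes {1..n}" by simp
    have idJ: "restrict id {1..n} \<in> ?J" by auto
    have det: "D (restrict id {1..n}) = rdet R n M"
      unfolding D_def rdet_def using M pin
      by (intro finsum_cong' refl arg_cong[where f = "add_pow R _"] finprod_cong' sign_act_closed finprod_closed Pi_I)
         (auto simp del: atLeastAtMost_iff)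
    have detc: "rdet R n M \<in> carrier R"
      using M by (rule rdet_closed)
    have "D (restrict id {1..n} \<circ> p) = [sign p] \<cdot> D (restrict id {1..n})"
      unfolding D_def by (rule row_map_det_comp[OF _ idJ p]) (rule M)
    then have "D (restrict p {1..n}) = [sign p] \<cdot> rdet R n M"
      unfolding restrict_comp_permutes[OF p] det by simp
    moreover have "d (restrict p {1..n}) = (\<Otimes>i\<in>{1..n}. M i (inv' p i))"
    proof -
      have im: "p ` {1..n} = {1..n}" by (rule permutes_image[OF p])
      have "(\<Otimes>i\<in>{1..n}. M i (inv' p i)) = (\<Otimes>i\<in>p ` {1..n}. M i (inv' p i))"
        unfolding im ..
      also have "\<dots> = (\<Otimes>i\<in>{1..n}. M (p i) (inv' p (p i)))"
        using M pin[OF permutes_inv[OF p]] permutes_inj_on[OF p]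
        by (intro finprod_reindex) (auto simp: im simp del: atLeastAtMost_iff)
      also have "\<dots> = d (restrict p {1..n})"
        unfolding d_def using M pin[OF p]
        by (intro finprod_cong') (auto simp: permutes_inverses[OF p] simp del: atLeastAtMost_iff)
      finally show ?thesis by simp
    qed
    moreover have "(\<Otimes>i\<in>{1..n}. M i (inv' p i)) \<in> carrier R"
      using M pin[OF permutes_inv[OF p]] by (intro finprod_closed) (auto simp del: atLeastAtMost_iff)
    moreover have "evenperm (inv' p) \<longleftrightarrow> evenperm p"
      using p by (intro evenperm_inv) (auto simp: permutation_permutes)
    ultimately show "d (restrict p {1..n}) \<otimes> D (restrict p {1..n})
        = ([sign (inv' p)] \<cdot> (\<Otimes>i\<in>{1..n}. M i (inv' p i))) \<otimes> rdet R n M"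
      using detc by (simp add: sign_act l_minus r_minus)
  qed (use M pin invin in \<open>auto intro!: sign_act_closed finprod_closed rdet_closed m_closed simp del: atLeastAtMost_iff\<close>)
  also have "\<dots> = (\<Oplus>p\<in>?P. [sign (inv' p)] \<cdot> (\<Otimes>i\<in>{1..n}. M i (inv' p i))) \<otimes> rdet R n M"
    using M pin invin fin
    by (intro finsum_ldistr[symmetric])
      (auto intro!: sign_act_closed finprod_closed rdet_closed simp del: atLeastAtMost_iff)
  also have "(\<Oplus>p\<in>?P. [sign (inv' p)] \<cdot> (\<Otimes>i\<in>{1..n}. M i (inv' p i)))
      = (\<Oplus>p\<in>inv' ` ?P. [sign p] \<cdot> (\<Otimes>i\<in>{1..n}. M i (p i)))"
  proof (rule finsum_reindex[symmetric])
    show "inj_on inv' ?P"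
      by (rule inj_on_inverseI[of _ inv']) (simp add: inv_inv_eq permutes_bij)
  qed (use M pin invin in
      \<open>auto intro!: sign_act_closed finprod_closed simp del: atLeastAtMost_iff\<close>)
  also have "inv' ` ?P = ?P"
    using image_inverse_permutations[of "{1..n}"] by (simp add: setcompr_eq_image)
  finally show ?thesis
    unfolding rdet_def .
qed

lemma (in UP_cring) coeff_finsum:
  assumes "finite K" "f \<in> K \<rightarrow> carrier P"
  shows "coeff P (\<Oplus>\<^bsub>P\<^esub>k\<in>K. f k) m = (\<Oplus>k\<in>K. coeff P (f k) m)"
proof -
  show ?thesis
    using assms
  proof (induction K)
    case empty
    show ?case by (simp add: P.finsum_empty R.finsum_empty)
  next
    case (insert k K)
    have "(\<lambda>k. coeff P (f k) m) \<in> K \<rightarrow> carrier R" "f k \<in> carrier P" "f \<in> K \<rightarrow> carrier P"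
      using insert.prems by (auto simp: Pi_iff)
    then show ?case
      using insert by (simp add: P.finsum_insert R.finsum_insert P.finsum_closed)
  qed
qed

lemma (in UP_cring) finprod_monom:
  assumes "finite S" "c \<in> S \<rightarrow> carrier R"
  shows "(\<Otimes>\<^bsub>P\<^esub>i\<in>S. monom P (c i) e) = monom P (\<Otimes>i\<in>S. c i) (card S * e)"
proof -
  show ?thesis
    using assms
  proof (induction S)
    case (insert i S)
    have "c i \<in> carrier R" "c \<in> S \<rightarrow> carrier R" "(\<lambda>i. monom P (c i) e) \<in> S \<rightarrow> carrier P"
      using insert.prems by (auto simp: Pi_iff)
    then show ?case
      using insert by (simp add: monom_mult[symmetric] del: monom_mult)
  qed simp
qed

text \<open>The coefficients of a characteristic polynomial are sums of principal minors: in the product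
  belonging to the permutation \<open>p\<close>, choose the set \<open>S\<close> of factors contributing their constant term
  \<open>- M i (p i)\<close>. The others contribute \<open>\<lambda>\<close> or \<open>0\<close>, so this choice lives in degree \<open>n - card S\<close>.\<close>

lemma (in cring) coeff_char_poly:
  assumes M: "\<And>i j. i \<in> {1..n} \<Longrightarrow> j \<in> {1..n} \<Longrightarrow> M i j \<in> carrier R" and k: "k \<le> n"
  shows "[((- 1) ^ k :: int)] \<cdot> coeff (UP R) (rdet (UP R) n (\<lambda>i j.
      (if i = j then monom (UP R) \<one> 1 else \<zero>\<^bsub>UP R\<^esub>) \<ominus>\<^bsub>UP R\<^esub> monom (UP R) (M i j) 0)) (n - k)
    = (\<Oplus>p\<in>{p. p permutes {1..n}}. \<Oplus>S\<in>{S. S \<subseteq> {1..n} \<and> card S = k}.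
        [sign p] \<cdot> ((\<Otimes>i\<in>S. M i (p i)) \<otimes> (\<Otimes>i\<in>{1..n} - S. if i = p i then \<one> else \<zero>)))"
proof -
  interpret U: UP_cring R "UP R" by unfold_locales
  let ?P = "{p. p permutes {1..n}}" and ?K = "{S. S \<subseteq> {1..n} \<and> card S = k}"
  let ?m = "\<lambda>p S. (\<Otimes>i\<in>S. M i (p i)) \<otimes> (\<Otimes>i\<in>{1..n} - S. if i = p i then \<one> else \<zero>)"
  let ?x = "\<lambda>i j. (if i = j then monom (UP R) \<one> 1 else \<zero>\<^bsub>UP R\<^esub>) \<ominus>\<^bsub>UP R\<^esub> monom (UP R) (M i j) 0"
  have fin: "finite ?P" by (simp add: finite_permutations)
  have finK: "finite ?K" by (rule finite_subset[of _ "Pow {1..n}"]) auto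
  have pin: "p i \<in> {1..n}" if "p permutes {1..n}" "i \<in> {1..n}" for p i
    using that by (simp only: permutes_in_image)
  have Mc: "M i (p i) \<in> carrier R" if "p permutes {1..n}" "i \<in> {1..n}" for p i
    using M pin that by blast
  have neg: "[((- 1) ^ k :: int)] \<cdot> y = (if even k then y else \<ominus> y)" if "y \<in> carrier R" for y
    using that by (cases "even k") (simp_all add: add_pow_int_ge add_pow_int_lt add.nat_pow_eone)
  have prodneg: "(\<Otimes>i\<in>S. \<ominus> M i (p i)) = (if even (card S) then (\<Otimes>i\<in>S. M i (p i)) else \<ominus> (\<Otimes>i\<in>S. M i (p i)))"
    if "p permutes {1..n}" "finite S" "S \<subseteq> {1..n}" for p S
    using that(2,3)
  proof (induction S)
    case (insert i S)
    have c: "M i (p i) \<in> carrier R" "(\<lambda>i. M i (p i)) \<in> S \<rightarrow> carrier R" "(\<lambda>i. \<ominus> M i (p i)) \<in> S \<rightarrow> carrier R"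
      using insert.prems Mc[OF that(1)] by auto
    then show ?case
      using insert by (simp add: l_minus r_minus)
  qed simp
  have mc: "?m p S \<in> carrier R" if "p permutes {1..n}" "S \<subseteq> {1..n}" for p S
    using Mc[OF that(1)] that(2) by (intro m_closed finprod_closed) auto
  have coeff_p: "coeff (UP R) (\<Otimes>\<^bsub>UP R\<^esub>i\<in>{1..n}. ?x i (p i)) (n - k)
      = (\<Oplus>S\<in>?K. if even k then ?m p S else \<ominus> ?m p S)" if p: "p permutes {1..n}" for p
  proof -
    let ?d = "\<lambda>i. if i = p i then \<one> else \<zero>"
    let ?c = "\<lambda>S. (\<Otimes>i\<in>S. \<ominus> M i (p i)) \<otimes> (\<Otimes>i\<in>{1..n} - S. ?d i)"
    have cc: "?c S \<in> carrier R" if "S \<subseteq> {1..n}" for S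
      using Mc[OF p] that by (intro m_closed finprod_closed) auto
    have "(\<Otimes>\<^bsub>UP R\<^esub>i\<in>{1..n}. ?x i (p i))
        = (\<Otimes>\<^bsub>UP R\<^esub>i\<in>{1..n}. monom (UP R) (\<ominus> M i (p i)) 0 \<oplus>\<^bsub>UP R\<^esub> monom (UP R) (?d i) 1)"
      using Mc[OF p] by (intro U.P.finprod_cong') (auto simp: a_minus_def U.P.a_comm simp del: atLeastAtMost_iff)
    also have "\<dots> = (\<Oplus>\<^bsub>UP R\<^esub>S\<in>Pow {1..n}. (\<Otimes>\<^bsub>UP R\<^esub>i\<in>S. monom (UP R) (\<ominus> M i (p i)) 0)
        \<otimes>\<^bsub>UP R\<^esub> (\<Otimes>\<^bsub>UP R\<^esub>i\<in>{1..n} - S. monom (UP R) (?d i) 1))"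
      using Mc[OF p] by (intro U.P.finprod_add_distrib Pi_I U.monom_closed) auto
    also have "\<dots> = (\<Oplus>\<^bsub>UP R\<^esub>S\<in>Pow {1..n}. monom (UP R) (?c S) (n - card S))"
    proof (rule U.P.finsum_cong')
      fix S assume "S \<in> Pow {1..n}"
      then have S: "S \<subseteq> {1..n}" "finite S" by (auto intro: finite_subset)
      have card: "card ({1..n} - S) = n - card S"
        using card_Diff_subset[OF S(2,1)] by simp
      have c1: "(\<lambda>i. \<ominus> M i (p i)) \<in> S \<rightarrow> carrier R" "?d \<in> {1..n} - S \<rightarrow> carrier R"
        using Mc[OF p] S by auto
      have "(\<Otimes>\<^bsub>UP R\<^esub>i\<in>S. monom (UP R) (\<ominus> M i (p i)) 0) \<otimes>\<^bsub>UP R\<^esub> (\<Otimes>\<^bsub>UP R\<^esub>i\<in>{1..n} - S. monom (UP R) (?d i) 1)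
          = monom (UP R) (\<Otimes>i\<in>S. \<ominus> M i (p i)) (card S * 0) \<otimes>\<^bsub>UP R\<^esub> monom (UP R) (\<Otimes>i\<in>{1..n} - S. ?d i) (card ({1..n} - S) * 1)"
        using c1 S by (simp only: U.finprod_monom finite_Diff finite_atLeastAtMost)
      also have "\<dots> = monom (UP R) (?c S) (card S * 0 + card ({1..n} - S) * 1)"
        using c1 by (intro U.monom_mult[symmetric] finprod_closed)
      finally show "(\<Otimes>\<^bsub>UP R\<^esub>i\<in>S. monom (UP R) (\<ominus> M i (p i)) 0) \<otimes>\<^bsub>UP R\<^esub> (\<Otimes>\<^bsub>UP R\<^esub>i\<in>{1..n} - S. monom (UP R) (?d i) 1)
          = monom (UP R) (?c S) (n - card S)" by (simp add: card)
    qed (use cc in auto)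
    finally have "coeff (UP R) (\<Otimes>\<^bsub>UP R\<^esub>i\<in>{1..n}. ?x i (p i)) (n - k)
        = (\<Oplus>S\<in>Pow {1..n}. coeff (UP R) (monom (UP R) (?c S) (n - card S)) (n - k))"
      using cc by (simp add: U.coeff_finsum)
    also have "\<dots> = (\<Oplus>S\<in>?K. ?c S)"
    proof (rule add.finprod_mono_neutral_cong_right[folded finsum_def])
      fix S assume S: "S \<in> Pow {1..n} - ?K"
      then have "card S \<le> n" using card_mono[of "{1..n}" S] by auto
      \<comment> \<open>Subtraction is injective here because both cardinalities are at most \<open>n\<close>.\<close>
      then have "n - card S \<noteq> n - k" using S k by auto
      then show "coeff (UP R) (monom (UP R) (?c S) (n - card S)) (n - k) = \<zero>"
        using cc S by simp
    qed (use cc in auto)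
    also have "\<dots> = (\<Oplus>S\<in>?K. if even k then ?m p S else \<ominus> ?m p S)"
    proof (rule finsum_cong')
      fix S assume S: "S \<in> ?K"
      then have "finite S" by (auto intro: finite_subset)
      moreover have "(\<Otimes>i\<in>S. M i (p i)) \<in> carrier R" "(\<Otimes>i\<in>{1..n} - S. ?d i) \<in> carrier R"
        using S Mc[OF p] by (auto intro!: finprod_closed simp del: atLeastAtMost_iff)
      ultimately show "?c S = (if even k then ?m p S else \<ominus> ?m p S)"
        using S prodneg[OF p, of S] by (simp add: l_minus)
    qed (use mc[OF p] in auto)
    finally show ?thesis .
  qed
  have xc: "?x i (p i) \<in> carrier (UP R)" if "p permutes {1..n}" "i \<in> {1..n}" for p i
    using Mc that by auto
  have prc: "(\<Otimes>\<^bsub>UP R\<^esub>i\<in>{1..n}. ?x i (p i)) \<in> carrier (UP R)" if "p permutes {1..n}" for p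
    using xc[OF that] by (intro U.P.finprod_closed) auto
  have "coeff (UP R) (rdet (UP R) n ?x) (n - k)
      = (\<Oplus>p\<in>?P. coeff (UP R) ([sign p] \<cdot>\<^bsub>UP R\<^esub> (\<Otimes>\<^bsub>UP R\<^esub>i\<in>{1..n}. ?x i (p i))) (n - k))"
    unfolding rdet_def using prc fin by (intro U.coeff_finsum) auto
  also have "\<dots> = (\<Oplus>p\<in>?P. \<Oplus>S\<in>?K. [sign p] \<cdot> (if even k then ?m p S else \<ominus> ?m p S))"
  proof (rule finsum_cong')
    fix p assume "p \<in> ?P"
    then have p: "p permutes {1..n}" by simp
    have "coeff (UP R) ([sign p] \<cdot>\<^bsub>UP R\<^esub> (\<Otimes>\<^bsub>UP R\<^esub>i\<in>{1..n}. ?x i (p i))) (n - k)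
        = [sign p] \<cdot> coeff (UP R) (\<Otimes>\<^bsub>UP R\<^esub>i\<in>{1..n}. ?x i (p i)) (n - k)"
      using prc[OF p] by (simp add: U.P.sign_act sign_act)
    also have "\<dots> = (\<Oplus>S\<in>?K. [sign p] \<cdot> (if even k then ?m p S else \<ominus> ?m p S))"
      unfolding coeff_p[OF p] using mc[OF p] finK by (intro sign_act_finsum) auto
    finally show "coeff (UP R) ([sign p] \<cdot>\<^bsub>UP R\<^esub> (\<Otimes>\<^bsub>UP R\<^esub>i\<in>{1..n}. ?x i (p i))) (n - k)
        = (\<Oplus>S\<in>?K. [sign p] \<cdot> (if even k then ?m p S else \<ominus> ?m p S))" .
  qed (use mc in \<open>auto intro!: finsum_closed\<close>)
  also have "\<dots> = (\<Oplus>p\<in>?P. if even k then (\<Oplus>S\<in>?K. [sign p] \<cdot> ?m p S)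
      else \<ominus> (\<Oplus>S\<in>?K. [sign p] \<cdot> ?m p S))"
  proof (rule finsum_cong')
    fix p assume "p \<in> ?P"
    then have p: "p permutes {1..n}" by simp
    show "(\<Oplus>S\<in>?K. [sign p] \<cdot> (if even k then ?m p S else \<ominus> ?m p S))
      = (if even k then (\<Oplus>S\<in>?K. [sign p] \<cdot> ?m p S) else \<ominus> (\<Oplus>S\<in>?K. [sign p] \<cdot> ?m p S))"
    proof (cases "even k")
      case False
      have "(\<Oplus>S\<in>?K. [sign p] \<cdot> (\<ominus> ?m p S)) = (\<Oplus>S\<in>?K. \<ominus> ([sign p] \<cdot> ?m p S))"
        using mc[OF p] by (intro finsum_cong') (auto simp: sign_act)
      also have "\<dots> = \<ominus> (\<Oplus>S\<in>?K. [sign p] \<cdot> ?m p S)"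
        using mc[OF p] finK by (intro finsum_neg) auto
      finally show ?thesis using False by simp
    qed simp
  qed (use mc in \<open>auto intro!: finsum_closed\<close>)
  also have "\<dots> = (if even k then (\<Oplus>p\<in>?P. \<Oplus>S\<in>?K. [sign p] \<cdot> ?m p S)
      else \<ominus> (\<Oplus>p\<in>?P. \<Oplus>S\<in>?K. [sign p] \<cdot> ?m p S))"
    using finsum_neg[of "\<lambda>p. \<Oplus>S\<in>?K. [sign p] \<cdot> ?m p S" ?P] fin mc
    by (auto intro!: finsum_closed)
  finally have e: "coeff (UP R) (rdet (UP R) n ?x) (n - k)
      = (if even k then (\<Oplus>p\<in>?P. \<Oplus>S\<in>?K. [sign p] \<cdot> ?m p S)
      else \<ominus> (\<Oplus>p\<in>?P. \<Oplus>S\<in>?K. [sign p] \<cdot> ?m p S))" .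
  have "(\<Oplus>p\<in>?P. \<Oplus>S\<in>?K. [sign p] \<cdot> ?m p S) \<in> carrier R"
    using mc by (auto intro!: finsum_closed)
  then show ?thesis
    unfolding e by (simp add: neg)
qed

section \<open>The free algebra on tuples\<close>

locale based_algebra = R: cring R + A: cring A
  for R :: "('a, 'm) ring_scheme" (structure) and A :: "('a, 'b, 'k) module_scheme" (structure) +
  fixes n :: nat and \<theta> :: "nat \<Rightarrow> 'b"
  assumes algebra: "algebra R A"
    and basis: "module_basis R A n \<theta>"
begin

sublocale A: algebra R A
  by (rule algebra)

abbreviation F where "F \<equiv> free_algebra R A n"
abbreviation T where "T \<equiv> tuples A n"
abbreviation supp :: "((nat \<Rightarrow> 'b) \<Rightarrow> 'a) \<Rightarrow> (nat \<Rightarrow> 'b) set" where "supp f \<equiv> {t. f t \<noteq> \<zero>}"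

text \<open>The linear functional on the free module with value \<open>w t\<close> on the generator \<open>t\<close>. Such functionals
  separate the elements of the free module, and on a product they become iterated functionals
  (\<open>lin_ext_mult\<close>). So the ring laws reduce to linearity of these functionals and to laws for tuples;
  for commutativity, two finite sums are interchanged as well.\<close>

definition lin_ext :: "((nat \<Rightarrow> 'b) \<Rightarrow> 'a) \<Rightarrow> ((nat \<Rightarrow> 'b) \<Rightarrow> 'a) \<Rightarrow> 'a"
  where "lin_ext w f = (\<Oplus>t\<in>supp f. f t \<otimes> w t)"

lemma carrier_F:
  "f \<in> carrier F \<longleftrightarrow> (\<forall>t. f t \<in> carrier R) \<and> supp f \<subseteq> T \<and> finite (supp f)"
  by (auto simp: free_algebra_def)

lemma F_simps:
  "\<zero>\<^bsub>F\<^esub> = (\<lambda>t. \<zero>)"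
  "\<one>\<^bsub>F\<^esub> = free_gen R (\<lambda>i\<in>{1..n}. \<one>\<^bsub>A\<^esub>)"
  "f \<oplus>\<^bsub>F\<^esub> g = (\<lambda>t. f t \<oplus> g t)"
  "r \<odot>\<^bsub>F\<^esub> f = (\<lambda>t. r \<otimes> f t)"
  by (simp_all add: free_algebra_def)

lemma tuple_entry: "u \<in> T \<Longrightarrow> i \<in> {1..n} \<Longrightarrow> u i \<in> carrier A"
  by (auto simp: tuples_def)

lemma tuple_mult_closed: "u \<in> T \<Longrightarrow> v \<in> T \<Longrightarrow> tuple_mult A n u v \<in> T"
  by (auto simp: tuples_def tuple_mult_def PiE_mem)

lemma tuple_mult_comm: "u \<in> T \<Longrightarrow> v \<in> T \<Longrightarrow> tuple_mult A n u v = tuple_mult A n v u"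
  unfolding tuple_mult_def by (rule restrict_ext) (simp add: A.m_comm tuple_entry)

lemma tuple_mult_assoc:
  "u \<in> T \<Longrightarrow> v \<in> T \<Longrightarrow> x \<in> T \<Longrightarrow>
    tuple_mult A n (tuple_mult A n u v) x = tuple_mult A n u (tuple_mult A n v x)"
  unfolding tuple_mult_def by (rule restrict_ext) (simp add: A.m_assoc tuple_entry)

lemma tuple_one_closed: "(\<lambda>i\<in>{1..n}. \<one>\<^bsub>A\<^esub>) \<in> T"
  by (auto simp: tuples_def)

lemma tuple_mult_one: "u \<in> T \<Longrightarrow> tuple_mult A n (\<lambda>i\<in>{1..n}. \<one>\<^bsub>A\<^esub>) u = u"
  using tuple_mult_closed[OF tuple_one_closed] unfolding tuples_def
  by (rule PiE_ext) (auto simp: tuple_mult_def tuple_entry[unfolded tuples_def])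

lemma free_gen_closed: "t \<in> T \<Longrightarrow> free_gen R t \<in> carrier F"
  unfolding carrier_F
  by (auto simp: free_gen_def intro: finite_subset[of _ "{t}"])

lemma F_add_closed: "f \<in> carrier F \<Longrightarrow> g \<in> carrier F \<Longrightarrow> f \<oplus>\<^bsub>F\<^esub> g \<in> carrier F"
  unfolding carrier_F F_simps
  by (auto intro!: finite_subset[of "supp (\<lambda>t. f t \<oplus> g t)" "supp f \<union> supp g"])
    (metis (mono_tags, lifting) R.l_zero R.zero_closed mem_Collect_eq subsetD)

lemma F_smult_closed: "r \<in> carrier R \<Longrightarrow> f \<in> carrier F \<Longrightarrow> r \<odot>\<^bsub>F\<^esub> f \<in> carrier F"
  unfolding carrier_F F_simps
  by (auto intro: finite_subset[of _ "supp f"])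

lemma lin_ext_superset:
  assumes "f \<in> carrier F" "w \<in> T \<rightarrow> carrier R" "finite S" "supp f \<subseteq> S" "S \<subseteq> T"
  shows "lin_ext w f = (\<Oplus>t\<in>S. f t \<otimes> w t)"
  unfolding lin_ext_def using assms
  by (intro R.add.finprod_mono_neutral_cong_left[folded finsum_def])
    (auto simp: carrier_F Pi_iff subset_iff)

lemma lin_ext_closed:
  "f \<in> carrier F \<Longrightarrow> w \<in> T \<rightarrow> carrier R \<Longrightarrow> lin_ext w f \<in> carrier R"
  unfolding lin_ext_def by (auto simp: carrier_F Pi_iff subset_iff intro!: R.finsum_closed)

lemma lin_ext_add:
  assumes f: "f \<in> carrier F" and g: "g \<in> carrier F" and w: "w \<in> T \<rightarrow> carrier R"
  shows "lin_ext w (f \<oplus>\<^bsub>F\<^esub> g) = lin_ext w f \<oplus> lin_ext w g"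
proof -
  let ?S = "supp f \<union> supp g"
  have S: "finite ?S" "?S \<subseteq> T"
    using f g by (auto simp: carrier_F)
  have wc: "w t \<in> carrier R" if "t \<in> ?S" for t
    using that S w by auto
  have fc: "f t \<in> carrier R" "g t \<in> carrier R" for t
    using f g by (auto simp: carrier_F)
  have "lin_ext w (f \<oplus>\<^bsub>F\<^esub> g) = (\<Oplus>t\<in>?S. (f t \<oplus> g t) \<otimes> w t)"
    using S by (subst lin_ext_superset[OF F_add_closed[OF f g] w, of ?S]) (auto simp: F_simps)
  also have "\<dots> = (\<Oplus>t\<in>?S. f t \<otimes> w t \<oplus> g t \<otimes> w t)"
    using fc wc by (intro R.finsum_cong') (auto simp: R.l_distr)
  also have "\<dots> = (\<Oplus>t\<in>?S. f t \<otimes> w t) \<oplus> (\<Oplus>t\<in>?S. g t \<otimes> w t)"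
    using fc wc by (intro R.finsum_addf) auto
  also have "\<dots> = lin_ext w f \<oplus> lin_ext w g"
    using S by (subst (1 2) lin_ext_superset[OF _ w, of _ ?S]) (auto simp: f g)
  finally show ?thesis .
qed

lemma lin_ext_smult:
  assumes f: "f \<in> carrier F" and r: "r \<in> carrier R" and w: "w \<in> T \<rightarrow> carrier R"
  shows "lin_ext w (r \<odot>\<^bsub>F\<^esub> f) = r \<otimes> lin_ext w f"
proof -
  have fc: "f t \<in> carrier R" for t
    using f by (auto simp: carrier_F)
  have S: "finite (supp f)" "supp f \<subseteq> T"
    using f by (auto simp: carrier_F)
  have wc: "w t \<in> carrier R" if "f t \<noteq> \<zero>" for t
    using that S w by auto
  have "lin_ext w (r \<odot>\<^bsub>F\<^esub> f) = (\<Oplus>t\<in>supp f. r \<otimes> f t \<otimes> w t)"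
    using S r by (subst lin_ext_superset[OF F_smult_closed[OF r f] w, of "supp f"]) (auto simp: F_simps)
  also have "\<dots> = (\<Oplus>t\<in>supp f. r \<otimes> (f t \<otimes> w t))"
    using fc wc r by (intro R.finsum_cong') (auto simp: R.m_assoc)
  also have "\<dots> = r \<otimes> lin_ext w f"
    unfolding lin_ext_def using fc wc r S by (intro R.finsum_rdistr[symmetric]) auto
  finally show ?thesis .
qed

lemma lin_ext_gen:
  assumes "t \<in> T" "w \<in> T \<rightarrow> carrier R"
  shows "lin_ext w (free_gen R t) = w t"
proof -
  have "lin_ext w (free_gen R t) = (\<Oplus>s\<in>{t}. free_gen R t s \<otimes> w s)"
    using assms by (intro lin_ext_superset free_gen_closed) (auto simp: free_gen_def)
  also have "\<dots> = w t"
    using funcset_mem[OF assms(2,1)] by (auto simp: R.finsum_insert R.finsum_empty free_gen_def)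
  finally show ?thesis .
qed

lemma lin_ext_weight_add:
  assumes f: "f \<in> carrier F" and w: "w \<in> T \<rightarrow> carrier R" "v \<in> T \<rightarrow> carrier R"
  shows "lin_ext (\<lambda>t. w t \<oplus> v t) f = lin_ext w f \<oplus> lin_ext v f"
proof -
  have fc: "f t \<in> carrier R" for t
    using f by (auto simp: carrier_F)
  have S: "finite (supp f)" "supp f \<subseteq> T"
    using f by (auto simp: carrier_F)
  have wc: "w t \<in> carrier R" "v t \<in> carrier R" if "f t \<noteq> \<zero>" for t
    using that S w by auto
  have "lin_ext (\<lambda>t. w t \<oplus> v t) f = (\<Oplus>t\<in>supp f. f t \<otimes> w t \<oplus> f t \<otimes> v t)"
    unfolding lin_ext_def using wc fc by (intro R.finsum_cong') (auto simp: R.r_distr)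
  also have "\<dots> = lin_ext w f \<oplus> lin_ext v f"
    unfolding lin_ext_def using wc fc by (intro R.finsum_addf) auto
  finally show ?thesis .
qed

lemma lin_ext_weight_smult:
  assumes f: "f \<in> carrier F" and w: "w \<in> T \<rightarrow> carrier R" and r: "r \<in> carrier R"
  shows "lin_ext (\<lambda>t. r \<otimes> w t) f = r \<otimes> lin_ext w f"
proof -
  have fc: "f t \<in> carrier R" for t
    using f by (auto simp: carrier_F)
  have S: "finite (supp f)" "supp f \<subseteq> T"
    using f by (auto simp: carrier_F)
  have wc: "w t \<in> carrier R" if "f t \<noteq> \<zero>" for t
    using that S w by auto
  have "lin_ext (\<lambda>t. r \<otimes> w t) f = (\<Oplus>t\<in>supp f. r \<otimes> (f t \<otimes> w t))"
    unfolding lin_ext_def using wc fc r by (intro R.finsum_cong') (auto simp: R.m_lcomm)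
  also have "\<dots> = r \<otimes> lin_ext w f"
    unfolding lin_ext_def using wc fc r S by (intro R.finsum_rdistr[symmetric]) auto
  finally show ?thesis .
qed

lemma lin_ext_cong:
  assumes "f \<in> carrier F" "w \<in> T \<rightarrow> carrier R" "\<And>t. t \<in> T \<Longrightarrow> w t = v t"
  shows "lin_ext w f = lin_ext v f"
  unfolding lin_ext_def using assms
  by (intro R.finsum_cong') (auto simp: carrier_F Pi_iff subset_iff)

text \<open>The coefficient at \<open>t\<close> is itself such a functional, which is why they separate points.\<close>

lemma lin_ext_indicator:
  assumes f: "f \<in> carrier F" and t: "t \<in> T"
  shows "lin_ext (\<lambda>s. if s = t then \<one> else \<zero>) f = f t"
proof -
  have fc: "f s \<in> carrier R" for s
    using f by (auto simp: carrier_F)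
  let ?S = "insert t (supp f)"
  have "lin_ext (\<lambda>s. if s = t then \<one> else \<zero>) f = (\<Oplus>s\<in>?S. f s \<otimes> (if s = t then \<one> else \<zero>))"
    using f t by (intro lin_ext_superset) (auto simp: carrier_F)
  also have "\<dots> = (\<Oplus>s\<in>?S. if t = s then f s else \<zero>)"
    using fc by (intro R.finsum_cong') auto
  also have "\<dots> = f t"
    using f fc by (intro R.add.finprod_singleton[folded finsum_def]) (auto simp: carrier_F)
  finally show ?thesis .
qed

lemma F_ext:
  assumes "f \<in> carrier F" "g \<in> carrier F"
    and "\<And>w. w \<in> T \<rightarrow> carrier R \<Longrightarrow> lin_ext w f = lin_ext w g"
  shows "f = g"
proof
  fix t
  show "f t = g t"
  proof (cases "t \<in> T")
    case True
    then show ?thesis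
      using assms(1,2) assms(3)[of "\<lambda>s. if s = t then \<one> else \<zero>"]
      by (auto simp: lin_ext_indicator)
  next
    case False
    then have "f t = \<zero>" "g t = \<zero>" using assms(1,2) unfolding carrier_F by auto
    then show ?thesis by simp
  qed
qed

lemma
  assumes f: "f \<in> carrier F" and g: "g \<in> carrier F"
  shows F_mult_closed: "f \<otimes>\<^bsub>F\<^esub> g \<in> carrier F"
    and lin_ext_mult: "w \<in> T \<rightarrow> carrier R \<Longrightarrow>
      lin_ext w (f \<otimes>\<^bsub>F\<^esub> g) = lin_ext (\<lambda>u. lin_ext (\<lambda>v. w (tuple_mult A n u v)) g) f"
proof -
  let ?X = "supp f \<times> supp g"
  let ?m = "\<lambda>p. tuple_mult A n (fst p) (snd p)"
  let ?c = "\<lambda>p. f (fst p) \<otimes> g (snd p)"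
  let ?W = "?m ` ?X"
  have fc: "f t \<in> carrier R" "g t \<in> carrier R" for t
    using f g by (auto simp: carrier_F)
  have S: "finite (supp f)" "supp f \<subseteq> T" "finite (supp g)" "supp g \<subseteq> T"
    using f g by (auto simp: carrier_F)
  have X: "finite ?X" and W: "finite ?W" "?W \<subseteq> T"
    using S by (auto intro!: tuple_mult_closed)
  have fg: "(f \<otimes>\<^bsub>F\<^esub> g) t = (\<Oplus>p\<in>{p \<in> ?X. ?m p = t}. ?c p)" for t
    by (simp add: free_algebra_def) (rule arg_cong[where f = "finsum R _"], auto)
  have "supp (f \<otimes>\<^bsub>F\<^esub> g) \<subseteq> ?W"
  proof
    fix t assume t: "t \<in> supp (f \<otimes>\<^bsub>F\<^esub> g)"
    show "t \<in> ?W"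
    proof (rule ccontr)
      assume "t \<notin> ?W"
      then have "{p \<in> ?X. ?m p = t} = {}" by blast
      then show False using t unfolding mem_Collect_eq fg by (simp only: R.finsum_empty simp_thms)
    qed
  qed
  moreover have "(f \<otimes>\<^bsub>F\<^esub> g) t \<in> carrier R" for t
    unfolding fg using fc by (intro R.finsum_closed) auto
  ultimately show c: "f \<otimes>\<^bsub>F\<^esub> g \<in> carrier F"
    unfolding carrier_F using W finite_subset by blast
  assume w: "w \<in> T \<rightarrow> carrier R"
  have wc: "w (?m p) \<in> carrier R" if "p \<in> ?X" for p
    using that w W(2) by blast
  have "lin_ext w (f \<otimes>\<^bsub>F\<^esub> g) = (\<Oplus>t\<in>?W. (f \<otimes>\<^bsub>F\<^esub> g) t \<otimes> w t)"
    using c w W \<open>supp _ \<subseteq> ?W\<close> by (intro lin_ext_superset) auto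
  also have "\<dots> = (\<Oplus>t\<in>?W. \<Oplus>p\<in>{p \<in> ?X. ?m p = t}. ?c p \<otimes> w (?m p))"
  proof (rule R.finsum_cong')
    fix t assume t: "t \<in> ?W"
    then have "w t \<in> carrier R" using w W(2) by blast
    then have "(f \<otimes>\<^bsub>F\<^esub> g) t \<otimes> w t = (\<Oplus>p\<in>{p \<in> ?X. ?m p = t}. ?c p \<otimes> w t)"
      unfolding fg using X fc by (intro R.finsum_ldistr) auto
    also have "\<dots> = (\<Oplus>p\<in>{p \<in> ?X. ?m p = t}. ?c p \<otimes> w (?m p))"
      using fc wc by (intro R.finsum_cong') auto
    finally show "(f \<otimes>\<^bsub>F\<^esub> g) t \<otimes> w t = (\<Oplus>p\<in>{p \<in> ?X. ?m p = t}. ?c p \<otimes> w (?m p))" .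
  qed (use fc wc in \<open>auto intro!: R.finsum_closed\<close>)
  \<comment> \<open>Grouping the pairs of tuples by their product is undone.\<close>
  also have "\<dots> = (\<Oplus>p\<in>?X. ?c p \<otimes> w (?m p))"
    using X W fc wc by (intro R.add.finprod_fibre[folded finsum_def, symmetric]) auto
  also have "\<dots> = (\<Oplus>u\<in>supp f. \<Oplus>v\<in>supp g. f u \<otimes> g v \<otimes> w (tuple_mult A n u v))"
    using S fc wc
    by (intro R.add.finprod_Times[folded finsum_def,
          of _ _ "\<lambda>u v. f u \<otimes> g v \<otimes> w (tuple_mult A n u v)"]) auto
  also have "\<dots> = (\<Oplus>u\<in>supp f. f u \<otimes> (\<Oplus>v\<in>supp g. g v \<otimes> w (tuple_mult A n u v)))"
  proof (rule R.finsum_cong')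
    fix u assume u: "u \<in> supp f"
    have uw: "w (tuple_mult A n u v) \<in> carrier R" if "v \<in> supp g" for v
      using wc[of "(u, v)"] u that by simp
    have "(\<Oplus>v\<in>supp g. f u \<otimes> g v \<otimes> w (tuple_mult A n u v))
        = (\<Oplus>v\<in>supp g. f u \<otimes> (g v \<otimes> w (tuple_mult A n u v)))"
      using uw fc by (intro R.finsum_cong') (auto simp: R.m_assoc)
    also have "\<dots> = f u \<otimes> (\<Oplus>v\<in>supp g. g v \<otimes> w (tuple_mult A n u v))"
      using uw fc S by (intro R.finsum_rdistr[symmetric]) auto
    finally show "(\<Oplus>v\<in>supp g. f u \<otimes> g v \<otimes> w (tuple_mult A n u v))
        = f u \<otimes> (\<Oplus>v\<in>supp g. g v \<otimes> w (tuple_mult A n u v))" .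
  qed (use fc wc in \<open>auto intro!: R.finsum_closed\<close>)
  finally show "lin_ext w (f \<otimes>\<^bsub>F\<^esub> g) = lin_ext (\<lambda>u. lin_ext (\<lambda>v. w (tuple_mult A n u v)) g) f"
    unfolding lin_ext_def .
qed

lemma inner_weight:
  assumes "w \<in> T \<rightarrow> carrier R" "u \<in> T"
  shows "(\<lambda>v. w (tuple_mult A n u v)) \<in> T \<rightarrow> carrier R"
  using assms by (auto intro!: tuple_mult_closed funcset_mem[OF assms(1)])

lemma lin_ext_swap:
  assumes f: "f \<in> carrier F" and g: "g \<in> carrier F"
    and w: "\<And>u v. u \<in> T \<Longrightarrow> v \<in> T \<Longrightarrow> w u v \<in> carrier R"
  shows "lin_ext (\<lambda>u. lin_ext (\<lambda>v. w u v) g) f = lin_ext (\<lambda>v. lin_ext (\<lambda>u. w u v) f) g"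
proof -
  have fc: "f t \<in> carrier R" "g t \<in> carrier R" for t
    using f g by (auto simp: carrier_F)
  have S: "finite (supp f)" "supp f \<subseteq> T" "finite (supp g)" "supp g \<subseteq> T"
    using f g by (auto simp: carrier_F)
  have wc: "w u v \<in> carrier R" if "f u \<noteq> \<zero>" "g v \<noteq> \<zero>" for u v
    using that w S by auto
  have "lin_ext (\<lambda>u. lin_ext (\<lambda>v. w u v) g) f = (\<Oplus>u\<in>supp f. \<Oplus>v\<in>supp g. f u \<otimes> (g v \<otimes> w u v))"
    unfolding lin_ext_def using fc wc S
    by (intro R.finsum_cong' R.finsum_rdistr) (auto intro!: R.finsum_closed)
  also have "\<dots> = (\<Oplus>v\<in>supp g. \<Oplus>u\<in>supp f. f u \<otimes> (g v \<otimes> w u v))"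
    using fc wc S by (intro R.add.finprod_swap[folded finsum_def]) auto
  also have "\<dots> = (\<Oplus>v\<in>supp g. \<Oplus>u\<in>supp f. g v \<otimes> (f u \<otimes> w u v))"
    using fc wc by (intro R.finsum_cong') (auto simp: R.m_lcomm intro!: R.finsum_closed)
  also have "\<dots> = lin_ext (\<lambda>v. lin_ext (\<lambda>u. w u v) f) g"
    unfolding lin_ext_def using fc wc S
    by (intro R.finsum_cong' R.finsum_rdistr[symmetric]) (auto intro!: R.finsum_closed)
  finally show ?thesis .
qed

lemma cring_F: "cring F"
proof (rule cringI)
  show "abelian_group F"
  proof (rule abelian_groupI)
    fix f assume c: "f \<in> carrier F"
    show "\<exists>g\<in>carrier F. g \<oplus>\<^bsub>F\<^esub> f = \<zero>\<^bsub>F\<^esub>"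
    proof
      show "(\<ominus> \<one>) \<odot>\<^bsub>F\<^esub> f \<in> carrier F" using c by (intro F_smult_closed) auto
      show "(\<ominus> \<one>) \<odot>\<^bsub>F\<^esub> f \<oplus>\<^bsub>F\<^esub> f = \<zero>\<^bsub>F\<^esub>"
        using c by (auto simp: F_simps carrier_F R.l_minus R.l_neg)
    qed
  qed (simp add: F_add_closed, auto simp: carrier_F F_simps R.a_ac)
  show "comm_monoid F"
  proof (rule comm_monoidI)
    fix f g h assume c: "f \<in> carrier F" "g \<in> carrier F" "h \<in> carrier F"
    show "f \<otimes>\<^bsub>F\<^esub> g \<otimes>\<^bsub>F\<^esub> h = f \<otimes>\<^bsub>F\<^esub> (g \<otimes>\<^bsub>F\<^esub> h)"
    proof (rule F_ext)
      fix w assume w: "w \<in> T \<rightarrow> carrier R"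
      have w1: "(\<lambda>u. lin_ext (\<lambda>v. w (tuple_mult A n u v)) h) \<in> T \<rightarrow> carrier R"
        using c w by (auto intro!: lin_ext_closed funcset_mem[OF w] tuple_mult_closed)
      have w2: "(\<lambda>u. lin_ext (\<lambda>v. lin_ext (\<lambda>x. w (tuple_mult A n (tuple_mult A n u v) x)) h) g)
          \<in> T \<rightarrow> carrier R"
        using c w by (auto intro!: lin_ext_closed funcset_mem[OF w] tuple_mult_closed)
      have "lin_ext w (f \<otimes>\<^bsub>F\<^esub> g \<otimes>\<^bsub>F\<^esub> h) = lin_ext (\<lambda>u. lin_ext (\<lambda>v.
          lin_ext (\<lambda>x. w (tuple_mult A n (tuple_mult A n u v) x)) h) g) f"
        using c w w1 by (simp add: lin_ext_mult F_mult_closed)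
      also have "\<dots> = lin_ext (\<lambda>u. lin_ext (\<lambda>v. w (tuple_mult A n u v)) (g \<otimes>\<^bsub>F\<^esub> h)) f"
      proof (rule lin_ext_cong[OF c(1) w2])
        fix u assume u: "u \<in> T"
        have "lin_ext (\<lambda>v. w (tuple_mult A n u v)) (g \<otimes>\<^bsub>F\<^esub> h)
          = lin_ext (\<lambda>v. lin_ext (\<lambda>x. w (tuple_mult A n u (tuple_mult A n v x))) h) g"
          using c u inner_weight[OF w u] by (simp add: lin_ext_mult)
        also have "\<dots> = lin_ext (\<lambda>v. lin_ext (\<lambda>x. w (tuple_mult A n (tuple_mult A n u v) x)) h) g"
          using c u w
          by (intro lin_ext_cong)
            (auto simp: tuple_mult_assoc intro!: lin_ext_closed funcset_mem[OF w] tuple_mult_closed)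
        finally show "lin_ext (\<lambda>v. lin_ext (\<lambda>x. w (tuple_mult A n (tuple_mult A n u v) x)) h) g
          = lin_ext (\<lambda>v. w (tuple_mult A n u v)) (g \<otimes>\<^bsub>F\<^esub> h)" by simp
      qed
      also have "\<dots> = lin_ext w (f \<otimes>\<^bsub>F\<^esub> (g \<otimes>\<^bsub>F\<^esub> h))"
        using c w by (simp add: lin_ext_mult F_mult_closed)
      finally show "lin_ext w (f \<otimes>\<^bsub>F\<^esub> g \<otimes>\<^bsub>F\<^esub> h) = lin_ext w (f \<otimes>\<^bsub>F\<^esub> (g \<otimes>\<^bsub>F\<^esub> h))" .
    qed (use c in \<open>auto intro!: F_mult_closed\<close>)
  next
    fix f g assume c: "f \<in> carrier F" "g \<in> carrier F"
    show "f \<otimes>\<^bsub>F\<^esub> g = g \<otimes>\<^bsub>F\<^esub> f"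
    proof (rule F_ext)
      fix w assume w: "w \<in> T \<rightarrow> carrier R"
      have "lin_ext w (f \<otimes>\<^bsub>F\<^esub> g) = lin_ext (\<lambda>v. lin_ext (\<lambda>u. w (tuple_mult A n u v)) f) g"
        using c w lin_ext_swap[OF c(1,2), of "\<lambda>u v. w (tuple_mult A n u v)"]
        by (auto simp: lin_ext_mult tuple_mult_closed funcset_mem[OF w])
      also have "\<dots> = lin_ext (\<lambda>v. lin_ext (\<lambda>u. w (tuple_mult A n v u)) f) g"
        using c w by (intro lin_ext_cong)
          (auto simp: tuple_mult_comm intro!: lin_ext_closed funcset_mem[OF w] tuple_mult_closed)
      also have "\<dots> = lin_ext w (g \<otimes>\<^bsub>F\<^esub> f)"
        using c w by (simp add: lin_ext_mult)
      finally show "lin_ext w (f \<otimes>\<^bsub>F\<^esub> g) = lin_ext w (g \<otimes>\<^bsub>F\<^esub> f)" .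
    qed (use c in \<open>auto intro!: F_mult_closed\<close>)
  next
    fix f assume c: "f \<in> carrier F"
    show "\<one>\<^bsub>F\<^esub> \<otimes>\<^bsub>F\<^esub> f = f"
    proof (rule F_ext)
      fix w assume w: "w \<in> T \<rightarrow> carrier R"
      have w1: "(\<lambda>u. lin_ext (\<lambda>v. w (tuple_mult A n u v)) f) \<in> T \<rightarrow> carrier R"
        using c w by (auto intro!: lin_ext_closed funcset_mem[OF w] tuple_mult_closed)
      have "lin_ext w (\<one>\<^bsub>F\<^esub> \<otimes>\<^bsub>F\<^esub> f) = lin_ext (\<lambda>v. w (tuple_mult A n (\<lambda>i\<in>{1..n}. \<one>\<^bsub>A\<^esub>) v)) f"
        unfolding F_simps(2) lin_ext_mult[OF free_gen_closed[OF tuple_one_closed] c w]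
        by (rule lin_ext_gen[OF tuple_one_closed w1])
      also have "\<dots> = lin_ext w f"
        by (rule lin_ext_cong[OF c inner_weight[OF w tuple_one_closed]])
          (simp only: tuple_mult_one)
      finally show "lin_ext w (\<one>\<^bsub>F\<^esub> \<otimes>\<^bsub>F\<^esub> f) = lin_ext w f" .
    qed (use c in \<open>auto intro!: F_mult_closed free_gen_closed tuple_one_closed simp: F_simps(2)\<close>)
  qed (auto simp: F_mult_closed F_simps(2) intro: free_gen_closed tuple_one_closed)
  fix f g h assume c: "f \<in> carrier F" "g \<in> carrier F" "h \<in> carrier F"
  show "(f \<oplus>\<^bsub>F\<^esub> g) \<otimes>\<^bsub>F\<^esub> h = f \<otimes>\<^bsub>F\<^esub> h \<oplus>\<^bsub>F\<^esub> g \<otimes>\<^bsub>F\<^esub> h"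
  proof (rule F_ext)
    fix w assume w: "w \<in> T \<rightarrow> carrier R"
    have w1: "(\<lambda>u. lin_ext (\<lambda>v. w (tuple_mult A n u v)) h) \<in> T \<rightarrow> carrier R"
      using c w by (auto intro!: lin_ext_closed funcset_mem[OF w] tuple_mult_closed)
    show "lin_ext w ((f \<oplus>\<^bsub>F\<^esub> g) \<otimes>\<^bsub>F\<^esub> h) = lin_ext w (f \<otimes>\<^bsub>F\<^esub> h \<oplus>\<^bsub>F\<^esub> g \<otimes>\<^bsub>F\<^esub> h)"
      using c w w1 by (simp add: lin_ext_mult lin_ext_add F_add_closed F_mult_closed)
  qed (use c in \<open>auto intro!: F_mult_closed F_add_closed\<close>)
qed

sublocale F: cring F
  by (rule cring_F)

lemma algebra_F: "algebra R F"
proof (rule algebraI)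
  fix a f g assume c: "a \<in> carrier R" "f \<in> carrier F" "g \<in> carrier F"
  show "a \<odot>\<^bsub>F\<^esub> f \<otimes>\<^bsub>F\<^esub> g = a \<odot>\<^bsub>F\<^esub> (f \<otimes>\<^bsub>F\<^esub> g)"
  proof (rule F_ext)
    fix w assume w: "w \<in> T \<rightarrow> carrier R"
    have w1: "(\<lambda>u. lin_ext (\<lambda>v. w (tuple_mult A n u v)) g) \<in> T \<rightarrow> carrier R"
      using c w by (auto intro!: lin_ext_closed funcset_mem[OF w] tuple_mult_closed)
    show "lin_ext w (a \<odot>\<^bsub>F\<^esub> f \<otimes>\<^bsub>F\<^esub> g) = lin_ext w (a \<odot>\<^bsub>F\<^esub> (f \<otimes>\<^bsub>F\<^esub> g))"
      using c w w1 by (simp add: lin_ext_mult lin_ext_smult F_smult_closed F_mult_closed)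
  qed (use c in \<open>auto intro!: F_mult_closed F_smult_closed\<close>)
qed (use R.is_cring cring_F F_smult_closed in
    \<open>auto simp: F_simps carrier_F R.l_distr R.r_distr R.m_assoc\<close>)

sublocale F: algebra R F
  by (rule algebra_F)

lemma F_induct [consumes 1, case_names gen add]:
  assumes f: "f \<in> carrier F"
    and gen: "\<And>r t. r \<in> carrier R \<Longrightarrow> t \<in> T \<Longrightarrow> P (r \<odot>\<^bsub>F\<^esub> free_gen R t)"
    and add: "\<And>f g. f \<in> carrier F \<Longrightarrow> g \<in> carrier F \<Longrightarrow> P f \<Longrightarrow> P g \<Longrightarrow> P (f \<oplus>\<^bsub>F\<^esub> g)"
  shows "P f"
proof -
  have "f \<in> carrier F \<longrightarrow> supp f \<subseteq> S \<longrightarrow> P f" if "finite S" for S f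
    using that
  proof (induction S arbitrary: f)
    case empty
    show ?case
    proof (intro impI)
      assume f: "f \<in> carrier F" "supp f \<subseteq> {}"
      then have "f = \<zero> \<odot>\<^bsub>F\<^esub> free_gen R (\<lambda>i\<in>{1..n}. \<one>\<^bsub>A\<^esub>)"
        by (auto simp: F_simps free_gen_def)
      then show "P f" using gen[OF R.zero_closed tuple_one_closed] by simp
    qed
  next
    case (insert t S)
    show ?case
    proof (intro impI)
      assume f: "f \<in> carrier F" "supp f \<subseteq> insert t S"
      have fc: "f s \<in> carrier R" for s
        using f by (auto simp: carrier_F)
      show "P f"
      proof (cases "f t = \<zero>")
        case True
        then show ?thesis using insert.IH[of f] f by blast
      next
        case False
        then have t: "t \<in> T" using f by (auto simp: carrier_F)
        let ?g = "f(t := \<zero>)"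
        have g: "?g \<in> carrier F" "supp ?g \<subseteq> S"
          using f by (auto simp: carrier_F intro: finite_subset[of _ "supp f"])
        have "f = f t \<odot>\<^bsub>F\<^esub> free_gen R t \<oplus>\<^bsub>F\<^esub> ?g"
          using fc by (auto simp: F_simps free_gen_def)
        moreover have "P (f t \<odot>\<^bsub>F\<^esub> free_gen R t \<oplus>\<^bsub>F\<^esub> ?g)"
          using gen[OF fc t] insert.IH[of ?g] g t fc
          by (intro add F_smult_closed free_gen_closed) blast+
        ultimately show ?thesis by simp
      qed
    qed
  qed
  then show ?thesis using f by (auto simp: carrier_F)
qed

section \<open>Coordinates and the tensor ideal\<close>

abbreviation crd where "crd \<equiv> coords R A n \<theta>"
abbreviation J :: "(nat \<Rightarrow> nat) set" where "J \<equiv> {1..n} \<rightarrow>\<^sub>E {1..n}"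

lemma theta_closed [simp]: "i \<in> {1..n} \<Longrightarrow> \<theta> i \<in> carrier A"
  using basis by (auto simp: module_basis_def)

lemma lincomb_closed:
  "c \<in> {1..n} \<rightarrow> carrier R \<Longrightarrow> (\<Oplus>\<^bsub>A\<^esub>i\<in>{1..n}. c i \<odot>\<^bsub>A\<^esub> \<theta> i) \<in> carrier A"
  by (auto intro!: A.finsum_closed)

text \<open>Linear independence is stated for vanishing combinations, so it is applied to the difference.\<close>

lemma lincomb_inj:
  assumes c: "c \<in> {1..n} \<rightarrow> carrier R" and d: "d \<in> {1..n} \<rightarrow> carrier R"
    and eq: "(\<Oplus>\<^bsub>A\<^esub>i\<in>{1..n}. c i \<odot>\<^bsub>A\<^esub> \<theta> i) = (\<Oplus>\<^bsub>A\<^esub>i\<in>{1..n}. d i \<odot>\<^bsub>A\<^esub> \<theta> i)" and i: "i \<in> {1..n}"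
  shows "c i = d i"
proof -
  have cd: "c i \<in> carrier R" "d i \<in> carrier R" if "i \<in> {1..n}" for i
    using c d that by auto
  have e: "(\<lambda>i. c i \<oplus> (\<ominus> \<one>) \<otimes> d i) \<in> {1..n} \<rightarrow> carrier R"
    using cd by auto
  have "(\<Oplus>\<^bsub>A\<^esub>i\<in>{1..n}. (c i \<oplus> (\<ominus> \<one>) \<otimes> d i) \<odot>\<^bsub>A\<^esub> \<theta> i)
      = (\<Oplus>\<^bsub>A\<^esub>i\<in>{1..n}. c i \<odot>\<^bsub>A\<^esub> \<theta> i \<oplus>\<^bsub>A\<^esub> (\<ominus> \<one>) \<odot>\<^bsub>A\<^esub> (d i \<odot>\<^bsub>A\<^esub> \<theta> i))"
    using cd by (intro A.finsum_cong') (auto simp: A.smult_l_distr A.smult_assoc1)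
  also have "\<dots> = (\<Oplus>\<^bsub>A\<^esub>i\<in>{1..n}. c i \<odot>\<^bsub>A\<^esub> \<theta> i) \<oplus>\<^bsub>A\<^esub> (\<ominus> \<one>) \<odot>\<^bsub>A\<^esub> (\<Oplus>\<^bsub>A\<^esub>i\<in>{1..n}. d i \<odot>\<^bsub>A\<^esub> \<theta> i)"
    using cd by (subst A.finsum_addf) (auto simp: A.finsum_smult_ldistr)
  also have "\<dots> = \<zero>\<^bsub>A\<^esub>"
    unfolding eq using lincomb_closed[OF d] by (simp add: A.smult_l_minus A.r_neg)
  finally have "c i \<oplus> (\<ominus> \<one>) \<otimes> d i = \<zero>"
    by (rule conjunct2[OF conjunct2[OF basis[unfolded module_basis_def]], rule_format, OF e _ i])
  then have "c i = \<ominus> ((\<ominus> \<one>) \<otimes> d i)"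
    using cd i by (intro R.sum_zero_eq_neg) auto
  then show ?thesis using cd[OF i] by (simp add: R.l_minus)
qed

lemma coords_spec:
  assumes "a \<in> carrier A"
  shows "crd a \<in> {1..n} \<rightarrow>\<^sub>E carrier R" "a = (\<Oplus>\<^bsub>A\<^esub>i\<in>{1..n}. crd a i \<odot>\<^bsub>A\<^esub> \<theta> i)"
proof -
  obtain c where c: "c \<in> {1..n} \<rightarrow> carrier R" "a = (\<Oplus>\<^bsub>A\<^esub>i\<in>{1..n}. c i \<odot>\<^bsub>A\<^esub> \<theta> i)"
    using basis assms unfolding module_basis_def by blast
  let ?P = "\<lambda>c. c \<in> {1..n} \<rightarrow>\<^sub>E carrier R \<and> a = (\<Oplus>\<^bsub>A\<^esub>i\<in>{1..n}. c i \<odot>\<^bsub>A\<^esub> \<theta> i)"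
  have "?P (restrict c {1..n})"
  proof
    show "a = (\<Oplus>\<^bsub>A\<^esub>i\<in>{1..n}. restrict c {1..n} i \<odot>\<^bsub>A\<^esub> \<theta> i)"
      unfolding c(2) using c(1) by (intro A.finsum_cong') (auto simp: Pi_iff)
  qed (use c(1) in auto)
  moreover have "d = restrict c {1..n}" if "?P d" for d
  proof (rule PiE_ext)
    show "d i = restrict c {1..n} i" if i: "i \<in> {1..n}" for i
      using lincomb_inj[of d c i] \<open>?P d\<close> c i by (auto simp: PiE_def)
  qed (use that c(1) in auto)
  ultimately have "?P (crd a)"
    unfolding coords_def by (rule theI)
  then show "crd a \<in> {1..n} \<rightarrow>\<^sub>E carrier R" "a = (\<Oplus>\<^bsub>A\<^esub>i\<in>{1..n}. crd a i \<odot>\<^bsub>A\<^esub> \<theta> i)"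
    by auto
qed

lemma coords_closed [simp]: "a \<in> carrier A \<Longrightarrow> i \<in> {1..n} \<Longrightarrow> crd a i \<in> carrier R"
  by (rule PiE_mem[OF coords_spec(1)])

lemma coords_eqI:
  assumes "c \<in> {1..n} \<rightarrow> carrier R" "a = (\<Oplus>\<^bsub>A\<^esub>i\<in>{1..n}. c i \<odot>\<^bsub>A\<^esub> \<theta> i)" "i \<in> {1..n}"
  shows "crd a i = c i"
proof -
  have a: "a \<in> carrier A" unfolding assms(2) using assms(1) by (rule lincomb_closed)
  show ?thesis
    using coords_spec[OF a] assms by (intro lincomb_inj) (auto simp: PiE_def)
qed

lemma coords_add:
  assumes "a \<in> carrier A" "b \<in> carrier A" "i \<in> {1..n}"
  shows "crd (a \<oplus>\<^bsub>A\<^esub> b) i = crd a i \<oplus> crd b i"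
proof (rule coords_eqI)
  have "a \<oplus>\<^bsub>A\<^esub> b = (\<Oplus>\<^bsub>A\<^esub>i\<in>{1..n}. crd a i \<odot>\<^bsub>A\<^esub> \<theta> i) \<oplus>\<^bsub>A\<^esub> (\<Oplus>\<^bsub>A\<^esub>i\<in>{1..n}. crd b i \<odot>\<^bsub>A\<^esub> \<theta> i)"
    using coords_spec(2) assms by simp
  also have "\<dots> = (\<Oplus>\<^bsub>A\<^esub>i\<in>{1..n}. crd a i \<odot>\<^bsub>A\<^esub> \<theta> i \<oplus>\<^bsub>A\<^esub> crd b i \<odot>\<^bsub>A\<^esub> \<theta> i)"
    using assms by (intro A.finsum_addf[symmetric]) auto
  also have "\<dots> = (\<Oplus>\<^bsub>A\<^esub>i\<in>{1..n}. (crd a i \<oplus> crd b i) \<odot>\<^bsub>A\<^esub> \<theta> i)"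
    using assms by (intro A.finsum_cong') (auto simp: A.smult_l_distr)
  finally show "a \<oplus>\<^bsub>A\<^esub> b = (\<Oplus>\<^bsub>A\<^esub>i\<in>{1..n}. (crd a i \<oplus> crd b i) \<odot>\<^bsub>A\<^esub> \<theta> i)" .
qed (use assms in auto)

lemma coords_smult:
  assumes "a \<in> carrier A" "r \<in> carrier R" "i \<in> {1..n}"
  shows "crd (r \<odot>\<^bsub>A\<^esub> a) i = r \<otimes> crd a i"
proof (rule coords_eqI)
  have "r \<odot>\<^bsub>A\<^esub> a = r \<odot>\<^bsub>A\<^esub> (\<Oplus>\<^bsub>A\<^esub>i\<in>{1..n}. crd a i \<odot>\<^bsub>A\<^esub> \<theta> i)"
    using coords_spec(2) assms by simp
  also have "\<dots> = (\<Oplus>\<^bsub>A\<^esub>i\<in>{1..n}. r \<odot>\<^bsub>A\<^esub> (crd a i \<odot>\<^bsub>A\<^esub> \<theta> i))"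
    using assms by (intro A.finsum_smult_ldistr) auto
  also have "\<dots> = (\<Oplus>\<^bsub>A\<^esub>i\<in>{1..n}. (r \<otimes> crd a i) \<odot>\<^bsub>A\<^esub> \<theta> i)"
    using assms by (intro A.finsum_cong') (auto simp: A.smult_assoc1)
  finally show "r \<odot>\<^bsub>A\<^esub> a = (\<Oplus>\<^bsub>A\<^esub>i\<in>{1..n}. (r \<otimes> crd a i) \<odot>\<^bsub>A\<^esub> \<theta> i)" .
qed (use assms in auto)

lemma coords_theta:
  assumes "i \<in> {1..n}" "j \<in> {1..n}"
  shows "crd (\<theta> j) i = (if i = j then \<one> else \<zero>)"
proof (rule coords_eqI)
  have "(\<Oplus>\<^bsub>A\<^esub>i\<in>{1..n}. (if i = j then \<one> else \<zero>) \<odot>\<^bsub>A\<^esub> \<theta> i)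
      = (\<Oplus>\<^bsub>A\<^esub>i\<in>{1..n}. if j = i then \<theta> i else \<zero>\<^bsub>A\<^esub>)"
    by (intro A.finsum_cong') auto
  also have "\<dots> = \<theta> j"
    using assms by (intro A.add.finprod_singleton[folded finsum_def]) auto
  finally show "\<theta> j = (\<Oplus>\<^bsub>A\<^esub>i\<in>{1..n}. (if i = j then \<one> else \<zero>) \<odot>\<^bsub>A\<^esub> \<theta> i)" by simp
qed (use assms in auto)

lemma coords_finsum:
  assumes "finite K" "g \<in> K \<rightarrow> carrier A" "i \<in> {1..n}"
  shows "crd (\<Oplus>\<^bsub>A\<^esub>k\<in>K. g k) i = (\<Oplus>k\<in>K. crd (g k) i)"
  using assms(1,2)
proof (induction K)
  case empty
  have "crd (\<zero> \<odot>\<^bsub>A\<^esub> \<one>\<^bsub>A\<^esub>) i = \<zero> \<otimes> crd \<one>\<^bsub>A\<^esub> i"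
    using assms(3) by (intro coords_smult) auto
  then show ?case
    using assms(3) by (simp add: A.finsum_empty R.finsum_empty)
next
  case (insert k K)
  have c: "crd (g k) i \<in> carrier R" "(\<lambda>k. crd (g k) i) \<in> K \<rightarrow> carrier R"
    using insert.prems assms(3) by (auto simp: Pi_iff)
  have "(\<Oplus>\<^bsub>A\<^esub>k\<in>insert k K. g k) = g k \<oplus>\<^bsub>A\<^esub> (\<Oplus>\<^bsub>A\<^esub>k\<in>K. g k)"
    using insert by (intro A.finsum_insert) auto
  moreover have "(\<Oplus>k\<in>insert k K. crd (g k) i) = crd (g k) i \<oplus> (\<Oplus>k\<in>K. crd (g k) i)"
    using insert c by (intro R.finsum_insert) auto
  moreover have "(\<Oplus>\<^bsub>A\<^esub>k\<in>K. g k) \<in> carrier A" "g k \<in> carrier A"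
    using insert.prems by (auto intro!: A.finsum_closed)
  ultimately show ?case using insert assms(3) by (simp add: coords_add)
qed

lemma coords_mult:
  assumes "a \<in> carrier A" "b \<in> carrier A" "i \<in> {1..n}"
  shows "crd (a \<otimes>\<^bsub>A\<^esub> b) i = (\<Oplus>k\<in>{1..n}. crd (b \<otimes>\<^bsub>A\<^esub> \<theta> k) i \<otimes> crd a k)"
proof -
  have "a \<otimes>\<^bsub>A\<^esub> b = (\<Oplus>\<^bsub>A\<^esub>k\<in>{1..n}. crd a k \<odot>\<^bsub>A\<^esub> \<theta> k) \<otimes>\<^bsub>A\<^esub> b"
    using coords_spec(2) assms by simp
  also have "\<dots> = (\<Oplus>\<^bsub>A\<^esub>k\<in>{1..n}. (crd a k \<odot>\<^bsub>A\<^esub> \<theta> k) \<otimes>\<^bsub>A\<^esub> b)"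
    using assms by (intro A.finsum_ldistr) auto
  also have "\<dots> = (\<Oplus>\<^bsub>A\<^esub>k\<in>{1..n}. crd a k \<odot>\<^bsub>A\<^esub> (b \<otimes>\<^bsub>A\<^esub> \<theta> k))"
  proof (rule A.finsum_cong')
    fix k assume k: "k \<in> {1..n}"
    show "(crd a k \<odot>\<^bsub>A\<^esub> \<theta> k) \<otimes>\<^bsub>A\<^esub> b = crd a k \<odot>\<^bsub>A\<^esub> (b \<otimes>\<^bsub>A\<^esub> \<theta> k)"
      using assms k A.m_comm[OF theta_closed[OF k] assms(2)] by (simp add: A.smult_assoc2)
  qed (use assms in auto)
  finally have "crd (a \<otimes>\<^bsub>A\<^esub> b) i = crd (\<Oplus>\<^bsub>A\<^esub>k\<in>{1..n}. crd a k \<odot>\<^bsub>A\<^esub> (b \<otimes>\<^bsub>A\<^esub> \<theta> k)) i"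
    by simp
  also have "\<dots> = (\<Oplus>k\<in>{1..n}. crd (crd a k \<odot>\<^bsub>A\<^esub> (b \<otimes>\<^bsub>A\<^esub> \<theta> k)) i)"
    using assms by (intro coords_finsum) auto
  also have "\<dots> = (\<Oplus>k\<in>{1..n}. crd (b \<otimes>\<^bsub>A\<^esub> \<theta> k) i \<otimes> crd a k)"
    using assms by (intro R.finsum_cong') (auto simp: coords_smult R.m_comm)
  finally show ?thesis .
qed

text \<open>The coefficient of \<open>\<theta> (j 1) \<otimes> \<dots> \<otimes> \<theta> (j n)\<close> in the expansion of the pure tensor of \<open>t\<close>.\<close>

definition weight :: "(nat \<Rightarrow> nat) \<Rightarrow> (nat \<Rightarrow> 'b) \<Rightarrow> 'a"
  where "weight j t = (\<Otimes>i\<in>{1..n}. crd (t i) (j i))"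

lemma J_mem: "j \<in> J \<Longrightarrow> i \<in> {1..n} \<Longrightarrow> j i \<in> {1..n}"
  by (drule (1) PiE_mem)

lemma coords_at: "a \<in> carrier A \<Longrightarrow> j \<in> J \<Longrightarrow> i \<in> {1..n} \<Longrightarrow> crd a (j i) \<in> carrier R"
  by (rule coords_closed[OF _ J_mem])

lemma weight_closed: "j \<in> J \<Longrightarrow> weight j \<in> T \<rightarrow> carrier R"
  unfolding weight_def by (intro Pi_I R.finprod_closed coords_at tuple_entry)

lemma weight_mult:
  assumes "u \<in> T" "v \<in> T" "j \<in> J"
  shows "weight j (tuple_mult A n u v)
    = (\<Oplus>k\<in>J. (\<Otimes>i\<in>{1..n}. crd (v i \<otimes>\<^bsub>A\<^esub> \<theta> (k i)) (j i)) \<otimes> weight k u)"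
proof -
  have ji: "j i \<in> {1..n}" if "i \<in> {1..n}" for i
    using J_mem[OF assms(3) that] .
  have c: "crd (v i \<otimes>\<^bsub>A\<^esub> \<theta> k) (j i) \<in> carrier R" "crd (u i) k \<in> carrier R"
    if "i \<in> {1..n}" "k \<in> {1..n}" for i k
    using that assms tuple_entry by (auto intro!: coords_closed ji)
  have "weight j (tuple_mult A n u v)
      = (\<Otimes>i\<in>{1..n}. \<Oplus>k\<in>{1..n}. crd (v i \<otimes>\<^bsub>A\<^esub> \<theta> k) (j i) \<otimes> crd (u i) k)"
    unfolding weight_def using assms c ji
    by (intro R.finprod_cong')
      (auto simp: tuple_mult_def intro!: coords_mult tuple_entry R.finsum_closed)
  also have "\<dots> = (\<Oplus>k\<in>J. \<Otimes>i\<in>{1..n}. crd (v i \<otimes>\<^bsub>A\<^esub> \<theta> (k i)) (j i) \<otimes> crd (u i) (k i))"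
    using c by (intro R.finprod_finsum_distrib) auto
  also have "\<dots> = (\<Oplus>k\<in>J. (\<Otimes>i\<in>{1..n}. crd (v i \<otimes>\<^bsub>A\<^esub> \<theta> (k i)) (j i)) \<otimes> weight k u)"
    unfolding weight_def using c
    by (intro R.finsum_cong' refl R.finprod_multf Pi_I R.finprod_closed R.m_closed) (auto dest: J_mem)
  finally show ?thesis .
qed

lemma tuple_upd: "t \<in> T \<Longrightarrow> i \<in> {1..n} \<Longrightarrow> a \<in> carrier A \<Longrightarrow> t(i := a) \<in> T"
  by (auto simp: tuples_def PiE_def extensional_def)

lemma weight_upd:
  assumes "t \<in> T" "i \<in> {1..n}" "a \<in> carrier A" "j \<in> J"
  shows "weight j (t(i := a)) = crd a (j i) \<otimes> (\<Otimes>l\<in>{1..n} - {i}. crd (t l) (j l))"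
proof -
  have c: "crd (t l) (j l) \<in> carrier R" if "l \<in> {1..n}" for l
    using that assms by (intro coords_at tuple_entry)
  have ci: "crd a (j i) \<in> carrier R"
    using assms(3) J_mem[OF assms(4,2)] by simp
  have eq: "{1..n} = insert i ({1..n} - {i})"
    using assms(2) by auto
  have "weight j (t(i := a)) = (\<Otimes>l\<in>insert i ({1..n} - {i}). crd ((t(i := a)) l) (j l))"
    unfolding weight_def using eq by simp
  also have "\<dots> = crd a (j i) \<otimes> (\<Otimes>l\<in>{1..n} - {i}. crd ((t(i := a)) l) (j l))"
    using c ci by (subst R.finprod_insert) auto
  also have "(\<Otimes>l\<in>{1..n} - {i}. crd ((t(i := a)) l) (j l)) = (\<Otimes>l\<in>{1..n} - {i}. crd (t l) (j l))"
    using c by (intro R.finprod_cong') auto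
  finally show ?thesis .
qed

lemma weight_linear:
  assumes "t \<in> T" "i \<in> {1..n}" "j \<in> J"
  shows "a \<in> carrier A \<Longrightarrow> b \<in> carrier A \<Longrightarrow>
      weight j (t(i := a \<oplus>\<^bsub>A\<^esub> b)) = weight j (t(i := a)) \<oplus> weight j (t(i := b))"
    and "a \<in> carrier A \<Longrightarrow> r \<in> carrier R \<Longrightarrow>
      weight j (t(i := r \<odot>\<^bsub>A\<^esub> a)) = r \<otimes> weight j (t(i := a))"
proof -
  have c: "(\<Otimes>l\<in>{1..n} - {i}. crd (t l) (j l)) \<in> carrier R"
    using assms by (intro Pi_I R.finprod_closed coords_at tuple_entry) auto
  have ji: "j i \<in> {1..n}" using J_mem[OF assms(3,2)] .
  show "a \<in> carrier A \<Longrightarrow> b \<in> carrier A \<Longrightarrow>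
      weight j (t(i := a \<oplus>\<^bsub>A\<^esub> b)) = weight j (t(i := a)) \<oplus> weight j (t(i := b))"
    using assms c coords_closed[OF _ ji] coords_add[OF _ _ ji] by (simp add: weight_upd R.l_distr)
  show "a \<in> carrier A \<Longrightarrow> r \<in> carrier R \<Longrightarrow>
      weight j (t(i := r \<odot>\<^bsub>A\<^esub> a)) = r \<otimes> weight j (t(i := a))"
    using assms c coords_closed[OF _ ji] coords_smult[OF _ _ ji] by (simp add: weight_upd R.m_assoc)
qed

lemma lin_ext_zero [simp]: "lin_ext w \<zero>\<^bsub>F\<^esub> = \<zero>"
  by (simp add: lin_ext_def F_simps R.finsum_empty)

lemma lin_ext_minus:
  assumes "f \<in> carrier F" "w \<in> T \<rightarrow> carrier R"
  shows "lin_ext w (\<ominus>\<^bsub>F\<^esub> f) = \<ominus> lin_ext w f"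
proof -
  have "lin_ext w (\<ominus>\<^bsub>F\<^esub> f) \<oplus> lin_ext w f = lin_ext w (\<ominus>\<^bsub>F\<^esub> f \<oplus>\<^bsub>F\<^esub> f)"
    using assms by (intro lin_ext_add[symmetric]) auto
  also have "\<dots> = \<zero>"
    using assms by (simp add: F.l_neg)
  finally show ?thesis
    using assms by (intro R.sum_zero_eq_neg lin_ext_closed) auto
qed

lemma lin_ext_diff:
  assumes "f \<in> carrier F" "g \<in> carrier F" "w \<in> T \<rightarrow> carrier R"
  shows "lin_ext w (f \<ominus>\<^bsub>F\<^esub> g) = lin_ext w f \<ominus> lin_ext w g"
  using assms by (simp add: a_minus_def lin_ext_add lin_ext_minus)

text \<open>The elements on which all coordinate functionals vanish. They form an ideal, because the weights
  of a product \<open>u v\<close> are linear combinations of the weights of \<open>u\<close>, with coefficients depending on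
  \<open>v\<close> (\<open>weight_mult\<close>), and they contain the multilinearity relations. So coordinates are well defined on the tensor power.\<close>

definition null_vectors :: "((nat \<Rightarrow> 'b) \<Rightarrow> 'a) set"
  where "null_vectors = {f \<in> carrier F. \<forall>j\<in>J. lin_ext (weight j) f = \<zero>}"

lemma null_vectors_mult:
  assumes f: "f \<in> null_vectors" and g: "g \<in> carrier F"
  shows "f \<otimes>\<^bsub>F\<^esub> g \<in> null_vectors"
proof -
  have fc: "f \<in> carrier F" using f by (simp add: null_vectors_def)
  have "lin_ext (weight j) (f \<otimes>\<^bsub>F\<^esub> g) = \<zero>" if j: "j \<in> J" for j
  proof -
    let ?w = "\<lambda>u v. weight j (tuple_mult A n u v)"
    have wc: "?w u v \<in> carrier R" if "u \<in> T" "v \<in> T" for u v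
      using that weight_closed[OF j] tuple_mult_closed by blast
    have z: "lin_ext (\<lambda>u. ?w u v) f = \<zero>" if v: "v \<in> T" for v
    proof -
      let ?m = "\<lambda>k. \<Otimes>i\<in>{1..n}. crd (v i \<otimes>\<^bsub>A\<^esub> \<theta> (k i)) (j i)"
      have mc: "?m k \<in> carrier R" if "k \<in> J" for k
        using v j
        by (intro Pi_I R.finprod_closed coords_at A.m_closed tuple_entry theta_closed J_mem[OF that])
      have "lin_ext (\<lambda>u. ?w u v) f = lin_ext (\<lambda>u. \<Oplus>k\<in>J. ?m k \<otimes> weight k u) f"
        using v j wc by (intro lin_ext_cong[OF fc] Pi_I weight_mult)
      also have "\<dots> = \<zero>"
      proof -
        have "lin_ext (\<lambda>u. \<Oplus>k\<in>K. ?m k \<otimes> weight k u) f = \<zero>" if "finite K" "K \<subseteq> J" for K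
          using that
        proof (induction K)
          case empty
          have "supp f \<subseteq> T" "f t \<in> carrier R" for t using fc by (auto simp: carrier_F)
          then show ?case by (simp add: lin_ext_def R.finsum_empty)
        next
          case (insert k K)
          have wk: "weight k \<in> T \<rightarrow> carrier R" and m: "?m k \<in> carrier R"
            using insert.prems mc weight_closed by auto
          have t: "?m k \<otimes> weight k u \<in> carrier R" if "k \<in> J" "u \<in> T" for k u
            using that mc funcset_mem[OF weight_closed] by (intro R.m_closed) blast+
          have s: "(\<lambda>u. \<Oplus>k\<in>K. ?m k \<otimes> weight k u) \<in> T \<rightarrow> carrier R"
            using t insert.prems by (intro Pi_I R.finsum_closed) blast
          have "lin_ext (\<lambda>u. \<Oplus>k\<in>insert k K. ?m k \<otimes> weight k u) f
              = lin_ext (\<lambda>u. ?m k \<otimes> weight k u \<oplus> (\<Oplus>k\<in>K. ?m k \<otimes> weight k u)) f"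
          proof (rule lin_ext_cong[OF fc])
            show "(\<lambda>u. \<Oplus>k\<in>insert k K. ?m k \<otimes> weight k u) \<in> T \<rightarrow> carrier R"
              using t insert.prems by (intro Pi_I R.finsum_closed) blast
            show "(\<Oplus>k\<in>insert k K. ?m k \<otimes> weight k u)
                = ?m k \<otimes> weight k u \<oplus> (\<Oplus>k\<in>K. ?m k \<otimes> weight k u)" if "u \<in> T" for u
              using t[OF _ that] insert by (intro R.finsum_insert) auto
          qed
          also have "\<dots> = ?m k \<otimes> lin_ext (weight k) f \<oplus> lin_ext (\<lambda>u. \<Oplus>k\<in>K. ?m k \<otimes> weight k u) f"
          proof -
            have "(\<lambda>u. ?m k \<otimes> weight k u) \<in> T \<rightarrow> carrier R"
              using t insert.prems by blast
            then show ?thesis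
              using lin_ext_weight_add[OF fc _ s] lin_ext_weight_smult[OF fc wk m] by simp
          qed
          also have "\<dots> = \<zero>"
            using insert f m by (simp add: null_vectors_def)
          finally show ?case .
        qed
        then show ?thesis by (simp add: finite_PiE)
      qed
      finally show ?thesis .
    qed
    have "lin_ext (weight j) (f \<otimes>\<^bsub>F\<^esub> g) = lin_ext (\<lambda>v. lin_ext (\<lambda>u. ?w u v) f) g"
      using lin_ext_mult[OF fc g weight_closed[OF j]] lin_ext_swap[OF fc g, of ?w] wc by simp
    also have "\<dots> = lin_ext (\<lambda>v. \<zero>) g"
      using z by (intro lin_ext_cong g) auto
    also have "\<dots> = \<zero>"
      using g by (simp add: lin_ext_def carrier_F)
    finally show ?thesis .
  qed
  then show ?thesis
    using fc g by (simp add: null_vectors_def)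
qed

lemma ideal_null_vectors: "ideal null_vectors F"
proof (rule idealI)
  show "subgroup null_vectors (add_monoid F)"
  proof (rule group.subgroupI[OF F.a_group])
    show "null_vectors \<noteq> {}"
      by (auto simp: null_vectors_def intro!: exI[of _ "\<zero>\<^bsub>F\<^esub>"])
    fix f assume "f \<in> null_vectors"
    then show "inv\<^bsub>add_monoid F\<^esub> f \<in> null_vectors"
      unfolding a_inv_def[symmetric] by (auto simp: null_vectors_def lin_ext_minus weight_closed)
  next
    fix f g assume "f \<in> null_vectors" "g \<in> null_vectors"
    then show "f \<otimes>\<^bsub>add_monoid F\<^esub> g \<in> null_vectors"
      by (auto simp: null_vectors_def lin_ext_add weight_closed)
  qed (auto simp: null_vectors_def)
  show "x \<otimes>\<^bsub>F\<^esub> a \<in> null_vectors" "a \<otimes>\<^bsub>F\<^esub> x \<in> null_vectors"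
    if "a \<in> null_vectors" "x \<in> carrier F" for a x
  proof -
    have "a \<in> carrier F" using that by (simp add: null_vectors_def)
    then show "x \<otimes>\<^bsub>F\<^esub> a \<in> null_vectors" "a \<otimes>\<^bsub>F\<^esub> x \<in> null_vectors"
      using null_vectors_mult[OF that] F.m_comm[of x a] that by auto
  qed
qed (rule F.ring_axioms)

abbreviation I where "I \<equiv> tensor_ideal R A n"

lemma minus_self: "x \<in> carrier R \<Longrightarrow> x \<ominus> x = \<zero>"
  by (simp add: a_minus_def R.r_neg)

lemma minus_zeroD: "x \<ominus> y = \<zero> \<Longrightarrow> x \<in> carrier R \<Longrightarrow> y \<in> carrier R \<Longrightarrow> x = y"
  unfolding a_minus_def using R.sum_zero_eq_neg[of x "\<ominus> y"] by simp

lemma relations_null: "tensor_relations R A n \<subseteq> null_vectors"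
proof
  fix x assume "x \<in> tensor_relations R A n"
  then consider
    (add) t i a b where "t \<in> T" "i \<in> {1..n}" "a \<in> carrier A" "b \<in> carrier A"
      "x = free_gen R (t(i := a \<oplus>\<^bsub>A\<^esub> b)) \<ominus>\<^bsub>F\<^esub> (free_gen R (t(i := a)) \<oplus>\<^bsub>F\<^esub> free_gen R (t(i := b)))"
  | (smult) t i r a where "t \<in> T" "i \<in> {1..n}" "r \<in> carrier R" "a \<in> carrier A"
      "x = free_gen R (t(i := r \<odot>\<^bsub>A\<^esub> a)) \<ominus>\<^bsub>F\<^esub> (r \<odot>\<^bsub>F\<^esub> free_gen R (t(i := a)))"
    unfolding tensor_relations_def Let_def by blast
  then show "x \<in> null_vectors"
  proof cases
    case add
    then have g: "free_gen R (t(i := a \<oplus>\<^bsub>A\<^esub> b)) \<in> carrier F" "free_gen R (t(i := a)) \<in> carrier F"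
        "free_gen R (t(i := b)) \<in> carrier F"
      by (auto intro!: free_gen_closed tuple_upd)
    have "lin_ext (weight j) x = \<zero>" if j: "j \<in> J" for j
    proof -
      have "weight j (t(i := a)) \<in> carrier R" "weight j (t(i := b)) \<in> carrier R"
        using add j by (auto intro!: funcset_mem[OF weight_closed] tuple_upd)
      then show ?thesis
        unfolding add using add(1-4) g weight_closed[OF j] j
        by (simp add: lin_ext_diff lin_ext_add lin_ext_gen tuple_upd weight_linear minus_self)
    qed
    then show ?thesis using g unfolding add(5) null_vectors_def by simp
  next
    case smult
    then have g: "free_gen R (t(i := r \<odot>\<^bsub>A\<^esub> a)) \<in> carrier F" "free_gen R (t(i := a)) \<in> carrier F"
      by (auto intro!: free_gen_closed tuple_upd)
    have "lin_ext (weight j) x = \<zero>" if j: "j \<in> J" for j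
    proof -
      have "weight j (t(i := a)) \<in> carrier R"
        using smult j by (auto intro!: funcset_mem[OF weight_closed] tuple_upd)
      then show ?thesis
        unfolding smult using smult(1-4) g weight_closed[OF j] j
        by (simp add: lin_ext_diff lin_ext_smult lin_ext_gen tuple_upd weight_linear minus_self)
    qed
    then show ?thesis using g smult(3) unfolding smult(5) null_vectors_def by simp
  qed
qed

lemma relations_closed: "tensor_relations R A n \<subseteq> carrier F"
  using relations_null by (auto simp: null_vectors_def)

lemma ideal_I: "ideal I F"
  unfolding tensor_ideal_def by (rule F.genideal_ideal[OF relations_closed])

sublocale I: ideal I F
  by (rule ideal_I)

lemma I_null: "I \<subseteq> null_vectors"
  unfolding tensor_ideal_def by (rule F.genideal_minimal[OF ideal_null_vectors relations_null])

lemma relations_I: "tensor_relations R A n \<subseteq> I"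
  unfolding tensor_ideal_def by (rule F.genideal_self[OF relations_closed])

section \<open>The tensor power as a free module\<close>

abbreviation B where "B \<equiv> tensor_power R A n"
abbreviation cls :: "((nat \<Rightarrow> 'b) \<Rightarrow> 'a) \<Rightarrow> ((nat \<Rightarrow> 'b) \<Rightarrow> 'a) set"
  where "cls f \<equiv> I +>\<^bsub>F\<^esub> f"
abbreviation pure where "pure \<equiv> pure_tensor R A n"
abbreviation \<iota> where "\<iota> \<equiv> tensor_at R A n"

lemma cls_eq_iff:
  "f \<in> carrier F \<Longrightarrow> g \<in> carrier F \<Longrightarrow> cls f = cls g \<longleftrightarrow> f \<ominus>\<^bsub>F\<^esub> g \<in> I"
  using F.quotient_eq_iff_same_a_r_cos[OF ideal_I] by blast

lemma mem_cls_iff: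
  "f \<in> carrier F \<Longrightarrow> g \<in> cls f \<longleftrightarrow> g \<in> carrier F \<and> g \<ominus>\<^bsub>F\<^esub> f \<in> I"
  using I.a_rcos_module[of f g] I.a_elemrcos_carrier[of f g] by (auto simp: a_minus_def)

lemma carrier_B: "carrier B = cls ` carrier F"
  by (auto simp: tensor_power_def Let_def FactRing_def A_RCOSETS_def' image_def)

lemma cls_closed [simp]: "f \<in> carrier F \<Longrightarrow> cls f \<in> carrier B"
  by (simp add: carrier_B)

lemma cls_ring_ops:
  assumes "f \<in> carrier F" "g \<in> carrier F"
  shows cls_mult: "cls f \<otimes>\<^bsub>B\<^esub> cls g = cls (f \<otimes>\<^bsub>F\<^esub> g)"
    and cls_add: "cls f \<oplus>\<^bsub>B\<^esub> cls g = cls (f \<oplus>\<^bsub>F\<^esub> g)"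
  using I.rcoset_mult_add[OF assms] I.a_rcos_sum[OF assms]
  by (simp_all add: tensor_power_def Let_def FactRing_def)

lemma cls_one: "cls \<one>\<^bsub>F\<^esub> = \<one>\<^bsub>B\<^esub>" and cls_zero: "cls \<zero>\<^bsub>F\<^esub> = \<zero>\<^bsub>B\<^esub>"
  using I.a_rcos_const[OF I.zero_closed]
  by (simp_all add: tensor_power_def Let_def FactRing_def)

lemma cls_smult:
  assumes f: "f \<in> carrier F" and r: "r \<in> carrier R"
  shows "r \<odot>\<^bsub>B\<^esub> cls f = cls (r \<odot>\<^bsub>F\<^esub> f)"
proof -
  have "cls (r \<odot>\<^bsub>F\<^esub> g) = cls (r \<odot>\<^bsub>F\<^esub> f)" if g: "g \<in> cls f" for g
  proof -
    have gc: "g \<in> carrier F" "g \<ominus>\<^bsub>F\<^esub> f \<in> I"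
      using g mem_cls_iff[OF f] by auto
    have r1: "r \<odot>\<^bsub>F\<^esub> \<one>\<^bsub>F\<^esub> \<in> carrier F"
      using r by simp
    have "r \<odot>\<^bsub>F\<^esub> g \<ominus>\<^bsub>F\<^esub> r \<odot>\<^bsub>F\<^esub> f = r \<odot>\<^bsub>F\<^esub> (g \<ominus>\<^bsub>F\<^esub> f)"
      using r gc f by (simp add: a_minus_def F.smult_r_distr F.smult_r_minus)
    also have "\<dots> = (r \<odot>\<^bsub>F\<^esub> \<one>\<^bsub>F\<^esub>) \<otimes>\<^bsub>F\<^esub> (g \<ominus>\<^bsub>F\<^esub> f)"
      using r gc f by (simp add: F.smult_assoc2)
    also have "\<dots> \<in> I"
      using gc r1 by (intro I.I_l_closed)
    finally show ?thesis
      using gc f r by (simp add: cls_eq_iff)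
  qed
  moreover have "f \<in> cls f"
    using f by (rule I.a_rcos_self)
  ultimately have "(\<Union>g\<in>cls f. cls (r \<odot>\<^bsub>F\<^esub> g)) = cls (r \<odot>\<^bsub>F\<^esub> f)"
    by blast
  then show ?thesis
    unfolding tensor_power_def Let_def by simp
qed

text \<open>The tensor power has the ring operations of the quotient ring, so it inherits their laws.\<close>

lemma algebra_B: "algebra R B"
proof -
  interpret Q: cring "F Quot I"
    by (rule I.quotient_is_cring) (rule F.is_cring)
  have Q: "carrier (F Quot I) = carrier B" "mult (F Quot I) = mult B" "one (F Quot I) = one B"
    "zero (F Quot I) = zero B" "add (F Quot I) = add B"
    by (simp_all add: tensor_power_def Let_def)
  have cring: "cring B"
  proof (rule cringI)
    show "abelian_group B"
    proof (rule abelian_groupI)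
      show "\<exists>y\<in>carrier B. y \<oplus>\<^bsub>B\<^esub> x = \<zero>\<^bsub>B\<^esub>" if "x \<in> carrier B" for x
        using Q.l_neg[of x] Q.a_inv_closed[of x] that unfolding Q by blast
    qed (use Q.a_assoc Q.a_comm Q.l_zero Q.a_closed Q.zero_closed in \<open>auto simp: Q\<close>)
    show "comm_monoid B"
      by (rule comm_monoidI)
        (use Q.m_assoc Q.m_comm Q.l_one Q.m_closed Q.one_closed in \<open>auto simp: Q\<close>)
  qed (use Q.l_distr in \<open>auto simp: Q\<close>)
  show ?thesis
  proof (rule algebraI)
    show "cring B" by (rule cring)
  qed (auto simp: carrier_B cls_smult cls_ring_ops R.is_cring F.smult_l_distr F.smult_r_distr
      F.smult_assoc1 F.smult_assoc2)
qed

sublocale B: algebra R B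
  by (rule algebra_B)

sublocale B: cring B
  by (rule B.M_cring)

lemma pure_cls: "pure t = cls (free_gen R t)"
  by (simp add: pure_tensor_def)

lemma pure_closed [simp]: "t \<in> T \<Longrightarrow> pure t \<in> carrier B"
  by (simp add: pure_cls free_gen_closed)

lemma gen_mult:
  assumes "u \<in> T" "v \<in> T"
  shows "free_gen R u \<otimes>\<^bsub>F\<^esub> free_gen R v = free_gen R (tuple_mult A n u v)"
proof (rule F_ext)
  fix w assume w: "w \<in> T \<rightarrow> carrier R"
  have wc: "w (tuple_mult A n a b) \<in> carrier R" if "a \<in> T" "b \<in> T" for a b
    using that by (intro funcset_mem[OF w] tuple_mult_closed)
  have in1: "(\<lambda>b. w (tuple_mult A n a b)) \<in> T \<rightarrow> carrier R" if "a \<in> T" for a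
    using that wc by blast
  have "lin_ext w (free_gen R u \<otimes>\<^bsub>F\<^esub> free_gen R v)
      = lin_ext (\<lambda>a. lin_ext (\<lambda>b. w (tuple_mult A n a b)) (free_gen R v)) (free_gen R u)"
    using assms w by (intro lin_ext_mult free_gen_closed)
  also have "\<dots> = w (tuple_mult A n u v)"
    using in1 assms
    by (subst lin_ext_gen[OF assms(1)])
      (auto intro!: lin_ext_closed free_gen_closed lin_ext_gen)
  also have "\<dots> = lin_ext w (free_gen R (tuple_mult A n u v))"
    using assms w by (simp add: lin_ext_gen tuple_mult_closed)
  finally show "lin_ext w (free_gen R u \<otimes>\<^bsub>F\<^esub> free_gen R v)
      = lin_ext w (free_gen R (tuple_mult A n u v))" .
qed (use assms in \<open>auto simp: free_gen_closed tuple_mult_closed\<close>)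

lemma pure_mult: "u \<in> T \<Longrightarrow> v \<in> T \<Longrightarrow> pure u \<otimes>\<^bsub>B\<^esub> pure v = pure (tuple_mult A n u v)"
  by (simp add: pure_cls cls_mult free_gen_closed gen_mult)

lemma pure_one: "pure (\<lambda>i\<in>{1..n}. \<one>\<^bsub>A\<^esub>) = \<one>\<^bsub>B\<^esub>"
  by (simp add: pure_cls cls_one[symmetric] F_simps(2))

lemma pure_upd_add:
  assumes "t \<in> T" "i \<in> {1..n}" "a \<in> carrier A" "b \<in> carrier A"
  shows "pure (t(i := a \<oplus>\<^bsub>A\<^esub> b)) = pure (t(i := a)) \<oplus>\<^bsub>B\<^esub> pure (t(i := b))"
proof -
  have g: "free_gen R (t(i := a \<oplus>\<^bsub>A\<^esub> b)) \<in> carrier F" "free_gen R (t(i := a)) \<in> carrier F"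
      "free_gen R (t(i := b)) \<in> carrier F"
    using assms by (auto intro!: free_gen_closed tuple_upd)
  have "free_gen R (t(i := a \<oplus>\<^bsub>A\<^esub> b)) \<ominus>\<^bsub>F\<^esub> (free_gen R (t(i := a)) \<oplus>\<^bsub>F\<^esub> free_gen R (t(i := b)))
      \<in> tensor_relations R A n"
    unfolding tensor_relations_def Let_def using assms by blast
  then have "free_gen R (t(i := a \<oplus>\<^bsub>A\<^esub> b)) \<ominus>\<^bsub>F\<^esub> (free_gen R (t(i := a)) \<oplus>\<^bsub>F\<^esub> free_gen R (t(i := b))) \<in> I"
    using relations_I by blast
  then show ?thesis
    using g by (simp add: pure_cls cls_add cls_eq_iff)
qed

lemma pure_upd_smult:
  assumes "t \<in> T" "i \<in> {1..n}" "a \<in> carrier A" "r \<in> carrier R"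
  shows "pure (t(i := r \<odot>\<^bsub>A\<^esub> a)) = r \<odot>\<^bsub>B\<^esub> pure (t(i := a))"
proof -
  have g: "free_gen R (t(i := r \<odot>\<^bsub>A\<^esub> a)) \<in> carrier F" "free_gen R (t(i := a)) \<in> carrier F"
    using assms by (auto intro!: free_gen_closed tuple_upd)
  have "free_gen R (t(i := r \<odot>\<^bsub>A\<^esub> a)) \<ominus>\<^bsub>F\<^esub> (r \<odot>\<^bsub>F\<^esub> free_gen R (t(i := a))) \<in> tensor_relations R A n"
    unfolding tensor_relations_def Let_def using assms by blast
  then have "free_gen R (t(i := r \<odot>\<^bsub>A\<^esub> a)) \<ominus>\<^bsub>F\<^esub> (r \<odot>\<^bsub>F\<^esub> free_gen R (t(i := a))) \<in> I"
    using relations_I by blast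
  then show ?thesis
    using g assms(4) by (simp add: pure_cls cls_smult cls_eq_iff)
qed

lemma tensor_at_upd:
  assumes "i \<in> {1..n}"
  shows "\<iota> i a = pure ((\<lambda>j\<in>{1..n}. \<one>\<^bsub>A\<^esub>)(i := a))"
proof -
  have "(\<lambda>j\<in>{1..n}. if j = i then a else \<one>\<^bsub>A\<^esub>) = (\<lambda>j\<in>{1..n}. \<one>\<^bsub>A\<^esub>)(i := a)"
    using assms by (auto simp: fun_eq_iff restrict_def)
  then show ?thesis by (simp add: tensor_at_def)
qed

lemma iota_closed [simp]: "i \<in> {1..n} \<Longrightarrow> a \<in> carrier A \<Longrightarrow> \<iota> i a \<in> carrier B"
  unfolding tensor_at_upd by (intro pure_closed tuple_upd tuple_one_closed)

lemma iota_add: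
  "i \<in> {1..n} \<Longrightarrow> a \<in> carrier A \<Longrightarrow> b \<in> carrier A \<Longrightarrow> \<iota> i (a \<oplus>\<^bsub>A\<^esub> b) = \<iota> i a \<oplus>\<^bsub>B\<^esub> \<iota> i b"
  unfolding tensor_at_upd by (intro pure_upd_add tuple_one_closed)

lemma iota_smult:
  "i \<in> {1..n} \<Longrightarrow> a \<in> carrier A \<Longrightarrow> r \<in> carrier R \<Longrightarrow> \<iota> i (r \<odot>\<^bsub>A\<^esub> a) = r \<odot>\<^bsub>B\<^esub> \<iota> i a"
  unfolding tensor_at_upd by (intro pure_upd_smult tuple_one_closed)

lemma iota_mult:
  assumes "i \<in> {1..n}" "a \<in> carrier A" "b \<in> carrier A"
  shows "\<iota> i (a \<otimes>\<^bsub>A\<^esub> b) = \<iota> i a \<otimes>\<^bsub>B\<^esub> \<iota> i b"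
proof -
  let ?o = "\<lambda>j\<in>{1..n}. \<one>\<^bsub>A\<^esub>"
  have "tuple_mult A n (?o(i := a)) (?o(i := b)) = ?o(i := a \<otimes>\<^bsub>A\<^esub> b)"
    using assms(1) by (auto simp: tuple_mult_def fun_eq_iff restrict_def)
  then show ?thesis
    unfolding tensor_at_upd[OF assms(1)] using assms
    by (simp only: pure_mult tuple_upd tuple_one_closed)
qed

text \<open>Entries in different positions multiply without interaction.\<close>

lemma prod_iota_restrict:
  assumes "finite S" "S \<subseteq> {1..n}" "\<And>i. i \<in> {1..n} \<Longrightarrow> t i \<in> carrier A"
  shows "(\<Otimes>\<^bsub>B\<^esub>i\<in>S. \<iota> i (t i)) = pure (\<lambda>j\<in>{1..n}. if j \<in> S then t j else \<one>\<^bsub>A\<^esub>)"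
  using assms(1,2)
proof (induction S)
  case empty
  show ?case by (simp only: B.finprod_empty empty_iff if_False pure_one)
next
  case (insert i S)
  let ?t = "\<lambda>S. \<lambda>j\<in>{1..n}. if j \<in> S then t j else \<one>\<^bsub>A\<^esub>"
  have T: "?t S \<in> T" for S
    using assms(3) by (auto simp: tuples_def)
  have "(\<Otimes>\<^bsub>B\<^esub>i\<in>insert i S. \<iota> i (t i)) = \<iota> i (t i) \<otimes>\<^bsub>B\<^esub> (\<Otimes>\<^bsub>B\<^esub>i\<in>S. \<iota> i (t i))"
    using insert assms(3) by (intro B.finprod_insert Pi_I iota_closed) auto
  also have "\<dots> = pure (?t {i}) \<otimes>\<^bsub>B\<^esub> pure (?t S)"
  proof -
    have "\<iota> i (t i) = pure (?t {i})"
      unfolding tensor_at_def by (rule arg_cong[where f = pure], rule restrict_ext) auto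
    moreover have "(\<Otimes>\<^bsub>B\<^esub>i\<in>S. \<iota> i (t i)) = pure (?t S)"
      using insert by blast
    ultimately show ?thesis by simp
  qed
  also have "\<dots> = pure (tuple_mult A n (?t {i}) (?t S))"
    by (rule pure_mult[OF T T])
  also have "tuple_mult A n (?t {i}) (?t S) = ?t (insert i S)"
    using insert assms(3) by (auto simp: tuple_mult_def fun_eq_iff restrict_def)
  finally show ?case .
qed

lemma prod_iota:
  assumes "t \<in> T"
  shows "(\<Otimes>\<^bsub>B\<^esub>i\<in>{1..n}. \<iota> i (t i)) = pure t"
proof -
  have "(\<lambda>j\<in>{1..n}. if j \<in> {1..n} then t j else \<one>\<^bsub>A\<^esub>) = t"
    using assms by (auto simp: tuples_def fun_eq_iff restrict_def PiE_def extensional_def)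
  then show ?thesis
    using assms prod_iota_restrict[of "{1..n}" t] tuple_entry[OF assms] by simp
qed

text \<open>The pure tensor of basis elements attached to a self-map of the positions; these form the
  basis of the tensor power.\<close>

definition E :: "(nat \<Rightarrow> nat) \<Rightarrow> ((nat \<Rightarrow> 'b) \<Rightarrow> 'a) set"
  where "E f = (\<Otimes>\<^bsub>B\<^esub>i\<in>{1..n}. \<iota> i (\<theta> (f i)))"

lemma E_pure: "f \<in> J \<Longrightarrow> E f = pure (\<lambda>i\<in>{1..n}. \<theta> (f i))"
  using J_mem[of f] unfolding E_def
  by (subst prod_iota_restrict) (auto intro!: arg_cong[where f = pure] simp: restrict_def fun_eq_iff)

lemma theta_tuple: "f \<in> J \<Longrightarrow> (\<lambda>i\<in>{1..n}. \<theta> (f i)) \<in> T"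
  using J_mem[of f] by (auto simp: tuples_def)

lemma E_closed [simp]: "f \<in> J \<Longrightarrow> E f \<in> carrier B"
  by (simp only: E_pure pure_closed theta_tuple)

lemma finite_J [simp]: "finite J"
  by (intro finite_PiE) auto

lemma B_smult_mult_smult:
  assumes "r \<in> carrier R" "s \<in> carrier R" "x \<in> carrier B" "y \<in> carrier B"
  shows "(r \<odot>\<^bsub>B\<^esub> x) \<otimes>\<^bsub>B\<^esub> (s \<odot>\<^bsub>B\<^esub> y) = (r \<otimes> s) \<odot>\<^bsub>B\<^esub> (x \<otimes>\<^bsub>B\<^esub> y)"
proof -
  have "(r \<odot>\<^bsub>B\<^esub> x) \<otimes>\<^bsub>B\<^esub> (s \<odot>\<^bsub>B\<^esub> y) = r \<odot>\<^bsub>B\<^esub> ((s \<odot>\<^bsub>B\<^esub> y) \<otimes>\<^bsub>B\<^esub> x)"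
    using assms B.m_comm[of x "s \<odot>\<^bsub>B\<^esub> y"] by (simp add: B.smult_assoc2)
  also have "\<dots> = (r \<otimes> s) \<odot>\<^bsub>B\<^esub> (x \<otimes>\<^bsub>B\<^esub> y)"
    using assms B.m_comm[of x y] by (simp add: B.smult_assoc2 B.smult_assoc1)
  finally show ?thesis .
qed

lemma B_finprod_smult:
  assumes "finite S" "c \<in> S \<rightarrow> carrier R" "x \<in> S \<rightarrow> carrier B"
  shows "(\<Otimes>\<^bsub>B\<^esub>i\<in>S. c i \<odot>\<^bsub>B\<^esub> x i) = (\<Otimes>i\<in>S. c i) \<odot>\<^bsub>B\<^esub> (\<Otimes>\<^bsub>B\<^esub>i\<in>S. x i)"
  using assms
proof (induction S)
  case (insert i S)
  have c: "c i \<in> carrier R" "x i \<in> carrier B" "c \<in> S \<rightarrow> carrier R" "x \<in> S \<rightarrow> carrier B"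
    using insert.prems by auto
  have "(\<Otimes>\<^bsub>B\<^esub>i\<in>insert i S. c i \<odot>\<^bsub>B\<^esub> x i) = (c i \<odot>\<^bsub>B\<^esub> x i) \<otimes>\<^bsub>B\<^esub> (\<Otimes>\<^bsub>B\<^esub>i\<in>S. c i \<odot>\<^bsub>B\<^esub> x i)"
    using insert.hyps c by (intro B.finprod_insert) auto
  also have "\<dots> = (c i \<odot>\<^bsub>B\<^esub> x i) \<otimes>\<^bsub>B\<^esub> ((\<Otimes>i\<in>S. c i) \<odot>\<^bsub>B\<^esub> (\<Otimes>\<^bsub>B\<^esub>i\<in>S. x i))"
    using insert.IH c by simp
  also have "\<dots> = (c i \<otimes> (\<Otimes>i\<in>S. c i)) \<odot>\<^bsub>B\<^esub> (x i \<otimes>\<^bsub>B\<^esub> (\<Otimes>\<^bsub>B\<^esub>i\<in>S. x i))"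
    using c by (intro B_smult_mult_smult) auto
  also have "\<dots> = (\<Otimes>i\<in>insert i S. c i) \<odot>\<^bsub>B\<^esub> (\<Otimes>\<^bsub>B\<^esub>i\<in>insert i S. x i)"
    using insert.hyps c by simp
  finally show ?case .
qed simp

lemma iota_lincomb:
  assumes "i \<in> {1..n}" "finite K" "c \<in> K \<rightarrow> carrier R" "x \<in> K \<rightarrow> carrier A"
  shows "\<iota> i (\<Oplus>\<^bsub>A\<^esub>k\<in>K. c k \<odot>\<^bsub>A\<^esub> x k) = (\<Oplus>\<^bsub>B\<^esub>k\<in>K. c k \<odot>\<^bsub>B\<^esub> \<iota> i (x k))"
  using assms(2-4)
proof (induction K)
  case empty
  have "\<iota> i (\<zero> \<odot>\<^bsub>A\<^esub> \<one>\<^bsub>A\<^esub>) = \<zero> \<odot>\<^bsub>B\<^esub> \<iota> i \<one>\<^bsub>A\<^esub>"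
    using assms(1) by (intro iota_smult) auto
  then show ?case
    using assms(1) by (simp add: A.finsum_empty B.finsum_empty)
next
  case (insert k K)
  have c: "c k \<in> carrier R" "x k \<in> carrier A" "c \<in> K \<rightarrow> carrier R" "x \<in> K \<rightarrow> carrier A"
    using insert.prems by auto
  have ca: "(\<lambda>k. c k \<odot>\<^bsub>A\<^esub> x k) \<in> K \<rightarrow> carrier A"
    using c by (auto simp: Pi_iff)
  have cb: "(\<lambda>k. c k \<odot>\<^bsub>B\<^esub> \<iota> i (x k)) \<in> K \<rightarrow> carrier B"
    using c assms(1) by (auto simp: Pi_iff)
  have "(\<Oplus>\<^bsub>A\<^esub>k\<in>insert k K. c k \<odot>\<^bsub>A\<^esub> x k) = c k \<odot>\<^bsub>A\<^esub> x k \<oplus>\<^bsub>A\<^esub> (\<Oplus>\<^bsub>A\<^esub>k\<in>K. c k \<odot>\<^bsub>A\<^esub> x k)"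
    using insert.hyps c ca by (intro A.finsum_insert) auto
  moreover have "(\<Oplus>\<^bsub>B\<^esub>k\<in>insert k K. c k \<odot>\<^bsub>B\<^esub> \<iota> i (x k))
      = c k \<odot>\<^bsub>B\<^esub> \<iota> i (x k) \<oplus>\<^bsub>B\<^esub> (\<Oplus>\<^bsub>B\<^esub>k\<in>K. c k \<odot>\<^bsub>B\<^esub> \<iota> i (x k))"
    using insert.hyps c cb assms(1) by (intro B.finsum_insert) auto
  ultimately show ?case
    using insert.IH c ca assms(1) by (simp add: iota_add iota_smult A.finsum_closed)
qed

text \<open>Multilinear expansion: the tensors \<open>E j\<close> span.\<close>

lemma pure_expand:
  assumes t: "t \<in> T"
  shows "pure t = (\<Oplus>\<^bsub>B\<^esub>j\<in>J. weight j t \<odot>\<^bsub>B\<^esub> E j)"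
proof -
  have tc: "t i \<in> carrier A" if "i \<in> {1..n}" for i
    using tuple_entry[OF t that] .
  have c: "crd (t i) k \<in> carrier R" if "i \<in> {1..n}" "k \<in> {1..n}" for i k
    using tc that by simp
  have "pure t = (\<Otimes>\<^bsub>B\<^esub>i\<in>{1..n}. \<iota> i (t i))"
    using prod_iota[OF t] by simp
  also have "\<dots> = (\<Otimes>\<^bsub>B\<^esub>i\<in>{1..n}. \<Oplus>\<^bsub>B\<^esub>k\<in>{1..n}. crd (t i) k \<odot>\<^bsub>B\<^esub> \<iota> i (\<theta> k))"
  proof (rule B.finprod_cong')
    fix i assume i: "i \<in> {1..n}"
    have "\<iota> i (t i) = \<iota> i (\<Oplus>\<^bsub>A\<^esub>k\<in>{1..n}. crd (t i) k \<odot>\<^bsub>A\<^esub> \<theta> k)"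
      using coords_spec(2)[OF tc[OF i]] by simp
    also have "\<dots> = (\<Oplus>\<^bsub>B\<^esub>k\<in>{1..n}. crd (t i) k \<odot>\<^bsub>B\<^esub> \<iota> i (\<theta> k))"
      using i c by (intro iota_lincomb) auto
    finally show "\<iota> i (t i) = (\<Oplus>\<^bsub>B\<^esub>k\<in>{1..n}. crd (t i) k \<odot>\<^bsub>B\<^esub> \<iota> i (\<theta> k))" .
  qed (use c in \<open>auto intro!: B.finsum_closed\<close>)
  also have "\<dots> = (\<Oplus>\<^bsub>B\<^esub>j\<in>J. \<Otimes>\<^bsub>B\<^esub>i\<in>{1..n}. crd (t i) (j i) \<odot>\<^bsub>B\<^esub> \<iota> i (\<theta> (j i)))"
    using c by (intro B.finprod_finsum_distrib) auto
  also have "\<dots> = (\<Oplus>\<^bsub>B\<^esub>j\<in>J. weight j t \<odot>\<^bsub>B\<^esub> E j)"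
  proof (rule B.finsum_cong')
    show "(\<lambda>j. weight j t \<odot>\<^bsub>B\<^esub> E j) \<in> J \<rightarrow> carrier B"
      using funcset_mem[OF weight_closed t] by auto
    fix j assume j: "j \<in> J"
    have ji: "j i \<in> {1..n}" if "i \<in> {1..n}" for i
      using J_mem[OF j that] .
    show "(\<Otimes>\<^bsub>B\<^esub>i\<in>{1..n}. crd (t i) (j i) \<odot>\<^bsub>B\<^esub> \<iota> i (\<theta> (j i))) = weight j t \<odot>\<^bsub>B\<^esub> E j"
      unfolding weight_def E_def using c ji by (intro B_finprod_smult Pi_I iota_closed theta_closed) auto
  qed simp
  finally show ?thesis .
qed

text \<open>The coordinate at \<open>E j\<close>. The value does not depend on the representative of the coset, by
  \<open>kappa_cls\<close>.\<close>

definition \<kappa> :: "(nat \<Rightarrow> nat) \<Rightarrow> ((nat \<Rightarrow> 'b) \<Rightarrow> 'a) set \<Rightarrow> 'a"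
  where "\<kappa> j X = lin_ext (weight j) (SOME f. f \<in> X)"

lemma kappa_cls:
  assumes f: "f \<in> carrier F" and j: "j \<in> J"
  shows "\<kappa> j (cls f) = lin_ext (weight j) f"
proof -
  define g where "g = (SOME g. g \<in> cls f)"
  have "g \<in> cls f"
    unfolding g_def using I.a_rcos_self[OF f] someI[of "\<lambda>g. g \<in> cls f"] by blast
  then have g: "g \<in> carrier F" "g \<ominus>\<^bsub>F\<^esub> f \<in> null_vectors"
    using mem_cls_iff[OF f] I_null by auto
  then have "lin_ext (weight j) g \<ominus> lin_ext (weight j) f = \<zero>"
    using j f by (auto simp: null_vectors_def lin_ext_diff weight_closed)
  then have "lin_ext (weight j) g = lin_ext (weight j) f"
    by (rule minus_zeroD) (use g f j in \<open>auto intro!: lin_ext_closed weight_closed\<close>)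
  then show ?thesis by (simp add: \<kappa>_def g_def)
qed

lemma kappa_closed [simp]: "j \<in> J \<Longrightarrow> X \<in> carrier B \<Longrightarrow> \<kappa> j X \<in> carrier R"
  by (auto simp: carrier_B kappa_cls lin_ext_closed weight_closed)

lemma kappa_add:
  "j \<in> J \<Longrightarrow> X \<in> carrier B \<Longrightarrow> Y \<in> carrier B \<Longrightarrow> \<kappa> j (X \<oplus>\<^bsub>B\<^esub> Y) = \<kappa> j X \<oplus> \<kappa> j Y"
  by (auto simp: carrier_B kappa_cls cls_add lin_ext_add weight_closed)

lemma kappa_smult:
  "j \<in> J \<Longrightarrow> X \<in> carrier B \<Longrightarrow> r \<in> carrier R \<Longrightarrow> \<kappa> j (r \<odot>\<^bsub>B\<^esub> X) = r \<otimes> \<kappa> j X"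
  by (auto simp: carrier_B kappa_cls cls_smult lin_ext_smult weight_closed)

lemma kappa_pure: "j \<in> J \<Longrightarrow> t \<in> T \<Longrightarrow> \<kappa> j (pure t) = weight j t"
  by (simp add: pure_cls kappa_cls free_gen_closed lin_ext_gen weight_closed)

lemma kappa_zero [simp]: "j \<in> J \<Longrightarrow> \<kappa> j \<zero>\<^bsub>B\<^esub> = \<zero>"
  by (simp add: cls_zero[symmetric] kappa_cls)

lemma kappa_minus: "j \<in> J \<Longrightarrow> X \<in> carrier B \<Longrightarrow> \<kappa> j (\<ominus>\<^bsub>B\<^esub> X) = \<ominus> \<kappa> j X"
  using kappa_add[of j X "\<ominus>\<^bsub>B\<^esub> X"]
  by (metis B.a_inv_closed B.r_neg kappa_closed kappa_zero R.add.m_comm R.minus_equality)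

lemma kappa_finsum:
  assumes "j \<in> J" "finite K" "x \<in> K \<rightarrow> carrier B"
  shows "\<kappa> j (\<Oplus>\<^bsub>B\<^esub>k\<in>K. x k) = (\<Oplus>k\<in>K. \<kappa> j (x k))"
  using assms(2,3)
proof (induction K)
  case (insert k K)
  have c: "(\<lambda>k. \<kappa> j (x k)) \<in> K \<rightarrow> carrier R" "x k \<in> carrier B" "x \<in> K \<rightarrow> carrier B"
    using insert.prems assms(1) by (auto simp: Pi_iff)
  then show ?case
    using insert assms(1) by (simp add: B.finsum_insert R.finsum_insert kappa_add B.finsum_closed)
qed (simp add: assms(1) B.finsum_empty R.finsum_empty)

lemma weight_theta:
  assumes j: "j \<in> J" and f: "f \<in> J"
  shows "weight j (\<lambda>i\<in>{1..n}. \<theta> (f i)) = (if j = f then \<one> else \<zero>)"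
proof -
  have ji: "j i \<in> {1..n}" "f i \<in> {1..n}" if "i \<in> {1..n}" for i
    using J_mem[OF j that] J_mem[OF f that] .
  have eq: "weight j (\<lambda>i\<in>{1..n}. \<theta> (f i)) = (\<Otimes>i\<in>{1..n}. if j i = f i then \<one> else \<zero>)"
    unfolding weight_def using ji by (intro R.finprod_cong') (auto simp: coords_theta)
  show ?thesis
  proof (cases "j = f")
    case True
    then show ?thesis unfolding eq by simp
  next
    case False
    then obtain i where i: "i \<in> {1..n}" "j i \<noteq> f i"
      using PiE_ext[OF j f] by blast
    have e: "{1..n} = insert i ({1..n} - {i})" using i by auto
    have "(\<Otimes>i\<in>{1..n}. if j i = f i then \<one> else \<zero>) = \<zero>"
      using i by (subst e, subst R.finprod_insert) auto
    then show ?thesis unfolding eq using False by simp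
  qed
qed

lemma kappa_E: "j \<in> J \<Longrightarrow> f \<in> J \<Longrightarrow> \<kappa> j (E f) = (if j = f then \<one> else \<zero>)"
  using theta_tuple by (simp add: E_pure kappa_pure weight_theta del: restrict_apply)

lemma cls_expand:
  assumes "f \<in> carrier F"
  shows "cls f = (\<Oplus>\<^bsub>B\<^esub>j\<in>J. lin_ext (weight j) f \<odot>\<^bsub>B\<^esub> E j)"
  using assms
proof (induction rule: F_induct)
  case (gen r t)
  have wc: "weight j t \<in> carrier R" if "j \<in> J" for j
    using funcset_mem[OF weight_closed[OF that] gen(2)] .
  have "cls (r \<odot>\<^bsub>F\<^esub> free_gen R t) = r \<odot>\<^bsub>B\<^esub> pure t"
    using gen by (simp add: cls_smult free_gen_closed pure_cls)
  also have "\<dots> = (\<Oplus>\<^bsub>B\<^esub>j\<in>J. r \<odot>\<^bsub>B\<^esub> (weight j t \<odot>\<^bsub>B\<^esub> E j))"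
    unfolding pure_expand[OF gen(2)] using gen(1) wc by (intro B.finsum_smult_ldistr) auto
  also have "\<dots> = (\<Oplus>\<^bsub>B\<^esub>j\<in>J. lin_ext (weight j) (r \<odot>\<^bsub>F\<^esub> free_gen R t) \<odot>\<^bsub>B\<^esub> E j)"
    using gen wc
    by (intro B.finsum_cong')
      (auto simp: lin_ext_smult free_gen_closed lin_ext_gen weight_closed B.smult_assoc1)
  finally show ?case .
next
  case (add f g)
  have c: "lin_ext (weight j) f \<in> carrier R" "lin_ext (weight j) g \<in> carrier R" if "j \<in> J" for j
    using add that by (auto intro!: lin_ext_closed weight_closed)
  have "cls (f \<oplus>\<^bsub>F\<^esub> g) = cls f \<oplus>\<^bsub>B\<^esub> cls g"
    by (rule cls_add[OF add(1,2), symmetric])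
  also have "\<dots> = (\<Oplus>\<^bsub>B\<^esub>j\<in>J. lin_ext (weight j) f \<odot>\<^bsub>B\<^esub> E j \<oplus>\<^bsub>B\<^esub> lin_ext (weight j) g \<odot>\<^bsub>B\<^esub> E j)"
    unfolding add.IH using c by (intro B.finsum_addf[symmetric]) auto
  also have "\<dots> = (\<Oplus>\<^bsub>B\<^esub>j\<in>J. lin_ext (weight j) (f \<oplus>\<^bsub>F\<^esub> g) \<odot>\<^bsub>B\<^esub> E j)"
    using c add by (intro B.finsum_cong') (auto simp: lin_ext_add weight_closed B.smult_l_distr)
  finally show ?case .
qed

lemma B_expand: "X \<in> carrier B \<Longrightarrow> X = (\<Oplus>\<^bsub>B\<^esub>j\<in>J. \<kappa> j X \<odot>\<^bsub>B\<^esub> E j)"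
proof -
  assume "X \<in> carrier B"
  then obtain f where f: "f \<in> carrier F" "X = cls f" by (auto simp: carrier_B)
  have "(\<Oplus>\<^bsub>B\<^esub>j\<in>J. \<kappa> j (cls f) \<odot>\<^bsub>B\<^esub> E j) = (\<Oplus>\<^bsub>B\<^esub>j\<in>J. lin_ext (weight j) f \<odot>\<^bsub>B\<^esub> E j)"
    using f(1) by (intro B.finsum_cong') (auto simp: kappa_cls lin_ext_closed weight_closed)
  then show ?thesis
    unfolding f(2) using cls_expand[OF f(1)] by simp
qed

lemma B_ext:
  assumes "X \<in> carrier B" "Y \<in> carrier B" "\<And>j. j \<in> J \<Longrightarrow> \<kappa> j X = \<kappa> j Y"
  shows "X = Y"
proof -
  have "X = (\<Oplus>\<^bsub>B\<^esub>j\<in>J. \<kappa> j X \<odot>\<^bsub>B\<^esub> E j)"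
    using assms(1) by (rule B_expand)
  also have "\<dots> = (\<Oplus>\<^bsub>B\<^esub>j\<in>J. \<kappa> j Y \<odot>\<^bsub>B\<^esub> E j)"
    using assms by (intro B.finsum_cong') auto
  also have "\<dots> = Y"
    using B_expand[OF assms(2)] by simp
  finally show ?thesis .
qed

text \<open>Since \<open>B_ext\<close> identifies the tensor ideal with the null vectors, a coset consists of all elements
  with given coordinates. This makes the elementwise action of a permutation on a coset
  computable.\<close>

lemma mem_cls_coords:
  assumes f: "f \<in> carrier F"
  shows "g \<in> cls f \<longleftrightarrow> g \<in> carrier F \<and> (\<forall>j\<in>J. lin_ext (weight j) g = lin_ext (weight j) f)"
proof (cases "g \<in> carrier F")
  case True
  have "g \<in> cls f \<longleftrightarrow> cls g = cls f"
    using True f by (simp add: mem_cls_iff cls_eq_iff)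
  also have "\<dots> \<longleftrightarrow> (\<forall>j\<in>J. \<kappa> j (cls g) = \<kappa> j (cls f))"
    using B_ext[of "cls g" "cls f"] True f by auto
  finally show ?thesis using True f by (simp add: kappa_cls)
qed (use f in \<open>simp add: mem_cls_iff\<close>)

section \<open>The action of permutations\<close>

abbreviation perm_F :: "(nat \<Rightarrow> nat) \<Rightarrow> ((nat \<Rightarrow> 'b) \<Rightarrow> 'a) \<Rightarrow> (nat \<Rightarrow> 'b) \<Rightarrow> 'a"
  where "perm_F \<sigma> f \<equiv> \<lambda>t. f (t \<circ> \<sigma>)"

lemma J_comp: "\<sigma> permutes {1..n} \<Longrightarrow> j \<in> J \<Longrightarrow> j \<circ> \<sigma> \<in> J"
  by (rule PiE_comp_permutes)

lemma T_comp: "\<sigma> permutes {1..n} \<Longrightarrow> t \<in> T \<Longrightarrow> t \<circ> \<sigma> \<in> T"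
  unfolding tuples_def by (rule PiE_comp_permutes)

lemma supp_perm_F:
  assumes "\<sigma> permutes {1..n}"
  shows "supp (perm_F \<sigma> f) = (\<lambda>t. t \<circ> inv' \<sigma>) ` supp f"
proof (intro equalityI subsetI)
  fix t assume "t \<in> supp (perm_F \<sigma> f)"
  then show "t \<in> (\<lambda>t. t \<circ> inv' \<sigma>) ` supp f"
    by (intro image_eqI[of _ _ "t \<circ> \<sigma>"]) (auto simp: comp_inv_permutes[OF assms])
qed (auto simp: comp_inv_permutes[OF assms])

lemma perm_F_closed:
  assumes \<sigma>: "\<sigma> permutes {1..n}" and f: "f \<in> carrier F"
  shows "perm_F \<sigma> f \<in> carrier F"
  using f T_comp[OF permutes_inv[OF \<sigma>]] unfolding carrier_F supp_perm_F[OF \<sigma>] by auto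

text \<open>Permuting tuples can be shifted from the argument to the weight.\<close>

lemma lin_ext_perm_F:
  assumes \<sigma>: "\<sigma> permutes {1..n}" and f: "f \<in> carrier F" and w: "w \<in> T \<rightarrow> carrier R"
  shows "lin_ext w (perm_F \<sigma> f) = lin_ext (\<lambda>t. w (t \<circ> inv' \<sigma>)) f"
proof -
  have inj: "inj_on (\<lambda>t. t \<circ> inv' \<sigma>) (supp f)"
    by (rule inj_on_inverseI[of _ "\<lambda>t. t \<circ> \<sigma>"]) (rule comp_inv_permutes[OF \<sigma>])
  have fc: "f t \<in> carrier R" for t using f by (auto simp: carrier_F)
  have wc: "w (t \<circ> inv' \<sigma>) \<in> carrier R" if "t \<in> supp f" for t
    using f that by (intro funcset_mem[OF w] T_comp permutes_inv[OF \<sigma>]) (auto simp: carrier_F)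
  have "lin_ext w (perm_F \<sigma> f) = (\<Oplus>t\<in>(\<lambda>t. t \<circ> inv' \<sigma>) ` supp f. f (t \<circ> \<sigma>) \<otimes> w t)"
    unfolding lin_ext_def supp_perm_F[OF \<sigma>] ..
  also have "\<dots> = (\<Oplus>t\<in>supp f. f (t \<circ> inv' \<sigma> \<circ> \<sigma>) \<otimes> w (t \<circ> inv' \<sigma>))"
    using inj fc wc by (intro R.finsum_reindex) auto
  also have "\<dots> = lin_ext (\<lambda>t. w (t \<circ> inv' \<sigma>)) f"
    unfolding lin_ext_def comp_inv_permutes[OF \<sigma>] ..
  finally show ?thesis .
qed

lemma tuple_mult_comp:
  assumes \<sigma>: "\<sigma> permutes {1..n}"
  shows "tuple_mult A n u v \<circ> \<sigma> = tuple_mult A n (u \<circ> \<sigma>) (v \<circ> \<sigma>)"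
proof
  fix i
  show "(tuple_mult A n u v \<circ> \<sigma>) i = tuple_mult A n (u \<circ> \<sigma>) (v \<circ> \<sigma>) i"
    using permutes_in_image[OF \<sigma>, of i] by (simp only: tuple_mult_def comp_apply restrict_def)
qed

lemma perm_F_mult:
  assumes \<sigma>: "\<sigma> permutes {1..n}" and f: "f \<in> carrier F" and g: "g \<in> carrier F"
  shows "perm_F \<sigma> (f \<otimes>\<^bsub>F\<^esub> g) = perm_F \<sigma> f \<otimes>\<^bsub>F\<^esub> perm_F \<sigma> g"
proof (rule F_ext)
  note i = permutes_inv[OF \<sigma>]
  fix w assume w: "w \<in> T \<rightarrow> carrier R"
  have wc: "w (tuple_mult A n u v) \<in> carrier R" if "u \<in> T" "v \<in> T" for u v
    using that by (intro funcset_mem[OF w] tuple_mult_closed)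
  have w1: "(\<lambda>t. w (t \<circ> inv' \<sigma>)) \<in> T \<rightarrow> carrier R"
    using funcset_mem[OF w T_comp[OF i]] by blast
  have w2: "(\<lambda>u. lin_ext (\<lambda>v. w (tuple_mult A n u v)) (perm_F \<sigma> g)) \<in> T \<rightarrow> carrier R"
    using wc by (intro Pi_I lin_ext_closed perm_F_closed[OF \<sigma> g]) auto
  have "lin_ext w (perm_F \<sigma> f \<otimes>\<^bsub>F\<^esub> perm_F \<sigma> g)
      = lin_ext (\<lambda>u. lin_ext (\<lambda>v. w (tuple_mult A n (u \<circ> inv' \<sigma>) v)) (perm_F \<sigma> g)) f"
    using lin_ext_mult[OF perm_F_closed[OF \<sigma> f] perm_F_closed[OF \<sigma> g] w]
      lin_ext_perm_F[OF \<sigma> f w2] by simp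
  also have "\<dots> = lin_ext (\<lambda>u. lin_ext (\<lambda>v. w (tuple_mult A n u v \<circ> inv' \<sigma>)) g) f"
  proof (rule lin_ext_cong[OF f])
    show "(\<lambda>u. lin_ext (\<lambda>v. w (tuple_mult A n (u \<circ> inv' \<sigma>) v)) (perm_F \<sigma> g)) \<in> T \<rightarrow> carrier R"
      using funcset_mem[OF w2 T_comp[OF i]] by blast
    fix u assume u: "u \<in> T"
    have "(\<lambda>v. w (tuple_mult A n (u \<circ> inv' \<sigma>) v)) \<in> T \<rightarrow> carrier R"
      using wc[OF T_comp[OF i u]] by blast
    then show "lin_ext (\<lambda>v. w (tuple_mult A n (u \<circ> inv' \<sigma>) v)) (perm_F \<sigma> g)
        = lin_ext (\<lambda>v. w (tuple_mult A n u v \<circ> inv' \<sigma>)) g"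
      using lin_ext_perm_F[OF \<sigma> g, of "\<lambda>v. w (tuple_mult A n (u \<circ> inv' \<sigma>) v)"]
      by (simp add: tuple_mult_comp[OF i])
  qed
  also have "\<dots> = lin_ext w (perm_F \<sigma> (f \<otimes>\<^bsub>F\<^esub> g))"
    using lin_ext_mult[OF f g w1] lin_ext_perm_F[OF \<sigma> F.m_closed[OF f g] w] by simp
  finally show "lin_ext w (perm_F \<sigma> (f \<otimes>\<^bsub>F\<^esub> g)) = lin_ext w (perm_F \<sigma> f \<otimes>\<^bsub>F\<^esub> perm_F \<sigma> g)"
    by simp
qed (use assms in \<open>auto intro!: perm_F_closed F.m_closed\<close>)

lemma weight_perm:
  assumes \<sigma>: "\<sigma> permutes {1..n}" and j: "j \<in> J" and t: "t \<in> T"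
  shows "weight j (t \<circ> inv' \<sigma>) = weight (j \<circ> \<sigma>) t"
proof -
  have im: "{1..n} = \<sigma> ` {1..n}"
    using permutes_image[OF \<sigma>] by simp
  have c: "crd ((t \<circ> inv' \<sigma>) i) (j i) \<in> carrier R" if "i \<in> {1..n}" for i
    using that by (intro coords_at j tuple_entry T_comp permutes_inv[OF \<sigma>] t)
  have "weight j (t \<circ> inv' \<sigma>) = (\<Otimes>i\<in>\<sigma> ` {1..n}. crd ((t \<circ> inv' \<sigma>) i) (j i))"
    unfolding weight_def using im by simp
  also have "\<dots> = (\<Otimes>i\<in>{1..n}. crd ((t \<circ> inv' \<sigma>) (\<sigma> i)) (j (\<sigma> i)))"
    using c im permutes_inj_on[OF \<sigma>] by (intro R.finprod_reindex) auto
  also have "\<dots> = weight (j \<circ> \<sigma>) t"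
    unfolding weight_def by (simp add: permutes_inverses[OF \<sigma>])
  finally show ?thesis .
qed

lemma coords_perm_F:
  assumes \<sigma>: "\<sigma> permutes {1..n}" and f: "f \<in> carrier F" and j: "j \<in> J"
  shows "lin_ext (weight j) (perm_F \<sigma> f) = lin_ext (weight (j \<circ> \<sigma>)) f"
proof -
  have "lin_ext (weight j) (perm_F \<sigma> f) = lin_ext (\<lambda>t. weight j (t \<circ> inv' \<sigma>)) f"
    using weight_closed[OF j] by (intro lin_ext_perm_F \<sigma> f)
  also have "\<dots> = lin_ext (weight (j \<circ> \<sigma>)) f"
    using funcset_mem[OF weight_closed[OF j] T_comp[OF permutes_inv[OF \<sigma>]]]
    by (intro lin_ext_cong f weight_perm \<sigma> j) blast
  finally show ?thesis .
qed

lemma perm_act_cls: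
  assumes \<sigma>: "\<sigma> permutes {1..n}" and f: "f \<in> carrier F"
  shows "perm_act \<sigma> (cls f) = cls (perm_F \<sigma> f)"
proof -
  have "g \<in> cls (perm_F \<sigma> f)" if g: "g \<in> perm_F \<sigma> ` cls f" for g
  proof -
    obtain h where h: "h \<in> carrier F" "\<And>j. j \<in> J \<Longrightarrow> lin_ext (weight j) h = lin_ext (weight j) f"
        "g = perm_F \<sigma> h"
      using g mem_cls_coords[OF f] by auto
    show ?thesis
      unfolding h(3) mem_cls_coords[OF perm_F_closed[OF \<sigma> f]]
      using h(1,2) f J_comp[OF \<sigma>] by (simp add: coords_perm_F[OF \<sigma>] perm_F_closed[OF \<sigma>])
  qed
  moreover have "g \<in> perm_F \<sigma> ` cls f" if g: "g \<in> cls (perm_F \<sigma> f)" for g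
  proof
    note i = permutes_inv[OF \<sigma>]
    let ?h = "perm_F (inv' \<sigma>) g"
    show "g = perm_F \<sigma> ?h"
      by (simp add: comp_inv_permutes[OF \<sigma>])
    have gc: "g \<in> carrier F" "\<And>j. j \<in> J \<Longrightarrow> lin_ext (weight j) g = lin_ext (weight (j \<circ> \<sigma>)) f"
      using g mem_cls_coords[OF perm_F_closed[OF \<sigma> f]] coords_perm_F[OF \<sigma> f] by auto
    show "?h \<in> cls f"
      unfolding mem_cls_coords[OF f]
      using gc J_comp[OF i] perm_F_closed[OF i]
      by (simp add: coords_perm_F[OF i] comp_inv_permutes[OF \<sigma>])
  qed
  ultimately show ?thesis
    unfolding perm_act_def by blast
qed

lemma act_closed: "\<sigma> permutes {1..n} \<Longrightarrow> X \<in> carrier B \<Longrightarrow> perm_act \<sigma> X \<in> carrier B"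
  by (auto simp: carrier_B perm_act_cls intro!: imageI perm_F_closed)

lemma kappa_act:
  "\<sigma> permutes {1..n} \<Longrightarrow> X \<in> carrier B \<Longrightarrow> j \<in> J \<Longrightarrow> \<kappa> j (perm_act \<sigma> X) = \<kappa> (j \<circ> \<sigma>) X"
  by (auto simp: carrier_B perm_act_cls kappa_cls perm_F_closed coords_perm_F J_comp)

lemma act_mult:
  "\<sigma> permutes {1..n} \<Longrightarrow> X \<in> carrier B \<Longrightarrow> Y \<in> carrier B \<Longrightarrow>
    perm_act \<sigma> (X \<otimes>\<^bsub>B\<^esub> Y) = perm_act \<sigma> X \<otimes>\<^bsub>B\<^esub> perm_act \<sigma> Y"
  by (auto simp: carrier_B perm_act_cls cls_mult perm_F_closed perm_F_mult)

lemma act_add: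
  "\<sigma> permutes {1..n} \<Longrightarrow> X \<in> carrier B \<Longrightarrow> Y \<in> carrier B \<Longrightarrow>
    perm_act \<sigma> (X \<oplus>\<^bsub>B\<^esub> Y) = perm_act \<sigma> X \<oplus>\<^bsub>B\<^esub> perm_act \<sigma> Y"
  by (intro B_ext) (auto simp: act_closed kappa_act kappa_add J_comp)

lemma act_smult:
  "\<sigma> permutes {1..n} \<Longrightarrow> X \<in> carrier B \<Longrightarrow> r \<in> carrier R \<Longrightarrow>
    perm_act \<sigma> (r \<odot>\<^bsub>B\<^esub> X) = r \<odot>\<^bsub>B\<^esub> perm_act \<sigma> X"
  by (intro B_ext) (auto simp: act_closed kappa_act kappa_smult J_comp)

lemma act_minus:
  "\<sigma> permutes {1..n} \<Longrightarrow> X \<in> carrier B \<Longrightarrow> perm_act \<sigma> (\<ominus>\<^bsub>B\<^esub> X) = \<ominus>\<^bsub>B\<^esub> perm_act \<sigma> X"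
  by (intro B_ext) (auto simp: act_closed kappa_act kappa_minus J_comp)

lemma act_comp:
  assumes "\<sigma> permutes {1..n}" "\<tau> permutes {1..n}" "X \<in> carrier B"
  shows "perm_act \<sigma> (perm_act \<tau> X) = perm_act (\<sigma> \<circ> \<tau>) X"
  using assms permutes_compose[OF assms(2,1)]
  by (intro B_ext) (auto simp: act_closed kappa_act J_comp comp_assoc)

lemma act_pure:
  assumes \<sigma>: "\<sigma> permutes {1..n}" and t: "t \<in> T"
  shows "perm_act \<sigma> (pure t) = pure (t \<circ> inv' \<sigma>)"
  using T_comp[OF permutes_inv[OF \<sigma>] t] assms
  by (intro B_ext) (auto simp: act_closed kappa_act kappa_pure weight_perm J_comp)

end

section \<open>Tensors acting on the alternating element\<close>

locale two_regular_algebra = based_algebra R A n \<theta>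
  for R :: "('a, 'm) ring_scheme" (structure) and A :: "('a, 'b, 'k) module_scheme" (structure)
    and n :: nat and \<theta> :: "nat \<Rightarrow> 'b" +
  assumes two_regular: "non_zero_divisor R (two R)"
begin

abbreviation P :: "(nat \<Rightarrow> nat) set" where "P \<equiv> {p. p permutes {1..n}}"
abbreviation rs :: "(nat \<Rightarrow> nat) \<Rightarrow> nat \<Rightarrow> nat" where "rs p \<equiv> restrict p {1..n}"
abbreviation \<delta> where "\<delta> \<equiv> alt_element R A n \<theta>"

lemma finite_P [simp]: "finite P"
  by (simp add: finite_permutations)

lemma rs_J: "p permutes {1..n} \<Longrightarrow> rs p \<in> J"
  by (rule restrict_permutes_PiE)

lemma delta_expand: "\<delta> = (\<Oplus>\<^bsub>B\<^esub>p\<in>P. [sign p] \<cdot>\<^bsub>B\<^esub> E (rs p))"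
proof -
  have pin: "p i \<in> {1..n}" if "p permutes {1..n}" "i \<in> {1..n}" for p i
    using that by (simp only: permutes_in_image)
  have "(\<Otimes>\<^bsub>B\<^esub>i\<in>{1..n}. \<iota> i (\<theta> (p i))) = E (rs p)" if "p permutes {1..n}" for p
    unfolding E_def using pin[OF that] by (intro B.finprod_cong') (auto simp del: atLeastAtMost_iff)
  then show ?thesis
    unfolding alt_element_def rdet_def using rs_J
    by (intro B.finsum_cong') (auto simp del: restrict_apply)
qed

lemma delta_closed [simp]: "\<delta> \<in> carrier B"
  unfolding delta_expand using rs_J by (auto intro!: B.finsum_closed)

lemma kappa_sign:
  "j \<in> J \<Longrightarrow> X \<in> carrier B \<Longrightarrow> \<kappa> j ([sign p] \<cdot>\<^bsub>B\<^esub> X) = [sign p] \<cdot> \<kappa> j X"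
  by (simp add: B.sign_act R.sign_act kappa_minus)

lemma kappa_delta:
  assumes j: "j \<in> J"
  shows "\<kappa> j \<delta> = (\<Oplus>p\<in>P. if j = rs p then [sign p] \<cdot> \<one> else \<zero>)"
proof -
  have "\<kappa> j \<delta> = (\<Oplus>p\<in>P. \<kappa> j ([sign p] \<cdot>\<^bsub>B\<^esub> E (rs p)))"
    unfolding delta_expand using j rs_J by (intro kappa_finsum) auto
  also have "\<dots> = (\<Oplus>p\<in>P. if j = rs p then [sign p] \<cdot> \<one> else \<zero>)"
  proof (rule R.finsum_cong')
    fix p assume "p \<in> P"
    then have p: "rs p \<in> J" using rs_J by simp
    show "\<kappa> j ([sign p] \<cdot>\<^bsub>B\<^esub> E (rs p)) = (if j = rs p then [sign p] \<cdot> \<one> else \<zero>)"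
      unfolding kappa_sign[OF j E_closed[OF p]] kappa_E[OF j p] by (simp add: R.sign_act)
  qed auto
  finally show ?thesis .
qed

lemma kappa_delta_perm:
  assumes q: "q permutes {1..n}"
  shows "\<kappa> (rs q) \<delta> = [sign q] \<cdot> \<one>"
proof -
  have eq: "rs q = rs p \<longleftrightarrow> q = p" if "p \<in> P" for p
    using inj_on_eq_iff[OF restrict_permutes_inj _ that, of q] q by simp
  have "\<kappa> (rs q) \<delta> = (\<Oplus>p\<in>P. if rs q = rs p then [sign p] \<cdot> \<one> else \<zero>)"
    by (rule kappa_delta[OF rs_J[OF q]])
  also have "\<dots> = (\<Oplus>p\<in>P. if q = p then [sign p] \<cdot> \<one> else \<zero>)"
    by (intro R.finsum_cong') (auto simp only: eq, auto)
  also have "\<dots> = [sign q] \<cdot> \<one>"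
    using q by (intro R.add.finprod_singleton[folded finsum_def]) auto
  finally show ?thesis .
qed

lemma kappa_delta_other: "j \<in> J \<Longrightarrow> j \<notin> rs ` P \<Longrightarrow> \<kappa> j \<delta> = \<zero>"
  unfolding kappa_delta by (intro R.add.finprod_one_eqI[folded finsum_def]) auto

abbreviation j0 where "j0 \<equiv> rs id"

lemma j0_J [simp]: "j0 \<in> J"
  by (rule rs_J[OF permutes_id])

lemma kappa_j0_delta: "\<kappa> j0 \<delta> = \<one>"
  using kappa_delta_perm[OF permutes_id] by (simp add: R.sign_act evenperm_id)

definition symmetric_tensor where
  "symmetric_tensor X \<longleftrightarrow> X \<in> carrier B \<and> (\<forall>\<sigma>\<in>P. perm_act \<sigma> X = X)"

definition antisymmetric_tensor where
  "antisymmetric_tensor X \<longleftrightarrow> X \<in> carrier B \<and> (\<forall>\<sigma>\<in>P. perm_act \<sigma> X = [sign \<sigma>] \<cdot>\<^bsub>B\<^esub> X)"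

lemma antisymmetric_coords:
  "antisymmetric_tensor X \<longleftrightarrow>
    X \<in> carrier B \<and> (\<forall>\<sigma>\<in>P. \<forall>j\<in>J. \<kappa> (j \<circ> \<sigma>) X = [sign \<sigma>] \<cdot> \<kappa> j X)"
proof (cases "X \<in> carrier B")
  case True
  have "perm_act \<sigma> X = [sign \<sigma>] \<cdot>\<^bsub>B\<^esub> X \<longleftrightarrow>
      (\<forall>j\<in>J. \<kappa> (j \<circ> \<sigma>) X = [sign \<sigma>] \<cdot> \<kappa> j X)" if "\<sigma> \<in> P" for \<sigma>
    using that True B_ext[of "perm_act \<sigma> X" "[sign \<sigma>] \<cdot>\<^bsub>B\<^esub> X"] act_closed[of \<sigma> X]
      kappa_act[of \<sigma> X] kappa_sign[of _ X \<sigma>]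
    by auto
  then show ?thesis
    by (auto simp: antisymmetric_tensor_def True)
qed (simp add: antisymmetric_tensor_def)

lemma antisymmetric_delta: "antisymmetric_tensor \<delta>"
  unfolding antisymmetric_coords
proof (intro conjI ballI)
  fix \<sigma> j assume \<sigma>: "\<sigma> \<in> P" and j: "j \<in> J"
  then have s: "\<sigma> permutes {1..n}" by simp
  show "\<kappa> (j \<circ> \<sigma>) \<delta> = [sign \<sigma>] \<cdot> \<kappa> j \<delta>"
  proof (cases "j \<in> rs ` P")
    case True
    then obtain p where p: "p permutes {1..n}" "j = rs p" by auto
    have "\<kappa> (j \<circ> \<sigma>) \<delta> = \<kappa> (rs (p \<circ> \<sigma>)) \<delta>"
      unfolding p(2) restrict_comp_permutes[OF s] ..
    also have "\<dots> = [sign (p \<circ> \<sigma>)] \<cdot> \<one>"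
      by (rule kappa_delta_perm[OF permutes_compose[OF s p(1)]])
    also have "\<dots> = [sign \<sigma>] \<cdot> \<kappa> j \<delta>"
      unfolding p(2) kappa_delta_perm[OF p(1)] by (rule R.sign_act_twice[OF _ _ p(1) s]) auto
    finally show ?thesis .
  next
    case False
    have "j \<circ> \<sigma> \<notin> rs ` P"
    proof
      assume "j \<circ> \<sigma> \<in> rs ` P"
      then obtain p where p: "p permutes {1..n}" "j \<circ> \<sigma> = rs p" by auto
      have "j = rs p \<circ> inv' \<sigma>"
        unfolding p(2)[symmetric] comp_inv_permutes[OF s] ..
      also have "\<dots> = rs (p \<circ> inv' \<sigma>)"
        by (rule restrict_comp_permutes[OF permutes_inv[OF s]])
      finally show False
        using False permutes_compose[OF permutes_inv[OF s] p(1)] by blast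
    qed
    then show ?thesis
      using False j J_comp[OF s j] by (simp add: kappa_delta_other R.sign_act)
  qed
qed simp

text \<open>An antisymmetric tensor has coordinates \<open>sign p\<close> times the one at the identity at the permutations
  \<open>p\<close>. At any other self-map, which is fixed by a transposition, the coordinate equals its own
  negative and vanishes because \<open>2\<close> is a non-zero-divisor. The alternating element has the same
  shape, with coordinate \<open>1\<close> at the identity.\<close>

lemma antisymmetric_multiple_delta:
  assumes X: "antisymmetric_tensor X"
  shows "X = \<kappa> j0 X \<odot>\<^bsub>B\<^esub> \<delta>"
proof -
  have XB: "X \<in> carrier B" and Xs: "\<And>\<sigma> j. \<sigma> permutes {1..n} \<Longrightarrow> j \<in> J \<Longrightarrow>
      \<kappa> (j \<circ> \<sigma>) X = [sign \<sigma>] \<cdot> \<kappa> j X"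
    using X by (auto simp: antisymmetric_coords)
  have k0: "\<kappa> j0 X \<in> carrier R" by (rule kappa_closed[OF j0_J XB])
  show ?thesis
  proof (rule B_ext[OF XB])
    show "\<kappa> j0 X \<odot>\<^bsub>B\<^esub> \<delta> \<in> carrier B" using k0 by simp
    fix j assume j: "j \<in> J"
    have rhs: "\<kappa> j (\<kappa> j0 X \<odot>\<^bsub>B\<^esub> \<delta>) = \<kappa> j0 X \<otimes> \<kappa> j \<delta>"
      by (rule kappa_smult[OF j delta_closed k0])
    from finite_atLeastAtMost j show "\<kappa> j X = \<kappa> j (\<kappa> j0 X \<odot>\<^bsub>B\<^esub> \<delta>)"
    proof (cases rule: self_map_cases)
      case (perm p)
      have "\<kappa> j X = \<kappa> (j0 \<circ> p) X"
        unfolding perm(2) restrict_comp_permutes[OF perm(1)] by simp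
      also have "\<dots> = [sign p] \<cdot> \<kappa> j0 X"
        by (rule Xs[OF perm(1) j0_J])
      finally show ?thesis
        unfolding rhs unfolding perm(2) kappa_delta_perm[OF perm(1)] using k0
        by (simp add: R.sign_act R.r_minus del: restrict_apply)
    next
      case (collision i k)
      have "\<kappa> j X = [sign (transpose i k)] \<cdot> \<kappa> j X"
        using Xs[OF permutes_swap_id[OF collision(1,2)] j] collision(4) by simp
      also have "\<dots> = \<ominus> \<kappa> j X"
        using collision(3) j XB by (simp add: R.sign_act evenperm_swap)
      finally have "\<kappa> j X = \<zero>"
        by (rule R.two_cancel[OF two_regular kappa_closed[OF j XB]])
      moreover have "j \<notin> rs ` P"
        using self_map_collision_not_perm[OF _ collision(1-3)] collision(4) by blast
      ultimately show ?thesis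
        unfolding rhs using kappa_delta_other[OF j] k0 by simp
    qed
  qed
qed

lemma symmetric_times_antisymmetric:
  "symmetric_tensor z \<Longrightarrow> antisymmetric_tensor X \<Longrightarrow> antisymmetric_tensor (z \<otimes>\<^bsub>B\<^esub> X)"
  by (auto simp: symmetric_tensor_def antisymmetric_tensor_def act_mult B.sign_act B.r_minus)

text \<open>If \<open>z\<close> acts on \<open>\<delta>\<close> by a scalar, that scalar is \<open>\<Phi> z\<close>, because \<open>\<delta>\<close> has coordinate \<open>1\<close> at the
  identity. Every symmetric tensor acts by a scalar (\<open>symmetric_acts\<close>), and scalars multiply and add
  like the tensors, so \<open>\<Phi>\<close> is a homomorphism on symmetric tensors. It is the canonical
  homomorphism characterised by \<open>e\<^sub>k(a) \<mapsto> s\<^sub>k(a)\<close>.\<close>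

definition \<Phi> where "\<Phi> z = \<kappa> j0 (z \<otimes>\<^bsub>B\<^esub> \<delta>)"

definition acts_by where
  "acts_by z r \<longleftrightarrow> z \<in> carrier B \<and> r \<in> carrier R \<and> z \<otimes>\<^bsub>B\<^esub> \<delta> = r \<odot>\<^bsub>B\<^esub> \<delta>"

lemma Phi_closed [simp]: "z \<in> carrier B \<Longrightarrow> \<Phi> z \<in> carrier R"
  by (simp only: \<Phi>_def kappa_closed[OF j0_J] B.m_closed delta_closed)

lemma symmetric_acts: "symmetric_tensor z \<Longrightarrow> acts_by z (\<Phi> z)"
  using antisymmetric_multiple_delta[OF symmetric_times_antisymmetric[OF _ antisymmetric_delta], of z]
  by (auto simp: acts_by_def \<Phi>_def symmetric_tensor_def simp del: restrict_apply)

lemma acts_unique: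
  assumes "acts_by z r"
  shows "\<Phi> z = r"
proof -
  have "\<Phi> z = \<kappa> j0 (r \<odot>\<^bsub>B\<^esub> \<delta>)"
    using assms by (simp only: \<Phi>_def acts_by_def)
  also have "\<dots> = r"
    using assms kappa_smult[OF j0_J delta_closed] kappa_j0_delta by (simp only: acts_by_def R.r_one)
  finally show ?thesis .
qed

lemma acts_add: "acts_by x r \<Longrightarrow> acts_by y s \<Longrightarrow> acts_by (x \<oplus>\<^bsub>B\<^esub> y) (r \<oplus> s)"
  by (simp add: acts_by_def B.l_distr B.smult_l_distr)

lemma acts_mult: "acts_by x r \<Longrightarrow> acts_by y s \<Longrightarrow> acts_by (x \<otimes>\<^bsub>B\<^esub> y) (r \<otimes> s)"
proof -
  assume x: "acts_by x r" and y: "acts_by y s"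
  then have c: "x \<in> carrier B" "y \<in> carrier B" "r \<in> carrier R" "s \<in> carrier R"
    by (auto simp: acts_by_def)
  have "x \<otimes>\<^bsub>B\<^esub> y \<otimes>\<^bsub>B\<^esub> \<delta> = x \<otimes>\<^bsub>B\<^esub> (s \<odot>\<^bsub>B\<^esub> \<delta>)"
    using y c by (simp add: B.m_assoc acts_by_def)
  also have "\<dots> = s \<odot>\<^bsub>B\<^esub> (x \<otimes>\<^bsub>B\<^esub> \<delta>)"
    using c B.m_comm[of x "s \<odot>\<^bsub>B\<^esub> \<delta>"] B.m_comm[of x \<delta>] by (simp add: B.smult_assoc2)
  also have "\<dots> = (r \<otimes> s) \<odot>\<^bsub>B\<^esub> \<delta>"
    using x c by (simp add: acts_by_def B.smult_assoc1[symmetric] R.m_comm)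
  finally show ?thesis using c by (simp add: acts_by_def)
qed

lemma acts_smult: "acts_by x r \<Longrightarrow> c \<in> carrier R \<Longrightarrow> acts_by (c \<odot>\<^bsub>B\<^esub> x) (c \<otimes> r)"
  by (simp add: acts_by_def B.smult_assoc2 B.smult_assoc1)

lemma acts_minus: "acts_by x r \<Longrightarrow> acts_by (\<ominus>\<^bsub>B\<^esub> x) (\<ominus> r)"
  by (simp add: acts_by_def B.l_minus B.smult_l_minus)

lemma acts_zero: "acts_by \<zero>\<^bsub>B\<^esub> \<zero>" and acts_one: "acts_by \<one>\<^bsub>B\<^esub> \<one>"
  by (simp_all add: acts_by_def)

lemma acts_sign: "acts_by x r \<Longrightarrow> acts_by ([sign p] \<cdot>\<^bsub>B\<^esub> x) ([sign p] \<cdot> r)"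
  using acts_minus[of x r] by (simp add: B.sign_act R.sign_act acts_by_def)

lemma acts_closed: "acts_by x r \<Longrightarrow> x \<in> carrier B" "acts_by x r \<Longrightarrow> r \<in> carrier R"
  by (simp_all add: acts_by_def)

lemma acts_finsum:
  assumes "finite K" "\<And>k. k \<in> K \<Longrightarrow> acts_by (x k) (r k)"
  shows "acts_by (\<Oplus>\<^bsub>B\<^esub>k\<in>K. x k) (\<Oplus>k\<in>K. r k)"
  using assms
proof (induction K)
  case empty
  show ?case using acts_zero by (simp add: B.finsum_empty R.finsum_empty)
next
  case (insert k K)
  have c: "x \<in> K \<rightarrow> carrier B" "x k \<in> carrier B" "r \<in> K \<rightarrow> carrier R" "r k \<in> carrier R"
    using insert.prems unfolding acts_by_def by auto
  show ?case
    using insert c by (simp add: B.finsum_insert R.finsum_insert acts_add)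
qed

lemma acts_finprod:
  assumes "finite K" "\<And>k. k \<in> K \<Longrightarrow> acts_by (x k) (r k)"
  shows "acts_by (\<Otimes>\<^bsub>B\<^esub>k\<in>K. x k) (\<Otimes>k\<in>K. r k)"
  using assms
proof (induction K)
  case empty
  show ?case using acts_one by simp
next
  case (insert k K)
  have c: "x \<in> K \<rightarrow> carrier B" "x k \<in> carrier B" "r \<in> K \<rightarrow> carrier R" "r k \<in> carrier R"
    using insert.prems unfolding acts_by_def by auto
  show ?case
    using insert c by (simp add: acts_mult)
qed

lemma acts_rdet:
  assumes "\<And>i j. i \<in> {1..n} \<Longrightarrow> j \<in> {1..n} \<Longrightarrow> acts_by (M i j) (m i j)"
  shows "acts_by (rdet B n M) (rdet R n m)"
  unfolding rdet_def using assms
  by (intro acts_finsum acts_sign acts_finprod) (auto simp: permutes_in_image simp del: atLeastAtMost_iff)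

lemma two_regular_B: "non_zero_divisor B (two B)"
  unfolding non_zero_divisor_def
proof (intro conjI ballI impI)
  show "two B \<in> carrier B" by (simp add: two_def)
  fix X assume X: "X \<in> carrier B" "two B \<otimes>\<^bsub>B\<^esub> X = \<zero>\<^bsub>B\<^esub>"
  have "X \<oplus>\<^bsub>B\<^esub> X = \<zero>\<^bsub>B\<^esub>"
    using X by (simp add: two_def B.l_distr)
  then have "X = \<ominus>\<^bsub>B\<^esub> X"
    using X by (intro B.sum_zero_eq_neg) auto
  then have "\<kappa> j X = \<ominus> \<kappa> j X" if "j \<in> J" for j
    using kappa_minus[OF that X(1)] by simp
  then have "\<kappa> j X = \<zero>" if "j \<in> J" for j
    using R.two_cancel[OF two_regular kappa_closed[OF that X(1)]] that by blast
  then show "X = \<zero>\<^bsub>B\<^esub>"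
    using X by (intro B_ext) auto
qed

text \<open>The tuple whose pure tensor is the product of the \<open>a\<^sup>(\<^sup>i\<^sup>)\<close> for \<open>i \<in> S\<close>.\<close>

abbreviation place :: "nat set \<Rightarrow> 'b \<Rightarrow> nat \<Rightarrow> 'b"
  where "place S a \<equiv> (\<lambda>j\<in>{1..n}. if j \<in> S then a else \<one>\<^bsub>A\<^esub>)"

lemma place_T: "a \<in> carrier A \<Longrightarrow> place S a \<in> T"
  by (auto simp: tuples_def)

lemma prod_iota_place:
  assumes "S \<subseteq> {1..n}" "a \<in> carrier A"
  shows "(\<Otimes>\<^bsub>B\<^esub>i\<in>S. \<iota> i a) = pure (place S a)"
  using assms finite_subset[OF assms(1)] by (intro prod_iota_restrict) auto

lemma place_comp:
  assumes \<sigma>: "\<sigma> permutes {1..n}"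
  shows "place S a \<circ> inv' \<sigma> = place (\<sigma> ` S) a"
proof
  fix i
  have "inv' \<sigma> i \<in> S \<longleftrightarrow> i \<in> \<sigma> ` S"
    using permutes_inverses[OF \<sigma>] by (metis imageE imageI)
  then show "(place S a \<circ> inv' \<sigma>) i = place (\<sigma> ` S) a i"
    using permutes_in_image[OF permutes_inv[OF \<sigma>], of i]
    by (simp only: comp_apply restrict_def)
qed

lemma act_finsum:
  assumes "\<sigma> permutes {1..n}" "finite K" "x \<in> K \<rightarrow> carrier B"
  shows "perm_act \<sigma> (\<Oplus>\<^bsub>B\<^esub>k\<in>K. x k) = (\<Oplus>\<^bsub>B\<^esub>k\<in>K. perm_act \<sigma> (x k))"
  using assms(2,3)
proof (induction K)
  case empty
  have "perm_act \<sigma> (\<zero> \<odot>\<^bsub>B\<^esub> \<one>\<^bsub>B\<^esub>) = \<zero> \<odot>\<^bsub>B\<^esub> perm_act \<sigma> \<one>\<^bsub>B\<^esub>"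
    by (rule act_smult[OF assms(1)]) auto
  then show ?case
    using act_closed[OF assms(1) B.one_closed] by (simp add: B.finsum_empty)
next
  case (insert k K)
  have c: "(\<lambda>k. perm_act \<sigma> (x k)) \<in> K \<rightarrow> carrier B" "perm_act \<sigma> (x k) \<in> carrier B"
      "x k \<in> carrier B" "x \<in> K \<rightarrow> carrier B"
    using insert.prems act_closed[OF assms(1)] by auto
  then show ?case
    using insert by (simp add: B.finsum_insert act_add[OF assms(1)] B.finsum_closed)
qed

lemma elem_sym_pure:
  assumes "a \<in> carrier A"
  shows "elem_sym R A n k a = (\<Oplus>\<^bsub>B\<^esub>S\<in>{S. S \<subseteq> {1..n} \<and> card S = k}. pure (place S a))"
  unfolding elem_sym_def using place_T[OF assms] assms
  by (intro B.finsum_cong') (auto simp: prod_iota_place simp del: restrict_apply)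

lemma finite_subsets_card [simp]: "finite {S. S \<subseteq> {1..n} \<and> card S = k}"
  by (rule finite_subset[of _ "Pow {1..n}"]) auto

lemma symmetric_elem_sym:
  assumes a: "a \<in> carrier A"
  shows "symmetric_tensor (elem_sym R A n k a)"
proof -
  let ?K = "{S. S \<subseteq> {1..n} \<and> card S = k}"
  have pc: "pure (place S a) \<in> carrier B" for S
    by (rule pure_closed[OF place_T[OF a]])
  have "perm_act \<sigma> (\<Oplus>\<^bsub>B\<^esub>S\<in>?K. pure (place S a)) = (\<Oplus>\<^bsub>B\<^esub>S\<in>?K. pure (place S a))"
    if "\<sigma> \<in> P" for \<sigma>
  proof -
    have \<sigma>: "\<sigma> permutes {1..n}" using that by simp
    have inj: "inj \<sigma>" by (rule permutes_inj[OF \<sigma>])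
    have im: "(`) \<sigma> ` ?K = ?K"
    proof (intro equalityI subsetI)
      fix S assume "S \<in> ?K"
      then have "S = \<sigma> ` (inv' \<sigma> ` S)" "inv' \<sigma> ` S \<subseteq> {1..n}" "card (inv' \<sigma> ` S) = k"
        using permutes_inverses[OF \<sigma>] permutes_image[OF permutes_inv[OF \<sigma>]]
          card_image[OF inj_on_subset[OF permutes_inj[OF permutes_inv[OF \<sigma>]] subset_UNIV], of S]
        by (auto simp: image_image permutes_in_image[OF permutes_inv[OF \<sigma>]] simp del: atLeastAtMost_iff)
      then show "S \<in> (`) \<sigma> ` ?K" by blast
    qed (use permutes_image[OF \<sigma>] inj in \<open>auto simp: card_image inj_on_subset\<close>)
    have "perm_act \<sigma> (\<Oplus>\<^bsub>B\<^esub>S\<in>?K. pure (place S a)) = (\<Oplus>\<^bsub>B\<^esub>S\<in>?K. perm_act \<sigma> (pure (place S a)))"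
      using pc by (intro act_finsum \<sigma>) auto
    also have "\<dots> = (\<Oplus>\<^bsub>B\<^esub>S\<in>?K. pure (place (\<sigma> ` S) a))"
      using place_comp[OF \<sigma>] act_pure[OF \<sigma> place_T[OF a]] by (simp del: restrict_apply)
    also have "\<dots> = (\<Oplus>\<^bsub>B\<^esub>S\<in>(`) \<sigma> ` ?K. pure (place S a))"
      using pc inj by (intro B.finsum_reindex[symmetric]) (auto simp: inj_on_def inj_image_eq_iff)
    finally show ?thesis unfolding im .
  qed
  then show ?thesis
    unfolding symmetric_tensor_def elem_sym_pure[OF a] using pc by (auto intro!: B.finsum_closed)
qed

section \<open>Elementary symmetric tensors and the discriminant\<close>

abbreviation "mm \<equiv> mult_matrix R A n \<theta>"

lemma mult_matrix_closed [simp]: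
  "a \<in> carrier A \<Longrightarrow> i \<in> {1..n} \<Longrightarrow> j \<in> {1..n} \<Longrightarrow> mm a i j \<in> carrier R"
  by (simp add: mult_matrix_def)

text \<open>The contribution of \<open>p\<close>, up to its sign, to the principal minor of the matrix of multiplication
  by \<open>a\<close> with rows and columns in \<open>S\<close>.\<close>

definition minor :: "'b \<Rightarrow> (nat \<Rightarrow> nat) \<Rightarrow> nat set \<Rightarrow> 'a"
  where "minor a p S = (\<Otimes>i\<in>S. mm a i (p i)) \<otimes> (\<Otimes>i\<in>{1..n} - S. if i = p i then \<one> else \<zero>)"

lemma minor_closed:
  assumes "a \<in> carrier A" "p permutes {1..n}" "S \<subseteq> {1..n}"
  shows "minor a p S \<in> carrier R"
proof -
  have pin: "p i \<in> {1..n}" if "i \<in> {1..n}" for i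
    using that assms(2) by (simp only: permutes_in_image)
  show ?thesis
    unfolding minor_def using assms pin
    by (intro R.m_closed R.finprod_closed Pi_I mult_matrix_closed) (auto simp del: atLeastAtMost_iff)
qed

text \<open>In the product with \<open>E p\<close>, position \<open>i\<close> holds \<open>a \<theta> (p i)\<close> if \<open>i \<in> S\<close> and \<open>\<theta> (p i)\<close> otherwise;
  the coordinate at the identity picks the coefficient of \<open>\<theta> i\<close> in each position.\<close>

lemma Phi_place:
  assumes a: "a \<in> carrier A" and S: "S \<subseteq> {1..n}"
  shows "\<Phi> (pure (place S a)) = (\<Oplus>p\<in>P. [sign p] \<cdot> minor a p S)"
proof -
  let ?X = "pure (place S a)"
  have X: "?X \<in> carrier B" by (rule pure_closed[OF place_T[OF a]])
  have "?X \<otimes>\<^bsub>B\<^esub> \<delta> = (\<Oplus>\<^bsub>B\<^esub>p\<in>P. ?X \<otimes>\<^bsub>B\<^esub> ([sign p] \<cdot>\<^bsub>B\<^esub> E (rs p)))"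
    unfolding delta_expand using X rs_J by (intro B.finsum_rdistr) auto
  also have "\<dots> = (\<Oplus>\<^bsub>B\<^esub>p\<in>P. [sign p] \<cdot>\<^bsub>B\<^esub> (?X \<otimes>\<^bsub>B\<^esub> E (rs p)))"
    using X rs_J by (intro B.finsum_cong') (auto simp: B.sign_act B.r_minus simp del: restrict_apply)
  finally have "\<Phi> ?X = \<kappa> j0 (\<Oplus>\<^bsub>B\<^esub>p\<in>P. [sign p] \<cdot>\<^bsub>B\<^esub> (?X \<otimes>\<^bsub>B\<^esub> E (rs p)))"
    by (simp only: \<Phi>_def)
  also have "\<dots> = (\<Oplus>p\<in>P. \<kappa> j0 ([sign p] \<cdot>\<^bsub>B\<^esub> (?X \<otimes>\<^bsub>B\<^esub> E (rs p))))"
    using X rs_J by (intro kappa_finsum j0_J) auto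
  also have "\<dots> = (\<Oplus>p\<in>P. [sign p] \<cdot> minor a p S)"
  proof (rule R.finsum_cong')
    fix p assume "p \<in> P"
    then have p: "p permutes {1..n}" by simp
    have pin: "p i \<in> {1..n}" if "i \<in> {1..n}" for i
      using that p by (simp only: permutes_in_image)
    let ?t = "\<lambda>i\<in>{1..n}. \<theta> (rs p i)"
    have t: "?t \<in> T" by (rule theta_tuple[OF rs_J[OF p]])
    have Mc: "mm a i (p i) \<in> carrier R" if "i \<in> {1..n}" for i
      using a that pin by (intro mult_matrix_closed) auto
    have "\<kappa> j0 (?X \<otimes>\<^bsub>B\<^esub> E (rs p)) = weight j0 (tuple_mult A n (place S a) ?t)"
      unfolding E_pure[OF rs_J[OF p]] pure_mult[OF place_T[OF a] t]
      by (rule kappa_pure[OF j0_J tuple_mult_closed[OF place_T[OF a] t]])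
    also have "\<dots> = (\<Otimes>i\<in>{1..n}. if i \<in> S then mm a i (p i) else if i = p i then \<one> else \<zero>)"
      unfolding weight_def
    proof (rule R.finprod_cong')
      fix i assume i: "i \<in> {1..n}"
      show "crd (tuple_mult A n (place S a) ?t i) (j0 i)
          = (if i \<in> S then mm a i (p i) else if i = p i then \<one> else \<zero>)"
        using i pin[OF i] a theta_closed[OF pin[OF i]] coords_theta[OF i pin[OF i]]
        by (simp add: tuple_mult_def mult_matrix_def)
    qed (use Mc in auto)
    also have "\<dots> = (\<Otimes>i\<in>S \<union> ({1..n} - S). if i \<in> S then mm a i (p i) else if i = p i then \<one> else \<zero>)"
      using S by (simp add: Un_absorb1)
    also have "\<dots> = (\<Otimes>i\<in>S. if i \<in> S then mm a i (p i) else if i = p i then \<one> else \<zero>)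
        \<otimes> (\<Otimes>i\<in>{1..n} - S. if i \<in> S then mm a i (p i) else if i = p i then \<one> else \<zero>)"
      using S Mc finite_subset[OF S] by (intro R.finprod_Un_disjoint) auto
    also have "\<dots> = minor a p S"
      unfolding minor_def using S Mc
      by (intro arg_cong2[where f = "mult R"] R.finprod_cong') auto
    finally have k: "\<kappa> j0 (?X \<otimes>\<^bsub>B\<^esub> E (rs p)) = minor a p S" .
    have XE: "?X \<otimes>\<^bsub>B\<^esub> E (rs p) \<in> carrier B"
      using X E_closed[OF rs_J[OF p]] by (rule B.m_closed)
    show "\<kappa> j0 ([sign p] \<cdot>\<^bsub>B\<^esub> (?X \<otimes>\<^bsub>B\<^esub> E (rs p))) = [sign p] \<cdot> minor a p S"
      unfolding kappa_sign[OF j0_J XE] k ..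
  qed (use minor_closed[OF a _ S] in auto)
  finally show ?thesis .
qed

lemma Phi_finsum:
  assumes "finite K" "x \<in> K \<rightarrow> carrier B"
  shows "\<Phi> (\<Oplus>\<^bsub>B\<^esub>k\<in>K. x k) = (\<Oplus>k\<in>K. \<Phi> (x k))"
proof -
  have "\<Phi> (\<Oplus>\<^bsub>B\<^esub>k\<in>K. x k) = \<kappa> j0 (\<Oplus>\<^bsub>B\<^esub>k\<in>K. x k \<otimes>\<^bsub>B\<^esub> \<delta>)"
    unfolding \<Phi>_def using assms by (simp only: B.finsum_ldistr delta_closed)
  also have "\<dots> = (\<Oplus>k\<in>K. \<Phi> (x k))"
    unfolding \<Phi>_def using assms by (intro kappa_finsum j0_J) auto
  finally show ?thesis .
qed

lemma Phi_elem_sym: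
  assumes a: "a \<in> carrier A" and k: "k \<in> {1..n}"
  shows "\<Phi> (elem_sym R A n k a) = char_coeff R A n \<theta> k a"
proof -
  let ?K = "{S. S \<subseteq> {1..n} \<and> card S = k}"
  have X: "pure (place S a) \<in> carrier B" for S by (rule pure_closed[OF place_T[OF a]])
  have "\<Phi> (elem_sym R A n k a) = (\<Oplus>S\<in>?K. \<Phi> (pure (place S a)))"
    unfolding elem_sym_pure[OF a] using X by (intro Phi_finsum) auto
  also have "\<dots> = (\<Oplus>S\<in>?K. \<Oplus>p\<in>P. [sign p] \<cdot> minor a p S)"
    using minor_closed[OF a]
    by (intro R.finsum_cong' Phi_place a) (auto intro!: R.finsum_closed simp del: restrict_apply)
  also have "\<dots> = (\<Oplus>p\<in>P. \<Oplus>S\<in>?K. [sign p] \<cdot> minor a p S)"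
    using minor_closed[OF a] by (intro R.add.finprod_swap[folded finsum_def]) auto
  also have "\<dots> = char_coeff R A n \<theta> k a"
    unfolding char_coeff_def algebra_char_poly_def minor_def
    using a k by (intro R.coeff_char_poly[symmetric]) auto
  finally show ?thesis .
qed

text \<open>A permutation other than the identity moves some position different from \<open>i\<close>, so among the
  contributions to the \<open>1 \<times> 1\<close> minor at \<open>i\<close> only that of the identity survives.\<close>

lemma acts_trace:
  assumes a: "a \<in> carrier A"
  shows "acts_by (\<Oplus>\<^bsub>B\<^esub>i\<in>{1..n}. \<iota> i a) (algebra_trace R A n \<theta> a)"
proof -
  let ?e = "\<Oplus>\<^bsub>B\<^esub>i\<in>{1..n}. \<iota> i a"
  have singletons: "{S. S \<subseteq> {1..n} \<and> card S = 1} = (\<lambda>i. {i}) ` {1..n}"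
    by (auto elim!: card_1_singletonE simp del: atLeastAtMost_iff)
  have iota: "\<iota> i a = pure (place {i} a)" for i
    unfolding tensor_at_def by (rule arg_cong[where f = pure], rule restrict_ext) auto
  have X: "pure (place S a) \<in> carrier B" for S by (rule pure_closed[OF place_T[OF a]])
  have e: "elem_sym R A n 1 a = ?e"
    unfolding elem_sym_pure[OF a] singletons iota
    by (rule B.finsum_reindex) (rule Pi_I, rule X, simp add: inj_on_def)
  have "\<Phi> ?e = (\<Oplus>i\<in>{1..n}. \<Phi> (pure (place {i} a)))"
    unfolding iota by (rule Phi_finsum[OF finite_atLeastAtMost]) (rule Pi_I, rule X)
  also have "\<dots> = (\<Oplus>i\<in>{1..n}. mm a i i)"
  proof (rule R.finsum_cong')
    fix i assume i: "i \<in> {1..n}"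
    have Mc: "mm a i (p i) \<in> carrier R" if "p permutes {1..n}" for p
      using a i that by (intro mult_matrix_closed) (auto simp: permutes_in_image simp del: atLeastAtMost_iff)
    have "\<Phi> (pure (place {i} a)) = (\<Oplus>p\<in>P. [sign p] \<cdot> minor a p {i})"
      using i by (intro Phi_place a) auto
    also have "\<dots> = (\<Oplus>p\<in>P. if id = p then mm a i (p i) else \<zero>)"
    proof (rule R.finsum_cong')
      fix p assume "p \<in> P"
      then have p: "p permutes {1..n}" by simp
      have m: "minor a p {i} = mm a i (p i) \<otimes> (\<Otimes>l\<in>{1..n} - {i}. if l = p l then \<one> else \<zero>)"
        unfolding minor_def using Mc[OF p] by simp
      show "[sign p] \<cdot> minor a p {i} = (if id = p then mm a i (p i) else \<zero>)"
      proof (cases "id = p")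
        case True
        then have "(\<Otimes>l\<in>{1..n} - {i}. if l = p l then \<one> else \<zero>) = \<one>"
          by (intro R.finprod_one_eqI) auto
        then show ?thesis
          unfolding m using Mc[OF p] True by (auto simp: R.sign_act evenperm_id)
      next
        case False
        have "\<exists>l\<in>{1..n} - {i}. p l \<noteq> l"
        proof (rule ccontr)
          assume "\<not> ?thesis"
          then have fx: "p l = l" if "l \<noteq> i" for l
            using that permutes_not_in[OF p, of l] by blast
          have "p i = i"
          proof (rule ccontr)
            assume "p i \<noteq> i"
            then have "p (p i) = p i" by (rule fx)
            then show False using permutes_inj[OF p] \<open>p i \<noteq> i\<close> by (auto dest: injD)
          qed
          then have "p = id" using fx by (metis eq_id_iff)
          then show False using False by simp
        qed
        then obtain l where l: "l \<in> {1..n} - {i}" "p l \<noteq> l" by blast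
        have s: "{1..n} - {i} = insert l ({1..n} - {i} - {l})" using l by auto
        have "(\<Otimes>l\<in>{1..n} - {i}. if l = p l then \<one> else \<zero>) = \<zero>"
          using l(2) by (subst s, subst R.finprod_insert) auto
        then show ?thesis
          unfolding m using Mc[OF p] False by (simp add: R.sign_act)
      qed
    qed (use Mc Mc[OF permutes_id] in auto)
    also have "\<dots> = mm a i (id i)"
      using Mc Mc[OF permutes_id] by (intro R.add.finprod_singleton[folded finsum_def]) (auto simp: permutes_id)
    finally show "\<Phi> (pure (place {i} a)) = mm a i i" by simp
  qed (use a in auto)
  finally have "\<Phi> ?e = algebra_trace R A n \<theta> a"
    by (simp only: algebra_trace_def)
  then show ?thesis
    using symmetric_acts[OF symmetric_elem_sym[OF a], of 1] unfolding e by simp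
qed

text \<open>The entries of \<open>M\<^sup>T M\<close>, for \<open>M\<close> the matrix with determinant \<open>\<delta>\<close>, are the tensors \<open>e\<^sub>1(\<theta>\<^sub>j \<theta>\<^sub>k)\<close>,
  which act by traces.\<close>

lemma acts_delta_square: "acts_by (\<delta> \<otimes>\<^bsub>B\<^esub> \<delta>) (discriminant R A n \<theta>)"
proof -
  have "\<delta> \<otimes>\<^bsub>B\<^esub> \<delta> = rdet B n (\<lambda>j k. \<Oplus>\<^bsub>B\<^esub>i\<in>{1..n}. \<iota> i (\<theta> j) \<otimes>\<^bsub>B\<^esub> \<iota> i (\<theta> k))"
    unfolding alt_element_def by (rule B.rdet_gram[OF _ two_regular_B, symmetric]) simp
  moreover have "acts_by \<dots> (discriminant R A n \<theta>)"
    unfolding discriminant_def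
  proof (rule acts_rdet)
    fix j k assume jk: "j \<in> {1..n}" "k \<in> {1..n}"
    have "(\<Oplus>\<^bsub>B\<^esub>i\<in>{1..n}. \<iota> i (\<theta> j) \<otimes>\<^bsub>B\<^esub> \<iota> i (\<theta> k)) = (\<Oplus>\<^bsub>B\<^esub>i\<in>{1..n}. \<iota> i (\<theta> j \<otimes>\<^bsub>A\<^esub> \<theta> k))"
      using jk by (intro B.finsum_cong') (auto simp: iota_mult)
    then show "acts_by (\<Oplus>\<^bsub>B\<^esub>i\<in>{1..n}. \<iota> i (\<theta> j) \<otimes>\<^bsub>B\<^esub> \<iota> i (\<theta> k)) (algebra_trace R A n \<theta> (\<theta> j \<otimes>\<^bsub>A\<^esub> \<theta> k))"
      using acts_trace[of "\<theta> j \<otimes>\<^bsub>A\<^esub> \<theta> k"] jk by simp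
  qed
  ultimately show ?thesis by simp
qed

end

section \<open>Symmetric tensors are generated by the elementary ones\<close>

lemma filter_image_mset_id:
  "filter_mset Q (image_mset f M) = image_mset f (filter_mset (\<lambda>x. Q (f x)) M)"
  by (induction M) auto

lemma size_filter_split:
  "size (filter_mset Q m) = size (filter_mset (\<lambda>x. Q x \<and> S x) m) + size (filter_mset (\<lambda>x. Q x \<and> \<not> S x) m)"
  by (induction m) auto

lemma size_filter_image: "size (filter_mset Q (image_mset f m)) = size (filter_mset (\<lambda>x. Q (f x)) m)"
  by (simp add: filter_image_mset_id)

lemma size_filter_eq: "size (filter_mset (\<lambda>l. l = j) m) = count m j"
  by (simp add: filter_eq_replicate_mset)

text \<open>Label \<open>0\<close> stands for the entry \<open>1\<close>. Merging a label \<open>j\<close> into it removes the occurrences of \<open>j\<close>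
  from the nontrivial labels.\<close>

lemma size_merged:
  assumes "j \<noteq> 0"
  shows "size (filter_mset (\<lambda>l. l \<noteq> 0) m)
    = size (filter_mset (\<lambda>l. l \<noteq> 0) (image_mset (\<lambda>l. if l = j then 0 else l) m)) + count m j"
proof -
  have "filter_mset (\<lambda>l. l \<noteq> 0 \<and> l = j) m = filter_mset (\<lambda>l. l = j) m"
    "filter_mset (\<lambda>l. (if l = j then 0 else l) \<noteq> 0) m = filter_mset (\<lambda>l. l \<noteq> 0 \<and> l \<noteq> j) m"
    using assms by (auto intro!: filter_mset_cong)
  then show ?thesis
    using size_filter_split[of "\<lambda>l. l \<noteq> 0" m "\<lambda>l. l = j"]
    by (simp add: size_filter_image size_filter_eq)
qed

context two_regular_algebra
begin

text \<open>A labelling attaches a label to each position, and a family \<open>a\<close> assigns an element of \<open>A\<close> to each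
  label, with \<open>a 0 = 1\<close>. Labels are kept apart from their values because different labels may have
  equal values, and orbit sums must then still be counted by labels. Two labellings are in the
  same orbit if they use each label equally often, that is, have the same multiset.\<close>

abbreviation mset_of :: "(nat \<Rightarrow> nat) \<Rightarrow> nat multiset"
  where "mset_of u \<equiv> image_mset u (mset_set {1..n})"

abbreviation labellings :: "(nat \<Rightarrow> nat) set"
  where "labellings \<equiv> {1..n} \<rightarrow>\<^sub>E UNIV"

definition arrangements :: "nat multiset \<Rightarrow> (nat \<Rightarrow> nat) set"
  where "arrangements m = {u \<in> labellings. mset_of u = m}"

definition label_tensor where
  "label_tensor a u = pure (\<lambda>i\<in>{1..n}. a (u i))"

definition orbit_sum where
  "orbit_sum a m = (\<Oplus>\<^bsub>B\<^esub>u\<in>arrangements m. label_tensor a u)"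

lemma finite_bounded_labellings: "finite L \<Longrightarrow> finite {u \<in> labellings. set_mset (mset_of u) \<subseteq> L}"
proof (rule finite_subset)
  assume "finite L"
  then show "finite ({1..n} \<rightarrow>\<^sub>E L)" by (intro finite_PiE) auto
  show "{u \<in> labellings. set_mset (mset_of u) \<subseteq> L} \<subseteq> {1..n} \<rightarrow>\<^sub>E L"
    by (auto simp: PiE_def)
qed

lemma finite_arrangements [simp]: "finite (arrangements m)"
  by (rule finite_subset[OF _ finite_bounded_labellings[of "set_mset m"]]) (auto simp: arrangements_def)

lemma label_tensor_closed [simp]: "(\<And>l. a l \<in> carrier A) \<Longrightarrow> label_tensor a u \<in> carrier B"
  unfolding label_tensor_def by (intro pure_closed) (auto simp: tuples_def)

lemma orbit_sum_closed [simp]: "(\<And>l. a l \<in> carrier A) \<Longrightarrow> orbit_sum a m \<in> carrier B"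
  unfolding orbit_sum_def by (intro B.finsum_closed) auto

lemma sum_over_saturated:
  assumes W: "finite W" "W \<subseteq> labellings"
    and sat: "\<And>u v. u \<in> W \<Longrightarrow> v \<in> labellings \<Longrightarrow> mset_of v = mset_of u \<Longrightarrow> v \<in> W"
    and f: "f \<in> W \<rightarrow> carrier B"
  shows "(\<Oplus>\<^bsub>B\<^esub>w\<in>W. f w) = (\<Oplus>\<^bsub>B\<^esub>m\<in>mset_of ` W. \<Oplus>\<^bsub>B\<^esub>w\<in>arrangements m. f w)"
proof -
  have "(\<Oplus>\<^bsub>B\<^esub>w\<in>W. f w) = (\<Oplus>\<^bsub>B\<^esub>m\<in>mset_of ` W. \<Oplus>\<^bsub>B\<^esub>w\<in>{w \<in> W. mset_of w = m}. f w)"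
    using W f by (intro B.add.finprod_fibre[folded finsum_def]) auto
  also have "\<dots> = (\<Oplus>\<^bsub>B\<^esub>m\<in>mset_of ` W. \<Oplus>\<^bsub>B\<^esub>w\<in>arrangements m. f w)"
  proof (rule B.finsum_cong')
    fix m assume "m \<in> mset_of ` W"
    then obtain u where "u \<in> W" "m = mset_of u" by auto
    then have "{w \<in> W. mset_of w = m} = arrangements m"
      using W(2) sat unfolding arrangements_def by blast
    then show "(\<Oplus>\<^bsub>B\<^esub>w\<in>{w \<in> W. mset_of w = m}. f w) = (\<Oplus>\<^bsub>B\<^esub>w\<in>arrangements m. f w)" by simp
  next
    show "(\<lambda>m. \<Oplus>\<^bsub>B\<^esub>w\<in>arrangements m. f w) \<in> mset_of ` W \<rightarrow> carrier B"
    proof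
      fix m assume "m \<in> mset_of ` W"
      then have "arrangements m \<subseteq> W"
        using sat unfolding arrangements_def by blast
      then show "(\<Oplus>\<^bsub>B\<^esub>w\<in>arrangements m. f w) \<in> carrier B"
        using f by (intro B.finsum_closed) blast
    qed
  qed simp
  finally show ?thesis .
qed

text \<open>Each label \<open>l\<close> splits into \<open>2 * l\<close>, with the value of \<open>l\<close>, and \<open>2 * l + 1\<close>, with that value times
  \<open>b\<close>. This records in which positions a factor \<open>b\<close> was inserted and keeps \<open>0\<close> as the trivial
  label.\<close>

definition doubled where
  "doubled a b l = (if odd l then a (l div 2) \<otimes>\<^bsub>A\<^esub> b else a (l div 2))"

lemma doubled_closed:
  "(\<And>l. a l \<in> carrier A) \<Longrightarrow> b \<in> carrier A \<Longrightarrow> doubled a b l \<in> carrier A"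
  by (simp add: doubled_def)

lemma size_odd_labels:
  "size (filter_mset odd (mset_of w)) = card {i \<in> {1..n}. odd (w i)}"
proof -
  have "filter_mset odd (mset_of w) = image_mset w (mset_set {i \<in> {1..n}. odd (w i)})"
    by (simp add: filter_image_mset_id filter_mset_mset_set)
  then show ?thesis by simp
qed

text \<open>The labellings that arise from an arrangement of \<open>m\<close> by inserting a factor in \<open>k\<close> positions.\<close>

definition refinements :: "nat \<Rightarrow> nat multiset \<Rightarrow> (nat \<Rightarrow> nat) set" where
  "refinements k m = {w \<in> labellings.
    image_mset (\<lambda>l. l div 2) (mset_of w) = m \<and> size (filter_mset odd (mset_of w)) = k}"

text \<open>Pairs of a \<open>k\<close>-subset and an arrangement correspond to refinements: the odd labels mark the subset,
  and halving the labels recovers the arrangement.\<close>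

lemma elem_sym_times_orbit_sum:
  assumes a: "\<And>l. a l \<in> carrier A" and b: "b \<in> carrier A"
  shows "elem_sym R A n k b \<otimes>\<^bsub>B\<^esub> orbit_sum a m = (\<Oplus>\<^bsub>B\<^esub>w\<in>refinements k m. label_tensor (doubled a b) w)"
    and "finite (refinements k m)"
proof -
  let ?K = "{S. S \<subseteq> {1..n} \<and> card S = k}"
  let ?enc = "\<lambda>p. \<lambda>i\<in>{1..n}. 2 * snd p i + (if i \<in> fst p then 1 else 0)"
  let ?dec = "\<lambda>w. ({i \<in> {1..n}. odd (w i)}, \<lambda>i\<in>{1..n}. w i div 2)"
  have bij: "bij_betw ?enc (?K \<times> arrangements m) (refinements k m)"
  proof (rule bij_betw_byWitness[of _ ?dec])
    show "\<forall>p\<in>?K \<times> arrangements m. ?dec (?enc p) = p"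
      by (auto simp: arrangements_def fun_eq_iff restrict_def PiE_def extensional_def)
    have "l - 1 + 1 = l" if "odd l" for l :: nat
      using that by (cases l) auto
    then show "\<forall>w\<in>refinements k m. ?enc (?dec w) = w"
      by (auto simp: refinements_def fun_eq_iff restrict_def PiE_def extensional_def)
    show "?enc ` (?K \<times> arrangements m) \<subseteq> refinements k m"
    proof safe
      fix S h assume S: "S \<subseteq> {1..n}" "k = card S" and h: "h \<in> arrangements m"
      have "image_mset (\<lambda>l. l div 2) (mset_of (?enc (S, h))) = mset_of h"
        unfolding image_mset.compositionality by (intro image_mset_cong) auto
      moreover have "{i \<in> {1..n}. odd (?enc (S, h) i)} = S"
        using S(1) by auto
      ultimately show "?enc (S, h) \<in> refinements (card S) m"
        using h unfolding refinements_def size_odd_labels by (auto simp: arrangements_def)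
    qed
    show "?dec ` refinements k m \<subseteq> ?K \<times> arrangements m"
    proof safe
      fix w assume w: "w \<in> refinements k m"
      show "card {i \<in> {1..n}. odd (w i)} = k"
        using w unfolding refinements_def size_odd_labels[symmetric] by simp
      have "mset_of (\<lambda>i\<in>{1..n}. w i div 2) = image_mset (\<lambda>l. l div 2) (mset_of w)"
        unfolding image_mset.compositionality by (intro image_mset_cong) auto
      then show "(\<lambda>i\<in>{1..n}. w i div 2) \<in> arrangements m"
        using w by (simp add: refinements_def arrangements_def)
    qed
  qed
  have fin: "finite (?K \<times> arrangements m)" by simp
  then show "finite (refinements k m)"
    using bij_betw_finite[OF bij] by simp
  have place: "pure (place S b) \<in> carrier B" for S by (rule pure_closed[OF place_T[OF b]])
  have lt: "label_tensor a u \<in> carrier B" for u using a by simp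
  have lt': "label_tensor (doubled a b) u \<in> carrier B" for u
    using doubled_closed[of a b] a b by simp
  have "elem_sym R A n k b \<otimes>\<^bsub>B\<^esub> orbit_sum a m
      = (\<Oplus>\<^bsub>B\<^esub>S\<in>?K. pure (place S b) \<otimes>\<^bsub>B\<^esub> orbit_sum a m)"
    unfolding elem_sym_pure[OF b] using place a by (intro B.finsum_ldistr) auto
  also have "\<dots> = (\<Oplus>\<^bsub>B\<^esub>S\<in>?K. \<Oplus>\<^bsub>B\<^esub>h\<in>arrangements m. pure (place S b) \<otimes>\<^bsub>B\<^esub> label_tensor a h)"
    unfolding orbit_sum_def using place lt
    by (intro B.finsum_cong' refl B.finsum_rdistr) (auto intro!: B.finsum_closed)
  also have "\<dots> = (\<Oplus>\<^bsub>B\<^esub>p\<in>?K \<times> arrangements m. pure (place (fst p) b) \<otimes>\<^bsub>B\<^esub> label_tensor a (snd p))"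
    using place lt by (intro B.add.finprod_Times[folded finsum_def, symmetric]) auto
  also have "\<dots> = (\<Oplus>\<^bsub>B\<^esub>p\<in>?K \<times> arrangements m. label_tensor (doubled a b) (?enc p))"
  proof (rule B.finsum_cong')
    fix p assume p: "p \<in> ?K \<times> arrangements m"
    have T: "(\<lambda>i\<in>{1..n}. a (snd p i)) \<in> T" using a by (auto simp: tuples_def)
    have "pure (place (fst p) b) \<otimes>\<^bsub>B\<^esub> label_tensor a (snd p)
        = pure (tuple_mult A n (place (fst p) b) (\<lambda>i\<in>{1..n}. a (snd p i)))"
      unfolding label_tensor_def by (rule pure_mult[OF place_T[OF b] T])
    also have "tuple_mult A n (place (fst p) b) (\<lambda>i\<in>{1..n}. a (snd p i))
        = (\<lambda>i\<in>{1..n}. doubled a b (?enc p i))"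
      unfolding tuple_mult_def
      by (rule restrict_ext) (use a b in \<open>auto simp: doubled_def A.m_comm\<close>)
    finally show "pure (place (fst p) b) \<otimes>\<^bsub>B\<^esub> label_tensor a (snd p)
        = label_tensor (doubled a b) (?enc p)"
      by (simp only: label_tensor_def)
  qed (use lt' in auto)
  also have "\<dots> = (\<Oplus>\<^bsub>B\<^esub>w\<in>refinements k m. label_tensor (doubled a b) w)"
    unfolding bij_betw_imp_surj_on[OF bij, symmetric]
    by (rule B.finsum_reindex[symmetric]) (rule Pi_I, rule lt', rule bij_betw_imp_inj_on[OF bij])
  finally show "elem_sym R A n k b \<otimes>\<^bsub>B\<^esub> orbit_sum a m
      = (\<Oplus>\<^bsub>B\<^esub>w\<in>refinements k m. label_tensor (doubled a b) w)" .
qed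

text \<open>Replace the label \<open>j\<close> by \<open>0\<close> and insert \<open>a j\<close> in \<open>count m j\<close> positions. If all insertions happen at
  label \<open>0\<close>, they produce the label \<open>1\<close>, with value \<open>a j\<close>; reading \<open>1\<close> as \<open>j\<close> gives back each
  arrangement of \<open>m\<close> exactly once.\<close>

lemma refinements_without_overlap:
  assumes j: "j \<noteq> 0" and a: "\<And>l. a l \<in> carrier A" "a 0 = \<one>\<^bsub>A\<^esub>"
  shows "(\<Oplus>\<^bsub>B\<^esub>w\<in>{w \<in> refinements (count m j) (image_mset (\<lambda>l. if l = j then 0 else l) m).
            \<forall>l\<in>#mset_of w. odd l \<longrightarrow> l = 1}. label_tensor (doubled a (a j)) w) = orbit_sum a m"
proof -
  let ?W = "{w \<in> refinements (count m j) (image_mset (\<lambda>l. if l = j then 0 else l) m).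
            \<forall>l\<in>#mset_of w. odd l \<longrightarrow> l = 1}"
  \<comment> \<open>The label \<open>j\<close> turns into an insertion at the trivial label, and other labels stay without one.\<close>
  let ?f = "\<lambda>l. if l = j then 1 else 2 * l" and ?g = "\<lambda>l. if l = 1 then j else l div 2"
  let ?F = "\<lambda>u. \<lambda>i\<in>{1..n}. ?f (u i)" and ?G = "\<lambda>w. \<lambda>i\<in>{1..n}. ?g (w i)"
  have bij: "bij_betw ?F (arrangements m) ?W"
  proof (rule bij_betw_byWitness[of _ ?G])
    show "\<forall>u\<in>arrangements m. ?G (?F u) = u"
      by (auto simp: arrangements_def fun_eq_iff restrict_def PiE_def extensional_def)
    show "\<forall>w\<in>?W. ?F (?G w) = w"
    proof
      fix w assume w: "w \<in> ?W"
      \<comment> \<open>The multiset of halved labels does not contain \<open>j\<close>, which was merged into \<open>0\<close>.\<close>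
      have j0: "w i div 2 \<noteq> j" if "i \<in> {1..n}" "w i \<noteq> 1" for i
      proof
        assume e: "w i div 2 = j"
        have "image_mset (\<lambda>l. l div 2) (mset_of w) = image_mset (\<lambda>l. if l = j then 0 else l) m"
          using w by (simp add: refinements_def)
        moreover have "j \<in># image_mset (\<lambda>l. l div 2) (mset_of w)"
          using that e by auto
        ultimately show False using j by (auto split: if_splits)
      qed
      have "2 * (w i div 2) = w i" if "i \<in> {1..n}" "w i \<noteq> 1" for i
        using w that by (cases "odd (w i)") auto
      then show "?F (?G w) = w"
        using w j0 by (auto simp: refinements_def fun_eq_iff restrict_def PiE_def extensional_def)
    qed
    show "?F ` arrangements m \<subseteq> ?W"
    proof safe
      fix u assume u: "u \<in> arrangements m"
      have m: "mset_of u = m" using u by (simp add: arrangements_def)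
      have F: "mset_of (?F u) = image_mset ?f m"
        unfolding m[symmetric] image_mset.compositionality by (intro image_mset_cong) auto
      have "image_mset (\<lambda>l. l div 2) (mset_of (?F u)) = image_mset (\<lambda>l. if l = j then 0 else l) m"
        unfolding F image_mset.compositionality by (intro image_mset_cong) auto
      moreover have "size (filter_mset odd (mset_of (?F u))) = count m j"
      proof -
        have "filter_mset (\<lambda>l. odd (?f l)) m = filter_mset (\<lambda>l. l = j) m"
          by (intro filter_mset_cong) auto
        then show ?thesis
          unfolding F filter_image_mset_id
          by (simp only: size_image_mset filter_eq_replicate_mset size_replicate_mset)
      qed
      ultimately show "?F u \<in> refinements (count m j) (image_mset (\<lambda>l. if l = j then 0 else l) m)"
        by (simp add: refinements_def)
      fix l assume "l \<in># mset_of (?F u)" "odd l"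
      then show "l = 1" unfolding F by (auto split: if_splits)
    qed
    show "?G ` ?W \<subseteq> arrangements m"
    proof
      fix u assume "u \<in> ?G ` ?W"
      then obtain w where w: "w \<in> ?W" "u = ?G w" by blast
      define M where "M = mset_of w"
      have M: "image_mset (\<lambda>l. l div 2) M = image_mset (\<lambda>l. if l = j then 0 else l) m"
        "size (filter_mset odd M) = count m j" "\<And>l. l \<in># M \<Longrightarrow> odd l \<Longrightarrow> l = 1"
        using w(1) unfolding M_def refinements_def by blast+
      have o: "filter_mset odd M = replicate_mset (count m j) 1"
      proof -
        have "filter_mset odd M = filter_mset (\<lambda>l. l = 1) M"
          using M(3) by (intro filter_mset_cong) auto
        then show ?thesis using M(2) by (simp add: filter_eq_replicate_mset)
      qed
      let ?E = "filter_mset (\<lambda>l. \<not> odd l) M"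
      have split: "M = filter_mset odd M + ?E" by (rule multiset_partition)
      have split_m: "m = filter_mset (\<lambda>l. l = j) m + filter_mset (\<lambda>l. \<not> l = j) m"
        by (rule multiset_partition)
      have "image_mset (\<lambda>l. l div 2) M
          = replicate_mset (count m j) 0 + image_mset (\<lambda>l. l div 2) ?E"
        by (subst split) (simp add: o)
      moreover have "image_mset (\<lambda>l. if l = j then 0 else l) m
          = replicate_mset (count m j) 0 + filter_mset (\<lambda>l. \<not> l = j) m"
      proof -
        have "image_mset (\<lambda>l. if l = j then 0 else l) (filter_mset (\<lambda>l. \<not> l = j) m)
            = image_mset (\<lambda>l. l) (filter_mset (\<lambda>l. \<not> l = j) m)"
          by (intro image_mset_cong) auto
        then show ?thesis
          by (subst split_m) (simp add: filter_eq_replicate_mset)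
      qed
      ultimately have E: "image_mset (\<lambda>l. l div 2) ?E = filter_mset (\<lambda>l. \<not> l = j) m"
        using M(1) by simp
      have "mset_of u = image_mset ?g M"
        unfolding w(2) M_def image_mset.compositionality by (intro image_mset_cong) auto
      also have "\<dots> = replicate_mset (count m j) j + image_mset ?g ?E"
        by (subst split) (simp add: o)
      also have "image_mset ?g ?E = image_mset (\<lambda>l. l div 2) ?E"
        by (intro image_mset_cong) auto
      also have "replicate_mset (count m j) j + \<dots> = m"
        unfolding E using split_m by (simp add: filter_eq_replicate_mset)
      finally have "mset_of u = m" .
      moreover have "u \<in> labellings"
        unfolding w(2) by simp
      ultimately show "u \<in> arrangements m"
        unfolding arrangements_def by blast
    qed
  qed
  have lt: "label_tensor a u \<in> carrier B" for u using a by simp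
  have lt': "label_tensor (doubled a (a j)) u \<in> carrier B" for u
    using doubled_closed[of a "a j"] a by simp
  have "(\<Oplus>\<^bsub>B\<^esub>w\<in>?W. label_tensor (doubled a (a j)) w)
      = (\<Oplus>\<^bsub>B\<^esub>u\<in>arrangements m. label_tensor (doubled a (a j)) (?F u))"
    unfolding bij_betw_imp_surj_on[OF bij, symmetric]
    by (rule B.finsum_reindex) (rule Pi_I, rule lt', rule bij_betw_imp_inj_on[OF bij])
  also have "\<dots> = orbit_sum a m"
    unfolding orbit_sum_def
  proof (rule B.finsum_cong')
    fix u
    have "(\<lambda>i\<in>{1..n}. doubled a (a j) (?F u i)) = (\<lambda>i\<in>{1..n}. a (u i))"
      by (rule restrict_ext) (use a in \<open>auto simp: doubled_def\<close>)
    then show "label_tensor (doubled a (a j)) (?F u) = label_tensor a u"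
      by (simp only: label_tensor_def)
  qed (use lt in auto)
  finally show ?thesis .
qed

text \<open>An insertion at a nontrivial label uses up one of the \<open>count m j\<close> insertions without making a
  new position nontrivial.\<close>

lemma size_overlap:
  assumes j: "j \<noteq> 0"
    and w: "w \<in> refinements (count m j) (image_mset (\<lambda>l. if l = j then 0 else l) m)"
    and l: "l \<in># mset_of w" "odd l" "l \<noteq> 1"
  shows "size (filter_mset (\<lambda>l. l \<noteq> 0) (mset_of w)) < size (filter_mset (\<lambda>l. l \<noteq> 0) m)"
proof -
  let ?M = "mset_of w"
  have M: "image_mset (\<lambda>l. l div 2) ?M = image_mset (\<lambda>l. if l = j then 0 else l) m"
    "size (filter_mset odd ?M) = count m j"
    using w by (simp_all add: refinements_def)
  have "filter_mset (\<lambda>l. l \<noteq> 0 \<and> l div 2 \<noteq> 0) ?M = filter_mset (\<lambda>l. l div 2 \<noteq> 0) ?M"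
    "filter_mset (\<lambda>l. l \<noteq> 0 \<and> \<not> l div 2 \<noteq> 0) ?M = filter_mset (\<lambda>l. odd l \<and> l = 1) ?M"
    by (auto intro!: filter_mset_cong)
  then have "size (filter_mset (\<lambda>l. l \<noteq> 0) ?M)
      = size (filter_mset (\<lambda>l. l \<noteq> 0) (image_mset (\<lambda>l. l div 2) ?M)) + size (filter_mset (\<lambda>l. odd l \<and> l = 1) ?M)"
    using size_filter_split[of "\<lambda>l. l \<noteq> 0" ?M "\<lambda>l. l div 2 \<noteq> 0"] by (simp add: size_filter_image)
  moreover have "size (filter_mset (\<lambda>l. odd l \<and> l = 1) ?M) < count m j"
  proof -
    have "l \<in># filter_mset (\<lambda>l. odd l \<and> \<not> l = 1) ?M"
      using l by simp
    then have "0 < size (filter_mset (\<lambda>l. odd l \<and> \<not> l = 1) ?M)"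
      by (metis empty_iff gr0I set_mset_empty size_eq_0_iff_empty)
    then show ?thesis
      using size_filter_split[of odd ?M "\<lambda>l. l = 1"] M(2) by linarith
  qed
  ultimately show ?thesis
    unfolding M(1) size_merged[OF j, of m] by simp
qed

lemma kappa_symmetric:
  assumes z: "symmetric_tensor z" and f: "f \<in> J" "g \<in> J" "mset_of f = mset_of g"
  shows "\<kappa> f z = \<kappa> g z"
proof -
  obtain p where p: "p permutes {1..n}" "\<forall>i\<in>{1..n}. f i = g (p i)"
    using image_mset_eq_implies_permutes[OF finite_atLeastAtMost f(3)] by blast
  have "f = g \<circ> p"
    by (rule PiE_ext[OF f(1) J_comp[OF p(1) f(2)]]) (use p(2) in simp)
  then show ?thesis
    using kappa_act[OF p(1) _ f(2), of z] z p(1) by (simp add: symmetric_tensor_def)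
qed

context
  fixes C
  assumes CB: "C \<subseteq> carrier B" and one: "\<one>\<^bsub>B\<^esub> \<in> C"
    and add: "\<And>x y. x \<in> C \<Longrightarrow> y \<in> C \<Longrightarrow> x \<oplus>\<^bsub>B\<^esub> y \<in> C"
    and mult: "\<And>x y. x \<in> C \<Longrightarrow> y \<in> C \<Longrightarrow> x \<otimes>\<^bsub>B\<^esub> y \<in> C"
    and smult: "\<And>r x. r \<in> carrier R \<Longrightarrow> x \<in> C \<Longrightarrow> r \<odot>\<^bsub>B\<^esub> x \<in> C"
    and elem: "\<And>k b. k \<in> {1..n} \<Longrightarrow> b \<in> carrier A \<Longrightarrow> elem_sym R A n k b \<in> C"
begin

lemma generated_zero: "\<zero>\<^bsub>B\<^esub> \<in> C"
  using smult[OF R.zero_closed one] by simp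

lemma generated_sum:
  assumes "finite K" "\<And>k. k \<in> K \<Longrightarrow> f k \<in> C"
  shows "(\<Oplus>\<^bsub>B\<^esub>k\<in>K. f k) \<in> C"
  using assms
proof (induction K)
  case (insert k K)
  have "f k \<in> carrier B" "f \<in> K \<rightarrow> carrier B"
    using insert.prems CB by auto
  then show ?case
    using insert by (simp add: B.finsum_insert add)
qed (simp add: generated_zero B.finsum_empty)

text \<open>Induction on the number of nontrivial entries. For a nontrivial label \<open>j\<close>, the product of
  \<open>e\<^sub>k(a j)\<close>, \<open>k = count m j\<close>, with the orbit sum where \<open>j\<close> is made trivial consists of the wanted
  orbit sum and of orbit sums with overlaps. The latter, and the second factor, have fewer
  nontrivial entries.\<close>

lemma orbit_sum_generated:
  assumes a: "\<And>l. a l \<in> carrier A" "a 0 = \<one>\<^bsub>A\<^esub>"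
  shows "orbit_sum a m \<in> C"
  using a
proof (induction "size (filter_mset (\<lambda>l. l \<noteq> 0) m)" arbitrary: a m rule: less_induct)
  case (less m a)
  note a = less.prems
  consider (empty) "arrangements m = {}" | (trivial) "\<forall>l\<in>#m. l = 0"
    | (label) j where "arrangements m \<noteq> {}" "j \<in># m" "j \<noteq> 0" by blast
  then show ?case
  proof cases
    case empty
    then show ?thesis using generated_zero by (simp add: orbit_sum_def B.finsum_empty)
  next
    case trivial
    have "label_tensor a u = \<one>\<^bsub>B\<^esub>" if "u \<in> arrangements m" for u
    proof -
      have "u i = 0" if "i \<in> {1..n}" for i
        using \<open>u \<in> arrangements m\<close> that trivial by (auto simp: arrangements_def)
      then have "(\<lambda>i\<in>{1..n}. a (u i)) = (\<lambda>i\<in>{1..n}. \<one>\<^bsub>A\<^esub>)"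
        using a(2) by (intro restrict_ext) auto
      then show ?thesis by (simp only: label_tensor_def pure_one)
    qed
    then show ?thesis
      unfolding orbit_sum_def by (intro generated_sum finite_arrangements) (simp add: one)
  next
    case (label j)
    let ?m' = "image_mset (\<lambda>l. if l = j then 0 else l) m"
    let ?W = "refinements (count m j) ?m'" and ?a = "doubled a (a j)"
    let ?W1 = "{w \<in> ?W. \<forall>l\<in>#mset_of w. odd l \<longrightarrow> l = 1}"
    let ?W2 = "{w \<in> ?W. \<not> (\<forall>l\<in>#mset_of w. odd l \<longrightarrow> l = 1)}"
    have k: "count m j \<in> {1..n}"
    proof -
      have "size m = n"
        using label(1) by (auto simp: arrangements_def)
      moreover have "count m j \<le> size m"
        using multiset_partition[of m "\<lambda>l. l = j"] by (metis le_add1 size_filter_eq size_union)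
      ultimately show ?thesis
        using label(2) by (simp add: Suc_leI One_nat_def)
    qed
    have lt: "label_tensor ?a u \<in> carrier B" for u
      using doubled_closed[of a "a j"] a by simp
    have W: "finite ?W" by (rule elem_sym_times_orbit_sum(2)[OF a(1) a(1)])
    have "size (filter_mset (\<lambda>l. l \<noteq> 0) ?m') < size (filter_mset (\<lambda>l. l \<noteq> 0) m)"
      using size_merged[OF label(3), of m] k by simp
    then have "orbit_sum a ?m' \<in> C"
      using a by (intro less.hyps) auto
    then have prod: "elem_sym R A n (count m j) (a j) \<otimes>\<^bsub>B\<^esub> orbit_sum a ?m' \<in> C"
      using a k by (intro mult elem)
    have "(\<Oplus>\<^bsub>B\<^esub>w\<in>?W2. label_tensor ?a w) = (\<Oplus>\<^bsub>B\<^esub>M\<in>mset_of ` ?W2. orbit_sum ?a M)"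
      unfolding orbit_sum_def
    proof (rule sum_over_saturated)
      show "finite ?W2" using W by simp
      show "?W2 \<subseteq> labellings" by (auto simp: refinements_def)
      show "v \<in> ?W2" if "u \<in> ?W2" "v \<in> labellings" "mset_of v = mset_of u" for u v
        using that(1,2) unfolding refinements_def mem_Collect_eq that(3) by blast
    qed (use lt in auto)
    also have "\<dots> \<in> C"
    proof (rule generated_sum)
      show "finite (mset_of ` ?W2)" using W by simp
      fix M assume "M \<in> mset_of ` ?W2"
      then obtain w l where w: "w \<in> ?W" "M = mset_of w" "l \<in># mset_of w" "odd l" "l \<noteq> 1" by blast
      show "orbit_sum ?a M \<in> C"
      proof (rule less.hyps)
        show "size (filter_mset (\<lambda>l. l \<noteq> 0) M) < size (filter_mset (\<lambda>l. l \<noteq> 0) m)"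
          unfolding w(2) by (rule size_overlap[OF label(3) w(1) w(3-5)])
        show "?a l \<in> carrier A" for l using a by (intro doubled_closed)
        show "?a 0 = \<one>\<^bsub>A\<^esub>" using a by (simp add: doubled_def)
      qed
    qed
    finally have W2: "(\<Oplus>\<^bsub>B\<^esub>w\<in>?W2. label_tensor ?a w) \<in> C" .
    have "elem_sym R A n (count m j) (a j) \<otimes>\<^bsub>B\<^esub> orbit_sum a ?m' = (\<Oplus>\<^bsub>B\<^esub>w\<in>?W. label_tensor ?a w)"
      by (rule elem_sym_times_orbit_sum(1)[OF a(1) a(1)])
    also have "?W = ?W1 \<union> ?W2" by blast
    also have "(\<Oplus>\<^bsub>B\<^esub>w\<in>?W1 \<union> ?W2. label_tensor ?a w)
        = (\<Oplus>\<^bsub>B\<^esub>w\<in>?W1. label_tensor ?a w) \<oplus>\<^bsub>B\<^esub> (\<Oplus>\<^bsub>B\<^esub>w\<in>?W2. label_tensor ?a w)"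
      using W lt by (intro B.finsum_Un_disjoint) auto
    also have "(\<Oplus>\<^bsub>B\<^esub>w\<in>?W1. label_tensor ?a w) = orbit_sum a m"
      by (rule refinements_without_overlap[where a = a, OF label(3) a])
    finally have "orbit_sum a m = elem_sym R A n (count m j) (a j) \<otimes>\<^bsub>B\<^esub> orbit_sum a ?m'
        \<oplus>\<^bsub>B\<^esub> \<ominus>\<^bsub>B\<^esub> (\<Oplus>\<^bsub>B\<^esub>w\<in>?W2. label_tensor ?a w)"
      using a W2 CB by (simp add: B.a_assoc B.r_neg subset_iff)
    moreover have "\<ominus>\<^bsub>B\<^esub> (\<Oplus>\<^bsub>B\<^esub>w\<in>?W2. label_tensor ?a w) = (\<ominus> \<one>) \<odot>\<^bsub>B\<^esub> (\<Oplus>\<^bsub>B\<^esub>w\<in>?W2. label_tensor ?a w)"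
      using W2 CB by (simp add: B.smult_l_minus subset_iff)
    ultimately show ?thesis
      using add[OF prod smult[OF _ W2, of "\<ominus> \<one>"]] by simp
  qed
qed

text \<open>The coordinates of a symmetric tensor are constant on orbits of self-maps, so it is a combination
  of orbit sums for the family \<open>\<theta>\<close>.\<close>

lemma symmetric_generated:
  assumes z: "symmetric_tensor z"
  shows "z \<in> C"
proof -
  have zB: "z \<in> carrier B" using z by (simp add: symmetric_tensor_def)
  \<comment> \<open>The label \<open>0\<close> must have the value \<open>1\<close>; self-maps of \<open>{1..n}\<close> only use the labels with basis values.\<close>
  define a where "a l = (if l \<in> {1..n} then \<theta> l else \<one>\<^bsub>A\<^esub>)" for l
  have a: "a l \<in> carrier A" "a 0 = \<one>\<^bsub>A\<^esub>" for l
    by (auto simp: a_def)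
  have JL: "J \<subseteq> labellings" by auto
  have sat: "v \<in> J" if "u \<in> J" "v \<in> labellings" "mset_of v = mset_of u" for u v
  proof (rule PiE_I)
    fix i assume "i \<in> {1..n}"
    then have "v i \<in># mset_of v" by simp
    then have "v i \<in># mset_of u" unfolding that(3) .
    then obtain l where "l \<in> {1..n}" "v i = u l" by auto
    then show "v i \<in> {1..n}" using J_mem[OF that(1)] by simp
  qed (use that(2) in \<open>auto simp: PiE_def extensional_def\<close>)
  have Ea: "E f = label_tensor a f" if "f \<in> J" for f
  proof -
    have "(\<lambda>i\<in>{1..n}. \<theta> (f i)) = (\<lambda>i\<in>{1..n}. a (f i))"
      by (rule restrict_ext) (use J_mem[OF that] in \<open>simp add: a_def\<close>)
    then show ?thesis by (simp only: E_pure[OF that] label_tensor_def)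
  qed
  have "z = (\<Oplus>\<^bsub>B\<^esub>f\<in>J. \<kappa> f z \<odot>\<^bsub>B\<^esub> E f)"
    by (rule B_expand[OF zB])
  also have "\<dots> = (\<Oplus>\<^bsub>B\<^esub>m\<in>mset_of ` J. \<Oplus>\<^bsub>B\<^esub>f\<in>arrangements m. \<kappa> f z \<odot>\<^bsub>B\<^esub> E f)"
    by (rule sum_over_saturated[OF finite_J JL sat]) (use zB in auto)
  also have "\<dots> \<in> C"
  proof (rule generated_sum)
    fix m assume "m \<in> mset_of ` J"
    then obtain g where g: "g \<in> J" "m = mset_of g" by blast
    have arr: "f \<in> J" "\<kappa> f z = \<kappa> g z" if "f \<in> arrangements m" for f
    proof -
      have "f \<in> labellings" "mset_of f = mset_of g"
        using that g(2) by (auto simp: arrangements_def)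
      then show "f \<in> J" using sat[OF g(1)] by blast
      then show "\<kappa> f z = \<kappa> g z"
        using kappa_symmetric[OF z _ g(1)] \<open>mset_of f = mset_of g\<close> by blast
    qed
    have "(\<Oplus>\<^bsub>B\<^esub>f\<in>arrangements m. \<kappa> f z \<odot>\<^bsub>B\<^esub> E f) = (\<Oplus>\<^bsub>B\<^esub>f\<in>arrangements m. \<kappa> g z \<odot>\<^bsub>B\<^esub> label_tensor a f)"
      using arr Ea a kappa_closed[OF g(1) zB] by (intro B.finsum_cong') auto
    also have "\<dots> = \<kappa> g z \<odot>\<^bsub>B\<^esub> orbit_sum a m"
      unfolding orbit_sum_def using a kappa_closed[OF g(1) zB]
      by (intro B.finsum_smult_ldistr[symmetric]) auto
    also have "\<dots> \<in> C"
      using kappa_closed[OF g(1) zB]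
      by (intro smult orbit_sum_generated a)
    finally show "(\<Oplus>\<^bsub>B\<^esub>f\<in>arrangements m. \<kappa> f z \<odot>\<^bsub>B\<^esub> E f) \<in> C" .
  qed simp
  finally show ?thesis .
qed

end

section \<open>Closure data and square roots\<close>

abbreviation AI where "AI \<equiv> alt_invariants R A n"
abbreviation \<tau> :: "nat \<Rightarrow> nat" where "\<tau> \<equiv> transpose 1 2"
text \<open>Odd permutations all act in the same way on tensors invariant under even ones; the
  transposition of \<open>1\<close> and \<open>2\<close> serves as representative.\<close>

abbreviation conjugate where "conjugate X \<equiv> perm_act \<tau> X"

lemma AI_simps:
  "mult AI = mult B" "add AI = add B" "one AI = one B" "smult AI = smult B"
  by (simp_all add: alt_invariants_def)

lemma carrier_AI:
  "X \<in> carrier AI \<longleftrightarrow> X \<in> carrier B \<and> (\<forall>\<sigma>. \<sigma> permutes {1..n} \<longrightarrow> evenperm \<sigma> \<longrightarrow> perm_act \<sigma> X = X)"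
  by (auto simp: alt_invariants_def alt_group_carrier)

lemma AI_B: "X \<in> carrier AI \<Longrightarrow> X \<in> carrier B"
  by (simp add: carrier_AI)

lemma act_one: "\<sigma> permutes {1..n} \<Longrightarrow> perm_act \<sigma> \<one>\<^bsub>B\<^esub> = \<one>\<^bsub>B\<^esub>"
proof -
  assume \<sigma>: "\<sigma> permutes {1..n}"
  have e: "place {} \<one>\<^bsub>A\<^esub> = (\<lambda>i\<in>{1..n}. \<one>\<^bsub>A\<^esub>)" by simp
  have "perm_act \<sigma> (pure (place {} \<one>\<^bsub>A\<^esub>)) = pure (place {} \<one>\<^bsub>A\<^esub>)"
    using act_pure[OF \<sigma> place_T[of "\<one>\<^bsub>A\<^esub>" "{}"]] place_comp[OF \<sigma>, of "{}" "\<one>\<^bsub>A\<^esub>"]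
    by (simp only: A.one_closed image_empty)
  then show ?thesis unfolding e pure_one .
qed

lemma AI_closed:
  "X \<in> carrier AI \<Longrightarrow> Y \<in> carrier AI \<Longrightarrow> X \<otimes>\<^bsub>B\<^esub> Y \<in> carrier AI"
  "X \<in> carrier AI \<Longrightarrow> Y \<in> carrier AI \<Longrightarrow> X \<oplus>\<^bsub>B\<^esub> Y \<in> carrier AI"
  "r \<in> carrier R \<Longrightarrow> X \<in> carrier AI \<Longrightarrow> r \<odot>\<^bsub>B\<^esub> X \<in> carrier AI"
  "\<one>\<^bsub>B\<^esub> \<in> carrier AI"
  by (auto simp: carrier_AI act_mult act_add act_smult act_one)

lemma symmetric_closed:
  "symmetric_tensor X \<Longrightarrow> symmetric_tensor Y \<Longrightarrow> symmetric_tensor (X \<otimes>\<^bsub>B\<^esub> Y)"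
  "symmetric_tensor X \<Longrightarrow> symmetric_tensor Y \<Longrightarrow> symmetric_tensor (X \<oplus>\<^bsub>B\<^esub> Y)"
  "r \<in> carrier R \<Longrightarrow> symmetric_tensor X \<Longrightarrow> symmetric_tensor (r \<odot>\<^bsub>B\<^esub> X)"
  "symmetric_tensor \<one>\<^bsub>B\<^esub>"
  by (auto simp: symmetric_tensor_def act_mult act_add act_smult act_one)

lemma symmetric_AI: "symmetric_tensor X \<Longrightarrow> X \<in> carrier AI"
  by (auto simp: symmetric_tensor_def carrier_AI)

lemma symmetric_B: "symmetric_tensor X \<Longrightarrow> X \<in> carrier B"
  by (simp add: symmetric_tensor_def)

lemma delta_AI: "\<delta> \<in> carrier AI"
  using antisymmetric_delta by (auto simp: carrier_AI antisymmetric_tensor_def B.sign_act)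

lemma Phi_ops:
  assumes "symmetric_tensor X" "symmetric_tensor Y"
  shows "\<Phi> (X \<otimes>\<^bsub>B\<^esub> Y) = \<Phi> X \<otimes> \<Phi> Y" and "\<Phi> (X \<oplus>\<^bsub>B\<^esub> Y) = \<Phi> X \<oplus> \<Phi> Y"
    and "r \<in> carrier R \<Longrightarrow> \<Phi> (r \<odot>\<^bsub>B\<^esub> X) = r \<otimes> \<Phi> X"
proof -
  note X = symmetric_acts[OF assms(1)] and Y = symmetric_acts[OF assms(2)]
  show "\<Phi> (X \<otimes>\<^bsub>B\<^esub> Y) = \<Phi> X \<otimes> \<Phi> Y"
    by (rule acts_unique[OF acts_mult[OF X Y]])
  show "\<Phi> (X \<oplus>\<^bsub>B\<^esub> Y) = \<Phi> X \<oplus> \<Phi> Y"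
    by (rule acts_unique[OF acts_add[OF X Y]])
  show "\<Phi> (r \<odot>\<^bsub>B\<^esub> X) = r \<otimes> \<Phi> X" if "r \<in> carrier R"
    by (rule acts_unique[OF acts_smult[OF X that]])
qed

lemma Phi_one: "\<Phi> \<one>\<^bsub>B\<^esub> = \<one>"
  by (rule acts_unique[OF acts_one])

text \<open>Agreement with \<open>\<Phi>\<close> is stable under the algebra operations and holds for the \<open>e\<^sub>k(a)\<close>, which
  generate.\<close>

lemma closure_datum_symmetric:
  assumes \<phi>: "\<phi> \<in> alt_closure_data R A n \<theta>" and z: "symmetric_tensor z"
  shows "\<phi> z = \<Phi> z"
proof -
  have hom: "\<phi> \<in> ring_hom AI R" and lin: "\<And>r x. r \<in> carrier R \<Longrightarrow> x \<in> carrier AI \<Longrightarrow> \<phi> (r \<odot>\<^bsub>B\<^esub> x) = r \<otimes> \<phi> x"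
    and elem: "\<And>a k. a \<in> carrier A \<Longrightarrow> k \<in> {1..n} \<Longrightarrow> \<phi> (elem_sym R A n k a) = char_coeff R A n \<theta> k a"
    using \<phi> by (auto simp: alt_closure_data_def algebra_homs_to_base_def AI_simps)
  note h = ring_hom_mult[OF hom, unfolded AI_simps] ring_hom_add[OF hom, unfolded AI_simps]
    ring_hom_one[OF hom, unfolded AI_simps]
  let ?C = "{z. symmetric_tensor z \<and> \<phi> z = \<Phi> z}"
  have "z \<in> ?C"
  proof (rule symmetric_generated)
    show "?C \<subseteq> carrier B" by (auto simp: symmetric_tensor_def)
    show "\<one>\<^bsub>B\<^esub> \<in> ?C" using h(3) by (simp add: symmetric_closed Phi_one)
    fix x y assume "x \<in> ?C" "y \<in> ?C"
    then show "x \<oplus>\<^bsub>B\<^esub> y \<in> ?C" "x \<otimes>\<^bsub>B\<^esub> y \<in> ?C"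
      by (simp_all add: symmetric_closed h symmetric_AI Phi_ops)
  next
    fix r x assume "r \<in> carrier R" "x \<in> ?C"
    then show "r \<odot>\<^bsub>B\<^esub> x \<in> ?C"
      by (simp add: symmetric_closed lin symmetric_AI Phi_ops(3)[of x x])
  next
    fix k b assume "k \<in> {1..n}" "b \<in> carrier A"
    then show "elem_sym R A n k b \<in> ?C"
      by (simp only: mem_Collect_eq symmetric_elem_sym elem Phi_elem_sym simp_thms)
  qed (rule z)
  then show ?thesis by simp
qed

lemma two_double: "x \<in> carrier R \<Longrightarrow> two R \<otimes> x = x \<oplus> x"
  by (simp add: two_def R.l_distr)

lemma two_closed: "two R \<in> carrier R"
  by (simp add: two_def)

lemma two_square: "x \<in> carrier R \<Longrightarrow> two R [^] (2::nat) \<otimes> x = (x \<oplus> x) \<oplus> (x \<oplus> x)"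
  using two_closed by (simp add: numeral_2_eq_2 two_double R.l_distr)

lemma two_inj:
  assumes "x \<in> carrier R" "y \<in> carrier R" "two R \<otimes> x = two R \<otimes> y"
  shows "x = y"
proof -
  have "two R \<otimes> (x \<ominus> y) = \<zero>"
    using assms two_closed by (simp add: a_minus_def R.r_distr R.r_minus R.r_neg)
  then have "x \<ominus> y = \<zero>"
    using two_regular assms by (simp add: non_zero_divisor_def)
  then show ?thesis by (rule minus_zeroD[OF _ assms(1,2)])
qed

lemma delta_cancel:
  assumes "r \<in> carrier R" "s \<in> carrier R" "r \<odot>\<^bsub>B\<^esub> \<delta> = s \<odot>\<^bsub>B\<^esub> \<delta>"
  shows "r = s"
proof -
  have k: "\<kappa> j0 (x \<odot>\<^bsub>B\<^esub> \<delta>) = x" if "x \<in> carrier R" for x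
    unfolding kappa_smult[OF j0_J delta_closed that] kappa_j0_delta using that by (rule R.r_one)
  have "r = \<kappa> j0 (r \<odot>\<^bsub>B\<^esub> \<delta>)"
    by (rule k[OF assms(1), symmetric])
  also have "\<dots> = s"
    unfolding assms(3) by (rule k[OF assms(2)])
  finally show ?thesis .
qed

context
  assumes n2: "2 \<le> n"
begin

lemma tau_permutes: "\<tau> permutes {1..n}"
  using n2 by (intro permutes_swap_id) auto

lemma tau_odd: "\<not> evenperm \<tau>"
  by (simp add: evenperm_swap)

lemma evenperm_comp_permutes:
  "p permutes {1..n} \<Longrightarrow> q permutes {1..n} \<Longrightarrow> evenperm (p \<circ> q) \<longleftrightarrow> (evenperm p \<longleftrightarrow> evenperm q)"
  by (rule sign_compose_permutes) auto

lemma odd_act: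
  assumes X: "X \<in> carrier AI" and \<sigma>: "\<sigma> permutes {1..n}" "\<not> evenperm \<sigma>"
  shows "perm_act \<sigma> X = conjugate X"
proof -
  have e: "evenperm (\<tau> \<circ> \<sigma>)" "\<tau> \<circ> \<sigma> permutes {1..n}"
    using evenperm_comp_permutes[OF tau_permutes \<sigma>(1)] tau_odd \<sigma>(2)
      permutes_compose[OF \<sigma>(1) tau_permutes] by auto
  \<comment> \<open>As \<open>\<tau> \<circ> \<sigma>\<close> is even, it fixes \<open>X\<close>, and only \<open>\<tau>\<close> remains.\<close>
  have "\<tau> \<circ> (\<tau> \<circ> \<sigma>) = \<sigma>"
    by (simp add: comp_assoc[symmetric])
  then have "perm_act \<sigma> X = perm_act \<tau> (perm_act (\<tau> \<circ> \<sigma>) X)"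
    using act_comp[OF tau_permutes e(2) AI_B[OF X]] by simp
  also have "perm_act (\<tau> \<circ> \<sigma>) X = X"
    using X e by (simp add: carrier_AI)
  finally show ?thesis .
qed

lemma conjugate_closed: "X \<in> carrier B \<Longrightarrow> conjugate X \<in> carrier B"
  by (rule act_closed[OF tau_permutes])

lemma act_conjugate:
  assumes X: "X \<in> carrier AI" and \<sigma>: "\<sigma> permutes {1..n}"
  shows "perm_act \<sigma> (conjugate X) = (if evenperm \<sigma> then conjugate X else X)"
proof -
  have "perm_act \<sigma> (conjugate X) = perm_act (\<sigma> \<circ> \<tau>) X"
    by (rule act_comp[OF \<sigma> tau_permutes AI_B[OF X]])
  also have "\<dots> = (if evenperm \<sigma> then conjugate X else X)"
    using odd_act[OF X permutes_compose[OF tau_permutes \<sigma>]] X tau_odd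
      permutes_compose[OF tau_permutes \<sigma>] evenperm_comp_permutes[OF \<sigma> tau_permutes]
    by (auto simp: carrier_AI)
  finally show ?thesis .
qed

lemma act_AI:
  assumes X: "X \<in> carrier AI" and \<sigma>: "\<sigma> permutes {1..n}"
  shows "perm_act \<sigma> X = (if evenperm \<sigma> then X else conjugate X)"
  using odd_act[OF X \<sigma>] X \<sigma> by (auto simp: carrier_AI)

lemma symmetric_sum:
  assumes X: "X \<in> carrier AI"
  shows "symmetric_tensor (X \<oplus>\<^bsub>B\<^esub> conjugate X)"
  unfolding symmetric_tensor_def
  using AI_B[OF X] conjugate_closed[OF AI_B[OF X]] act_AI[OF X] act_conjugate[OF X]
  by (auto simp: act_add B.a_comm)

lemma symmetric_norm:
  assumes X: "X \<in> carrier AI"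
  shows "symmetric_tensor (X \<otimes>\<^bsub>B\<^esub> conjugate X)"
  unfolding symmetric_tensor_def
  using AI_B[OF X] conjugate_closed[OF AI_B[OF X]] act_AI[OF X] act_conjugate[OF X]
  by (auto simp: act_mult B.m_comm)

lemma antisymmetric_diff:
  assumes X: "X \<in> carrier AI"
  shows "antisymmetric_tensor (X \<ominus>\<^bsub>B\<^esub> conjugate X)"
  unfolding antisymmetric_tensor_def
  using AI_B[OF X] conjugate_closed[OF AI_B[OF X]] act_AI[OF X] act_conjugate[OF X]
  by (auto simp: act_add act_minus a_minus_def B.sign_act B.minus_add B.a_comm)

text \<open>An invariant \<open>X\<close> of the even permutations satisfies \<open>2 X = (X + X') + (X - X')\<close> with \<open>X'\<close> its
  conjugate. The first summand acts on \<open>\<delta>\<close> by the trace part, and the second is the delta part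
  times \<open>\<delta>\<close>. These two scalars describe the values of closure data.\<close>

definition trace_part where "trace_part X = \<Phi> (X \<oplus>\<^bsub>B\<^esub> conjugate X)"
definition delta_part where "delta_part X = \<kappa> j0 (X \<ominus>\<^bsub>B\<^esub> conjugate X)"

lemma parts_closed [simp]:
  assumes "X \<in> carrier AI"
  shows "trace_part X \<in> carrier R" "delta_part X \<in> carrier R"
  using AI_B[OF assms] conjugate_closed[OF AI_B[OF assms]]
  unfolding trace_part_def delta_part_def by (auto intro!: Phi_closed kappa_closed j0_J simp del: restrict_apply)

lemma delta_part:
  "X \<in> carrier AI \<Longrightarrow> X \<ominus>\<^bsub>B\<^esub> conjugate X = delta_part X \<odot>\<^bsub>B\<^esub> \<delta>"
  unfolding delta_part_def by (rule antisymmetric_multiple_delta[OF antisymmetric_diff])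

lemma trace_part:
  "X \<in> carrier AI \<Longrightarrow> acts_by (X \<oplus>\<^bsub>B\<^esub> conjugate X) (trace_part X)"
  unfolding trace_part_def by (rule symmetric_acts[OF symmetric_sum])

lemma delta_parts_mult:
  assumes X: "X \<in> carrier AI" and Y: "Y \<in> carrier AI"
  shows "acts_by ((X \<ominus>\<^bsub>B\<^esub> conjugate X) \<otimes>\<^bsub>B\<^esub> (Y \<ominus>\<^bsub>B\<^esub> conjugate Y))
    (delta_part X \<otimes> delta_part Y \<otimes> discriminant R A n \<theta>)"
  unfolding delta_part[OF X] delta_part[OF Y]
  using X Y acts_smult[OF acts_delta_square, of "delta_part X \<otimes> delta_part Y"]
  by (simp add: B_smult_mult_smult)

lemma closure_datum_double:
  assumes \<phi>: "\<phi> \<in> alt_closure_data R A n \<theta>" and X: "X \<in> carrier AI"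
  shows "two R \<otimes> \<phi> X = trace_part X \<oplus> delta_part X \<otimes> \<phi> \<delta>"
proof -
  have hom: "\<phi> \<in> ring_hom AI R" and lin: "\<And>r x. r \<in> carrier R \<Longrightarrow> x \<in> carrier AI \<Longrightarrow> \<phi> (r \<odot>\<^bsub>B\<^esub> x) = r \<otimes> \<phi> x"
    using \<phi> by (auto simp: alt_closure_data_def algebra_homs_to_base_def AI_simps)
  note h = ring_hom_add[OF hom, unfolded AI_simps]
  have c: "X \<in> carrier B" "conjugate X \<in> carrier B"
    using AI_B[OF X] conjugate_closed[OF AI_B[OF X]] by auto
  have sum: "X \<oplus>\<^bsub>B\<^esub> conjugate X \<in> carrier AI"
    by (rule symmetric_AI[OF symmetric_sum[OF X]])
  have diff: "delta_part X \<odot>\<^bsub>B\<^esub> \<delta> \<in> carrier AI"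
    using X by (intro AI_closed delta_AI parts_closed)
  have "X \<oplus>\<^bsub>B\<^esub> X = (X \<oplus>\<^bsub>B\<^esub> conjugate X) \<oplus>\<^bsub>B\<^esub> (X \<ominus>\<^bsub>B\<^esub> conjugate X)"
    using c B.r_neg[OF c(2)] by (simp add: a_minus_def B.a_ac B.r_neg1)
  then have "\<phi> (X \<oplus>\<^bsub>B\<^esub> X) = \<phi> (X \<oplus>\<^bsub>B\<^esub> conjugate X) \<oplus> \<phi> (delta_part X \<odot>\<^bsub>B\<^esub> \<delta>)"
    using h[OF sum diff] delta_part[OF X] by simp
  moreover have "\<phi> X \<in> carrier R"
    using ring_hom_closed[OF hom X] .
  ultimately show ?thesis
    using h[OF X X] X closure_datum_symmetric[OF \<phi> symmetric_sum[OF X]] lin[OF _ delta_AI]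
    by (simp add: two_double trace_part_def)
qed

lemma parts_delta: "trace_part \<delta> = \<zero>" "delta_part \<delta> = two R"
proof -
  have "perm_act \<tau> \<delta> = [sign \<tau>] \<cdot>\<^bsub>B\<^esub> \<delta>"
    using antisymmetric_delta tau_permutes by (simp add: antisymmetric_tensor_def)
  then have c: "conjugate \<delta> = \<ominus>\<^bsub>B\<^esub> \<delta>"
    using tau_odd by (simp add: B.sign_act)
  have "acts_by (\<delta> \<oplus>\<^bsub>B\<^esub> conjugate \<delta>) \<zero>"
    using acts_zero by (simp add: c B.r_neg)
  then show "trace_part \<delta> = \<zero>"
    unfolding trace_part_def by (rule acts_unique)
  have "delta_part \<delta> = \<kappa> j0 (\<delta> \<oplus>\<^bsub>B\<^esub> \<delta>)"
    unfolding delta_part_def c a_minus_def by (simp add: B.minus_minus del: restrict_apply)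
  also have "\<dots> = two R"
    by (simp only: kappa_add[OF j0_J] delta_closed kappa_j0_delta two_def)
  finally show "delta_part \<delta> = two R" .
qed

lemma parts_symmetric:
  assumes z: "symmetric_tensor z"
  shows "trace_part z = two R \<otimes> \<Phi> z" "delta_part z = \<zero>"
proof -
  have c: "conjugate z = z" "z \<in> carrier B"
    using z tau_permutes by (auto simp: symmetric_tensor_def)
  show "trace_part z = two R \<otimes> \<Phi> z"
    using Phi_ops(2)[OF z z] c by (simp add: trace_part_def two_double)
  show "delta_part z = \<zero>"
    unfolding delta_part_def c(1) a_minus_def using B.r_neg[OF c(2)] kappa_zero[OF j0_J] by (simp only:)
qed

lemma parts_ops:
  assumes X: "X \<in> carrier AI" and Y: "Y \<in> carrier AI"
  shows "trace_part (X \<oplus>\<^bsub>B\<^esub> Y) = trace_part X \<oplus> trace_part Y"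
    and "delta_part (X \<oplus>\<^bsub>B\<^esub> Y) = delta_part X \<oplus> delta_part Y"
    and "r \<in> carrier R \<Longrightarrow> trace_part (r \<odot>\<^bsub>B\<^esub> X) = r \<otimes> trace_part X"
    and "r \<in> carrier R \<Longrightarrow> delta_part (r \<odot>\<^bsub>B\<^esub> X) = r \<otimes> delta_part X"
proof -
  note tp = tau_permutes
  have c: "X \<in> carrier B" "conjugate X \<in> carrier B" "Y \<in> carrier B" "conjugate Y \<in> carrier B"
    using AI_B X Y conjugate_closed by auto
  have "X \<oplus>\<^bsub>B\<^esub> Y \<oplus>\<^bsub>B\<^esub> conjugate (X \<oplus>\<^bsub>B\<^esub> Y)
      = (X \<oplus>\<^bsub>B\<^esub> conjugate X) \<oplus>\<^bsub>B\<^esub> (Y \<oplus>\<^bsub>B\<^esub> conjugate Y)"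
    using c by (simp add: act_add[OF tp] B.a_ac)
  then show "trace_part (X \<oplus>\<^bsub>B\<^esub> Y) = trace_part X \<oplus> trace_part Y"
    unfolding trace_part_def using Phi_ops(2)[OF symmetric_sum[OF X] symmetric_sum[OF Y]] by simp
  have "X \<oplus>\<^bsub>B\<^esub> Y \<ominus>\<^bsub>B\<^esub> conjugate (X \<oplus>\<^bsub>B\<^esub> Y)
      = (X \<ominus>\<^bsub>B\<^esub> conjugate X) \<oplus>\<^bsub>B\<^esub> (Y \<ominus>\<^bsub>B\<^esub> conjugate Y)"
    using c by (simp add: act_add[OF tp] a_minus_def B.minus_add B.a_ac)
  then show "delta_part (X \<oplus>\<^bsub>B\<^esub> Y) = delta_part X \<oplus> delta_part Y"
    unfolding delta_part_def using kappa_add[OF j0_J] c by (simp del: restrict_apply)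
  assume r: "r \<in> carrier R"
  have "r \<odot>\<^bsub>B\<^esub> X \<oplus>\<^bsub>B\<^esub> conjugate (r \<odot>\<^bsub>B\<^esub> X) = r \<odot>\<^bsub>B\<^esub> (X \<oplus>\<^bsub>B\<^esub> conjugate X)"
    using c r by (simp add: act_smult[OF tp] B.smult_r_distr)
  then show "trace_part (r \<odot>\<^bsub>B\<^esub> X) = r \<otimes> trace_part X"
    unfolding trace_part_def
    using Phi_ops(3)[OF symmetric_sum[OF X] symmetric_sum[OF X] r] by simp
  have "r \<odot>\<^bsub>B\<^esub> X \<ominus>\<^bsub>B\<^esub> conjugate (r \<odot>\<^bsub>B\<^esub> X) = r \<odot>\<^bsub>B\<^esub> (X \<ominus>\<^bsub>B\<^esub> conjugate X)"
    using c r by (simp add: act_smult[OF tp] B.smult_r_distr a_minus_def B.smult_r_minus)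
  then show "delta_part (r \<odot>\<^bsub>B\<^esub> X) = r \<otimes> delta_part X"
    unfolding delta_part_def using kappa_smult[OF j0_J _ r] c by (simp del: restrict_apply)
qed

text \<open>From \<open>(X + X') (Y + Y') + (X - X') (Y - Y') = 2 (X Y + X' Y')\<close>.\<close>

lemma trace_part_mult:
  assumes X: "X \<in> carrier AI" and Y: "Y \<in> carrier AI"
  shows "trace_part X \<otimes> trace_part Y \<oplus> delta_part X \<otimes> delta_part Y \<otimes> discriminant R A n \<theta>
    = two R \<otimes> trace_part (X \<otimes>\<^bsub>B\<^esub> Y)"
proof -
  have c: "X \<in> carrier B" "conjugate X \<in> carrier B" "Y \<in> carrier B" "conjugate Y \<in> carrier B"
    using AI_B X Y conjugate_closed by auto
  have XY: "X \<otimes>\<^bsub>B\<^esub> Y \<in> carrier AI" by (rule AI_closed(1)[OF X Y])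
  have cXY: "conjugate (X \<otimes>\<^bsub>B\<^esub> Y) = conjugate X \<otimes>\<^bsub>B\<^esub> conjugate Y"
    using c by (simp add: act_mult[OF tau_permutes])
  let ?S = "X \<otimes>\<^bsub>B\<^esub> Y \<oplus>\<^bsub>B\<^esub> conjugate (X \<otimes>\<^bsub>B\<^esub> Y)"
  have "(X \<oplus>\<^bsub>B\<^esub> conjugate X) \<otimes>\<^bsub>B\<^esub> (Y \<oplus>\<^bsub>B\<^esub> conjugate Y)
      \<oplus>\<^bsub>B\<^esub> (X \<ominus>\<^bsub>B\<^esub> conjugate X) \<otimes>\<^bsub>B\<^esub> (Y \<ominus>\<^bsub>B\<^esub> conjugate Y) = ?S \<oplus>\<^bsub>B\<^esub> ?S"
    unfolding cXY using c by algebra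
  then have "acts_by (?S \<oplus>\<^bsub>B\<^esub> ?S) (trace_part X \<otimes> trace_part Y
      \<oplus> delta_part X \<otimes> delta_part Y \<otimes> discriminant R A n \<theta>)"
    using acts_add[OF acts_mult[OF trace_part[OF X] trace_part[OF Y]] delta_parts_mult[OF X Y]] by simp
  moreover have "acts_by (?S \<oplus>\<^bsub>B\<^esub> ?S) (trace_part (X \<otimes>\<^bsub>B\<^esub> Y) \<oplus> trace_part (X \<otimes>\<^bsub>B\<^esub> Y))"
    by (rule acts_add[OF trace_part[OF XY] trace_part[OF XY]])
  ultimately show ?thesis
    using acts_unique XY by (metis parts_closed(1) two_double)
qed

text \<open>From \<open>(X + X') (Y - Y') + (Y + Y') (X - X') = 2 (X Y - X' Y')\<close>.\<close>

lemma delta_part_mult: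
  assumes X: "X \<in> carrier AI" and Y: "Y \<in> carrier AI"
  shows "trace_part X \<otimes> delta_part Y \<oplus> delta_part X \<otimes> trace_part Y
    = two R \<otimes> delta_part (X \<otimes>\<^bsub>B\<^esub> Y)"
proof (rule delta_cancel)
  have c: "X \<in> carrier B" "conjugate X \<in> carrier B" "Y \<in> carrier B" "conjugate Y \<in> carrier B"
    using AI_B X Y conjugate_closed by auto
  have XY: "X \<otimes>\<^bsub>B\<^esub> Y \<in> carrier AI" by (rule AI_closed(1)[OF X Y])
  have cXY: "conjugate (X \<otimes>\<^bsub>B\<^esub> Y) = conjugate X \<otimes>\<^bsub>B\<^esub> conjugate Y"
    using c by (simp add: act_mult[OF tau_permutes])
  let ?D = "X \<otimes>\<^bsub>B\<^esub> Y \<ominus>\<^bsub>B\<^esub> conjugate (X \<otimes>\<^bsub>B\<^esub> Y)"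
  have tr: "(U \<oplus>\<^bsub>B\<^esub> conjugate U) \<otimes>\<^bsub>B\<^esub> (V \<ominus>\<^bsub>B\<^esub> conjugate V) = (trace_part U \<otimes> delta_part V) \<odot>\<^bsub>B\<^esub> \<delta>"
    if "U \<in> carrier AI" "V \<in> carrier AI" for U V
  proof -
    have "(U \<oplus>\<^bsub>B\<^esub> conjugate U) \<otimes>\<^bsub>B\<^esub> (delta_part V \<odot>\<^bsub>B\<^esub> \<delta>)
        = delta_part V \<odot>\<^bsub>B\<^esub> ((U \<oplus>\<^bsub>B\<^esub> conjugate U) \<otimes>\<^bsub>B\<^esub> \<delta>)"
      using B_smult_mult_smult[of \<one> "delta_part V" "U \<oplus>\<^bsub>B\<^esub> conjugate U" \<delta>]
        acts_closed(1)[OF trace_part[OF that(1)]] that by simp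
    also have "\<dots> = (trace_part U \<otimes> delta_part V) \<odot>\<^bsub>B\<^esub> \<delta>"
      using trace_part[OF that(1)] that by (simp add: acts_by_def B.smult_assoc1[symmetric] R.m_comm)
    finally show ?thesis using delta_part[OF that(2)] by simp
  qed
  have "(trace_part X \<otimes> delta_part Y \<oplus> delta_part X \<otimes> trace_part Y) \<odot>\<^bsub>B\<^esub> \<delta>
      = (trace_part X \<otimes> delta_part Y) \<odot>\<^bsub>B\<^esub> \<delta> \<oplus>\<^bsub>B\<^esub> (trace_part Y \<otimes> delta_part X) \<odot>\<^bsub>B\<^esub> \<delta>"
    using X Y by (simp add: B.smult_l_distr R.m_comm)
  also have "\<dots> = (X \<oplus>\<^bsub>B\<^esub> conjugate X) \<otimes>\<^bsub>B\<^esub> (Y \<ominus>\<^bsub>B\<^esub> conjugate Y)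
      \<oplus>\<^bsub>B\<^esub> (Y \<oplus>\<^bsub>B\<^esub> conjugate Y) \<otimes>\<^bsub>B\<^esub> (X \<ominus>\<^bsub>B\<^esub> conjugate X)"
    unfolding tr[OF X Y] tr[OF Y X] ..
  also have "\<dots> = ?D \<oplus>\<^bsub>B\<^esub> ?D"
    unfolding cXY using c by algebra
  also have "\<dots> = (two R \<otimes> delta_part (X \<otimes>\<^bsub>B\<^esub> Y)) \<odot>\<^bsub>B\<^esub> \<delta>"
    unfolding delta_part[OF XY] using XY by (simp add: two_double B.smult_l_distr)
  finally show "(trace_part X \<otimes> delta_part Y \<oplus> delta_part X \<otimes> trace_part Y) \<odot>\<^bsub>B\<^esub> \<delta>
      = (two R \<otimes> delta_part (X \<otimes>\<^bsub>B\<^esub> Y)) \<odot>\<^bsub>B\<^esub> \<delta>" .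
qed (use X Y AI_closed(1)[OF X Y] two_closed in auto)

text \<open>From \<open>(X + X')\<^sup>2 - (X - X')\<^sup>2 = 4 X X'\<close>, where \<open>X X'\<close> is symmetric.\<close>

lemma norm_identity:
  assumes X: "X \<in> carrier AI"
  shows "trace_part X \<otimes> trace_part X \<ominus> delta_part X \<otimes> delta_part X \<otimes> discriminant R A n \<theta>
    = two R [^] (2::nat) \<otimes> \<Phi> (X \<otimes>\<^bsub>B\<^esub> conjugate X)"
proof -
  have c: "X \<in> carrier B" "conjugate X \<in> carrier B"
    using AI_B X conjugate_closed by auto
  let ?N = "X \<otimes>\<^bsub>B\<^esub> conjugate X"
  have N: "acts_by ?N (\<Phi> ?N)"
    by (rule symmetric_acts[OF symmetric_norm[OF X]])
  have Nc: "\<Phi> ?N \<in> carrier R" using acts_closed(2)[OF N] .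
  have "(X \<oplus>\<^bsub>B\<^esub> conjugate X) \<otimes>\<^bsub>B\<^esub> (X \<oplus>\<^bsub>B\<^esub> conjugate X)
      \<oplus>\<^bsub>B\<^esub> \<ominus>\<^bsub>B\<^esub> ((X \<ominus>\<^bsub>B\<^esub> conjugate X) \<otimes>\<^bsub>B\<^esub> (X \<ominus>\<^bsub>B\<^esub> conjugate X))
      = (?N \<oplus>\<^bsub>B\<^esub> ?N) \<oplus>\<^bsub>B\<^esub> (?N \<oplus>\<^bsub>B\<^esub> ?N)"
    using c by algebra
  then have "acts_by ((?N \<oplus>\<^bsub>B\<^esub> ?N) \<oplus>\<^bsub>B\<^esub> (?N \<oplus>\<^bsub>B\<^esub> ?N))
      (trace_part X \<otimes> trace_part X \<ominus> delta_part X \<otimes> delta_part X \<otimes> discriminant R A n \<theta>)"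
    using acts_add[OF acts_mult[OF trace_part[OF X] trace_part[OF X]] acts_minus[OF delta_parts_mult[OF X X]]]
    by (simp add: a_minus_def)
  moreover have "acts_by ((?N \<oplus>\<^bsub>B\<^esub> ?N) \<oplus>\<^bsub>B\<^esub> (?N \<oplus>\<^bsub>B\<^esub> ?N)) ((\<Phi> ?N \<oplus> \<Phi> ?N) \<oplus> (\<Phi> ?N \<oplus> \<Phi> ?N))"
    by (intro acts_add N)
  moreover have "two R [^] (2::nat) \<otimes> \<Phi> ?N = (\<Phi> ?N \<oplus> \<Phi> ?N) \<oplus> (\<Phi> ?N \<oplus> \<Phi> ?N)"
    by (rule two_square[OF Nc])
  ultimately show ?thesis
    using acts_unique by metis
qed

text \<open>By \<open>norm_identity\<close>, \<open>4\<close> divides \<open>(u + v) (u - v)\<close> for the trace part \<open>u\<close> and \<open>v\<close> the delta part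
  times \<open>r\<close>. As \<open>2\<close> is primoid, it divides one factor, and then both, since they differ by \<open>2 v\<close>.\<close>

lemma half_exists:
  assumes prim: "primoid R (two R)" and r: "r \<in> carrier R" "r \<otimes> r = discriminant R A n \<theta>"
    and X: "X \<in> carrier AI"
  shows "\<exists>g\<in>carrier R. two R \<otimes> g = trace_part X \<oplus> delta_part X \<otimes> r"
proof -
  let ?u = "trace_part X" and ?v = "delta_part X \<otimes> r" and ?w = "\<Phi> (X \<otimes>\<^bsub>B\<^esub> conjugate X)"
  have uv: "?u \<in> carrier R" "?v \<in> carrier R"
    using X r(1) by auto
  have w: "?w \<in> carrier R"
    using AI_B[OF X] conjugate_closed[OF AI_B[OF X]] by simp
  have "delta_part X \<otimes> delta_part X \<otimes> discriminant R A n \<theta> = ?v \<otimes> ?v"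
    unfolding r(2)[symmetric] using X r(1) by (simp add: R.m_ac)
  moreover have "(x \<oplus> y) \<otimes> (x \<ominus> y) = x \<otimes> x \<ominus> y \<otimes> y" if "x \<in> carrier R" "y \<in> carrier R" for x y
    using that by algebra
  ultimately have "(?u \<oplus> ?v) \<otimes> (?u \<ominus> ?v) = two R [^] (2::nat) \<otimes> ?w"
    using norm_identity[OF X] uv by simp
  then have "(two R [^] (2::nat)) divides\<^bsub>R\<^esub> ((?u \<oplus> ?v) \<otimes> (?u \<ominus> ?v))"
    using w by (auto simp: factor_def)
  then have "two R divides\<^bsub>R\<^esub> (?u \<oplus> ?v) \<or> two R divides\<^bsub>R\<^esub> (?u \<ominus> ?v)"
    using prim uv unfolding primoid_def by (meson R.a_closed R.minus_closed)
  then show ?thesis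
  proof
    assume "two R divides\<^bsub>R\<^esub> (?u \<oplus> ?v)"
    then show ?thesis by (auto simp: factor_def)
  next
    assume "two R divides\<^bsub>R\<^esub> (?u \<ominus> ?v)"
    then obtain g where g: "g \<in> carrier R" "?u \<ominus> ?v = two R \<otimes> g" by (auto simp: factor_def)
    \<comment> \<open>The two factors differ by twice \<open>v\<close>.\<close>
    have "two R \<otimes> (g \<oplus> ?v) = (?u \<ominus> ?v) \<oplus> (?v \<oplus> ?v)"
      using g uv two_closed by (simp add: R.r_distr two_double)
    also have "\<dots> = ?u \<oplus> ?v"
      using uv by (simp add: a_minus_def R.a_assoc R.r_neg1)
    finally show ?thesis using g uv by blast
  qed
qed

text \<open>The closure datum belonging to a square root \<open>r\<close>; the half is unique because \<open>2\<close> is a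
  non-zero-divisor.\<close>

definition half_datum where
  "half_datum r = (\<lambda>X\<in>carrier AI. THE g. g \<in> carrier R \<and> two R \<otimes> g = trace_part X \<oplus> delta_part X \<otimes> r)"

context
  fixes r
  assumes prim: "primoid R (two R)" and r: "r \<in> carrier R" "r \<otimes> r = discriminant R A n \<theta>"
begin

lemma half_datum:
  assumes X: "X \<in> carrier AI"
  shows "half_datum r X \<in> carrier R" "two R \<otimes> half_datum r X = trace_part X \<oplus> delta_part X \<otimes> r"
proof -
  obtain g where g: "g \<in> carrier R" "two R \<otimes> g = trace_part X \<oplus> delta_part X \<otimes> r"
    using half_exists[OF prim r X] by blast
  have "half_datum r X = (THE g. g \<in> carrier R \<and> two R \<otimes> g = trace_part X \<oplus> delta_part X \<otimes> r)"
    unfolding half_datum_def using X by simp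
  also have "\<dots> = g"
  proof (rule the_equality)
    fix g' assume "g' \<in> carrier R \<and> two R \<otimes> g' = trace_part X \<oplus> delta_part X \<otimes> r"
    then show "g' = g"
      using two_inj[of g' g] g by simp
  qed (use g in simp)
  finally have "half_datum r X = g" .
  then show "half_datum r X \<in> carrier R" "two R \<otimes> half_datum r X = trace_part X \<oplus> delta_part X \<otimes> r"
    using g by simp_all
qed

lemma half_datum_eqI:
  assumes "X \<in> carrier AI" "g \<in> carrier R" "two R \<otimes> g = trace_part X \<oplus> delta_part X \<otimes> r"
  shows "half_datum r X = g"
  by (rule two_inj) (simp_all add: half_datum assms)

lemma half_datum_symmetric:
  assumes z: "symmetric_tensor z"
  shows "half_datum r z = \<Phi> z"
  using parts_symmetric[OF z] r symmetric_B[OF z] two_closed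
  by (intro half_datum_eqI symmetric_AI[OF z]) auto

lemma half_datum_delta: "half_datum r \<delta> = r"
  using parts_delta r two_closed by (intro half_datum_eqI delta_AI) auto

lemma half_datum_add:
  assumes X: "X \<in> carrier AI" and Y: "Y \<in> carrier AI"
  shows "half_datum r (X \<oplus>\<^bsub>B\<^esub> Y) = half_datum r X \<oplus> half_datum r Y"
  using half_datum[OF X] half_datum[OF Y] parts_ops[OF X Y] X Y r two_closed
  by (intro half_datum_eqI AI_closed) (auto simp: R.r_distr R.l_distr R.a_ac)

lemma half_datum_smult:
  assumes X: "X \<in> carrier AI" and c: "c \<in> carrier R"
  shows "half_datum r (c \<odot>\<^bsub>B\<^esub> X) = c \<otimes> half_datum r X"
proof (rule half_datum_eqI)
  have "two R \<otimes> (c \<otimes> half_datum r X) = c \<otimes> (trace_part X \<oplus> delta_part X \<otimes> r)"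
    using half_datum[OF X] c two_closed R.m_lcomm[of "two R" c "half_datum r X"] by simp
  also have "\<dots> = trace_part (c \<odot>\<^bsub>B\<^esub> X) \<oplus> delta_part (c \<odot>\<^bsub>B\<^esub> X) \<otimes> r"
    using parts_ops[OF X X] X c r by (simp add: R.r_distr R.m_assoc)
  finally show "two R \<otimes> (c \<otimes> half_datum r X) = trace_part (c \<odot>\<^bsub>B\<^esub> X) \<oplus> delta_part (c \<odot>\<^bsub>B\<^esub> X) \<otimes> r" .
qed (use half_datum[OF X] c X in \<open>auto intro: AI_closed\<close>)

lemma half_datum_mult:
  assumes X: "X \<in> carrier AI" and Y: "Y \<in> carrier AI"
  shows "half_datum r (X \<otimes>\<^bsub>B\<^esub> Y) = half_datum r X \<otimes> half_datum r Y"
proof (rule half_datum_eqI)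
  let ?h = "half_datum r" and ?d = "discriminant R A n \<theta>"
  have XY: "X \<otimes>\<^bsub>B\<^esub> Y \<in> carrier AI" by (rule AI_closed(1)[OF X Y])
  have hc: "?h X \<in> carrier R" "?h Y \<in> carrier R"
    using half_datum X Y by auto
  have pc: "trace_part X \<in> carrier R" "trace_part Y \<in> carrier R"
      "delta_part X \<in> carrier R" "delta_part Y \<in> carrier R"
    using X Y by auto
  have "two R \<otimes> (two R \<otimes> (?h X \<otimes> ?h Y)) = (two R \<otimes> ?h X) \<otimes> (two R \<otimes> ?h Y)"
    using hc two_closed by (simp add: R.m_ac)
  also have "\<dots> = (trace_part X \<oplus> delta_part X \<otimes> r) \<otimes> (trace_part Y \<oplus> delta_part Y \<otimes> r)"
    using half_datum X Y by simp
  also have "\<dots> = (trace_part X \<otimes> trace_part Y \<oplus> delta_part X \<otimes> delta_part Y \<otimes> (r \<otimes> r))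
      \<oplus> (trace_part X \<otimes> delta_part Y \<oplus> delta_part X \<otimes> trace_part Y) \<otimes> r"
    using pc r(1) by algebra
  also have "\<dots> = two R \<otimes> trace_part (X \<otimes>\<^bsub>B\<^esub> Y) \<oplus> (two R \<otimes> delta_part (X \<otimes>\<^bsub>B\<^esub> Y)) \<otimes> r"
    unfolding r(2) trace_part_mult[OF X Y] delta_part_mult[OF X Y] ..
  also have "\<dots> = two R \<otimes> (trace_part (X \<otimes>\<^bsub>B\<^esub> Y) \<oplus> delta_part (X \<otimes>\<^bsub>B\<^esub> Y) \<otimes> r)"
    using XY r(1) two_closed by (simp add: R.r_distr R.m_assoc)
  finally show "two R \<otimes> (?h X \<otimes> ?h Y) = trace_part (X \<otimes>\<^bsub>B\<^esub> Y) \<oplus> delta_part (X \<otimes>\<^bsub>B\<^esub> Y) \<otimes> r"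
    by (rule two_inj[rotated 2]) (use hc XY r(1) two_closed in auto)
qed (use half_datum X Y in \<open>auto intro: AI_closed\<close>)

lemma half_datum_closure: "half_datum r \<in> alt_closure_data R A n \<theta>"
proof -
  have "half_datum r \<in> ring_hom AI R"
  proof (rule ring_hom_memI, unfold AI_simps)
    show "half_datum r \<one>\<^bsub>B\<^esub> = \<one>"
      using half_datum_symmetric[OF symmetric_closed(4)] Phi_one by simp
  qed (simp_all add: half_datum half_datum_mult half_datum_add)
  moreover have "half_datum r \<in> extensional (carrier AI)"
    unfolding half_datum_def by simp
  moreover have "half_datum r (elem_sym R A n k a) = char_coeff R A n \<theta> k a"
    if "a \<in> carrier A" "k \<in> {1..n}" for a k
    using half_datum_symmetric[OF symmetric_elem_sym[OF that(1)]] Phi_elem_sym[OF that] by simp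
  ultimately show ?thesis
    using half_datum_smult by (simp add: alt_closure_data_def algebra_homs_to_base_def AI_simps)
qed

end

lemma closure_datum_root:
  assumes \<phi>: "\<phi> \<in> alt_closure_data R A n \<theta>"
  shows "\<phi> \<delta> \<in> carrier R" "\<phi> \<delta> \<otimes> \<phi> \<delta> = discriminant R A n \<theta>"
proof -
  have hom: "\<phi> \<in> ring_hom AI R"
    using \<phi> by (auto simp: alt_closure_data_def algebra_homs_to_base_def)
  show "\<phi> \<delta> \<in> carrier R"
    by (rule ring_hom_closed[OF hom delta_AI])
  have "symmetric_tensor (\<delta> \<otimes>\<^bsub>B\<^esub> \<delta>)"
    using antisymmetric_delta
    by (auto simp: symmetric_tensor_def antisymmetric_tensor_def act_mult B.sign_act B.l_minus B.r_minus)
  then have "\<phi> (\<delta> \<otimes>\<^bsub>B\<^esub> \<delta>) = discriminant R A n \<theta>"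
    using closure_datum_symmetric[OF \<phi>] acts_unique[OF acts_delta_square] by simp
  then show "\<phi> \<delta> \<otimes> \<phi> \<delta> = discriminant R A n \<theta>"
    using ring_hom_mult[OF hom delta_AI delta_AI] by (simp add: AI_simps)
qed

lemma closure_datum_determined:
  assumes \<phi>: "\<phi> \<in> alt_closure_data R A n \<theta>" and \<psi>: "\<psi> \<in> alt_closure_data R A n \<theta>" and eq: "\<phi> \<delta> = \<psi> \<delta>"
  shows "\<phi> = \<psi>"
proof (rule extensionalityI)
  show "\<phi> \<in> extensional (carrier AI)" "\<psi> \<in> extensional (carrier AI)"
    using \<phi> \<psi> by (auto simp: alt_closure_data_def algebra_homs_to_base_def)
  fix X assume X: "X \<in> carrier AI"
  show "\<phi> X = \<psi> X"
  proof (rule two_inj)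
    show "\<phi> X \<in> carrier R" "\<psi> X \<in> carrier R"
      using \<phi> \<psi> X by (auto simp: alt_closure_data_def algebra_homs_to_base_def intro: ring_hom_closed)
    show "two R \<otimes> \<phi> X = two R \<otimes> \<psi> X"
      unfolding closure_datum_double[OF \<phi> X] closure_datum_double[OF \<psi> X] eq ..
  qed
qed

lemma bij_closure_data_roots:
  assumes prim: "primoid R (two R)"
  shows "bij_betw (\<lambda>\<phi>. \<phi> \<delta>) (alt_closure_data R A n \<theta>) (square_roots R (discriminant R A n \<theta>))"
proof (rule bij_betwI')
  have sq: "x [^] (2::nat) = x \<otimes> x" if "x \<in> carrier R" for x
    using that by (simp add: numeral_2_eq_2)
  show "\<phi> \<delta> = \<psi> \<delta> \<longleftrightarrow> \<phi> = \<psi>"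
    if "\<phi> \<in> alt_closure_data R A n \<theta>" "\<psi> \<in> alt_closure_data R A n \<theta>" for \<phi> \<psi>
    using closure_datum_determined[OF that] by blast
  show "\<phi> \<delta> \<in> square_roots R (discriminant R A n \<theta>)" if "\<phi> \<in> alt_closure_data R A n \<theta>" for \<phi>
    using closure_datum_root[OF that] sq by (simp add: square_roots_def)
  fix r assume "r \<in> square_roots R (discriminant R A n \<theta>)"
  then have r: "r \<in> carrier R" "r \<otimes> r = discriminant R A n \<theta>"
    using sq by (auto simp: square_roots_def)
  show "\<exists>\<phi>\<in>alt_closure_data R A n \<theta>. r = \<phi> \<delta>"
  proof (rule bexI)
    show "r = half_datum r \<delta>" by (rule half_datum_delta[OF prim r, symmetric])
    show "half_datum r \<in> alt_closure_data R A n \<theta>" by (rule half_datum_closure[OF prim r])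
  qed
qed

end

end

theorem theorem6p5:
  fixes R :: "('a, 'm) ring_scheme"
    and A :: "('a, 'b, 'k) module_scheme"
    and n :: nat
    and \<theta> :: "nat \<Rightarrow> 'b"
  assumes "algebra R A"
    and "primoid R (two R)"
    and "non_zero_divisor R (two R)"
    and "module_basis R A n \<theta>"
    and "n \<ge> 2"
  shows "bij_betw (\<lambda>\<phi>. \<phi> (alt_element R A n \<theta>))
    (alt_closure_data R A n \<theta>)
    (square_roots R (discriminant R A n \<theta>))"
proof -
  interpret two_regular_algebra R A n \<theta>
    using assms(1,3,4)
    by (intro two_regular_algebra.intro based_algebra.intro two_regular_algebra_axioms.intro
        based_algebra_axioms.intro algebra.R_cring algebra.M_cring)
  show ?thesis
    by (rule bij_closure_data_roots[OF assms(5,2)])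
qed

end
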